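(* Let $\alpha\in\mathbb{R}$ and $q_0\in L^2(0,\pi)$. Then: $(1^o)$ For any $k\ge1$ and $\lambda=\lambda_k(q_0)$, problem $(NP_\delta)$ with $\delta=1$ has no non-zero weak solution with $k-1$ or fewer roots in $(0,\pi)$, and problem $(NP_\delta)$ with $\delta=-1$ has no non-zero weak solution with $k-1$ or more roots in $(0,\pi)$. $(2^o)$ For any $k\ge1$ and any $\lambda\in(\lambda_{k-1}(q_0),\lambda_k(q_0))$, problem $(NP_\delta)$ with $\delta=1$ possesses an infinite sequence of distinct weak solutions $(u_\delta^l)_{l=k}^\infty$. Moreover, for each $l=k,k+1,\ldots$, $u_\delta^l$ has precisely $l-1$ roots in $(0,\pi)$. $(3^o)$ For any $k\ge1$ and any $\lambda\in(\lambda_k(q_0),\lambda_{k+1}(q_0))$, problem $(NP_\delta)$ with $\delta=-1$ possesses at least $k$ distinct weak solutions $(u_\delta^l)_{l=1}^k$. Moreover, for each $l=1,\ldots,k$, $u_\delta^l$ has precisely $l-1$ roots in $(0,\pi)$. Here $\lambda_0(q_0):=-\infty$.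
   Context: $L^2(0,\pi)$ is the space of real-valued square-integrable functions. Fix $\alpha\in\mathbb{R}$. For $q\in L^2(0,\pi)$, $\mathcal{L}[q]$ denotes the self-adjoint Sturm–Liouville operator on $L^2(0,\pi)$ given by $\mathcal{L}[q]u=-u''+q(x)u$ subject to the separated boundary conditions $$u(0)\cos\alpha+u'(0)\sin\alpha=0,\qquad u(\pi)\cos\alpha+u'(\pi)\sin\alpha=0.$$ Its spectrum is a sequence of simple eigenvalues $\lambda_1(q)<\lambda_2(q)<\cdots$. For $\lambda\in\mathbb{R}$ and $\delta\in\{1,-1\}$, $(NP_\delta)$ denotes the nonlinear boundary value problem $$-u''+q_0(x)u=\lambda u+\delta u^3,\quad x\in(0,\pi),$$ $$u(0)\cos\alpha+u'(0)\sin\alpha=0,\qquad u(\pi)\cos\alpha+u'(\pi)\sin\alpha=0.$$ Weak solutions are understood in the standard sense (equivalently, $u\in W^{2,2}(0,\pi)$ satisfying the equation a.e. and the boundary conditions). *)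

theory Defs
  imports "HOL-Analysis.Analysis"
begin

definition L2 :: "(real \<Rightarrow> real) set" where
  "L2 = {f \<in> borel_measurable (lebesgue_on {0<..<pi}).
           integrable (lebesgue_on {0<..<pi}) (\<lambda>x. (f x)\<^sup>2)}"

(* C^1 with compact support in (0,pi); this yields the same weak derivatives as smooth ones. *)
definition test_functions :: "(real \<Rightarrow> real) set" where
  "test_functions = {\<phi>. \<phi> C1_differentiable_on UNIV \<and>
     (\<exists>a b. 0 < a \<and> b < pi \<and> (\<forall>x. x \<notin> {a..b} \<longrightarrow> \<phi> x = 0))}"

definition weak_derivative :: "(real \<Rightarrow> real) \<Rightarrow> (real \<Rightarrow> real) \<Rightarrow> bool" where
  "weak_derivative u v \<longleftrightarrow> (\<forall>\<phi>\<in>test_functions.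
     (LINT x|lebesgue_on {0<..<pi}. u x * deriv \<phi> x) =
     - (LINT x|lebesgue_on {0<..<pi}. v x * \<phi> x))"

(* u is the continuous representative, on [0,pi], of an element of W^{2,2}(0,pi), v that of its
   first derivative (both exist and are unique by the Sobolev embedding into C^1[0,pi]), and w a
   representative of its second derivative.  Hence u 0, u pi, v 0, v pi are the boundary traces,
   and the zeros of u are well defined.  Values outside [0,pi] carry no information. *)
definition W22 :: "(real \<Rightarrow> real) \<Rightarrow> (real \<Rightarrow> real) \<Rightarrow> (real \<Rightarrow> real) \<Rightarrow> bool" where
  "W22 u v w \<longleftrightarrow> u \<in> L2 \<and> v \<in> L2 \<and> w \<in> L2 \<and>
     weak_derivative u v \<and> weak_derivative v w \<and>
     continuous_on {0..pi} u \<and> continuous_on {0..pi} v"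

(* The graph of the operator: u lies in the domain and  - u'' + q u = f  almost everywhere. *)
definition SL_operator ::
    "real \<Rightarrow> (real \<Rightarrow> real) \<Rightarrow> (real \<Rightarrow> real) \<Rightarrow> (real \<Rightarrow> real) \<Rightarrow> bool" where
  "SL_operator \<alpha> q u f \<longleftrightarrow> (\<exists>v w. W22 u v w \<and>
     u 0 * cos \<alpha> + v 0 * sin \<alpha> = 0 \<and>
     u pi * cos \<alpha> + v pi * sin \<alpha> = 0 \<and>
     (AE x in lebesgue_on {0<..<pi}. - w x + q x * u x = f x))"

definition nonzero :: "(real \<Rightarrow> real) \<Rightarrow> bool" where
  "nonzero u \<longleftrightarrow> (\<exists>x\<in>{0..pi}. u x \<noteq> 0)"

definition SL_eigenvalues :: "real \<Rightarrow> (real \<Rightarrow> real) \<Rightarrow> real set" where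
  "SL_eigenvalues \<alpha> q = {\<mu>. \<exists>u. nonzero u \<and> SL_operator \<alpha> q u (\<lambda>x. \<mu> * u x)}"

(* The k-th smallest eigenvalue for k \<ge> 1.  The eigenvalues are simple, so that counting them
   without multiplicity agrees with the usual numbering. *)
definition SL_eigenvalue :: "real \<Rightarrow> (real \<Rightarrow> real) \<Rightarrow> nat \<Rightarrow> ereal" where
  "SL_eigenvalue \<alpha> q k = (if k = 0 then - \<infinity> else
     ereal (THE \<mu>. \<mu> \<in> SL_eigenvalues \<alpha> q \<and>
       finite {\<nu> \<in> SL_eigenvalues \<alpha> q. \<nu> < \<mu>} \<and>
       card {\<nu> \<in> SL_eigenvalues \<alpha> q. \<nu> < \<mu>} = k - 1))"

definition NP_solution ::
    "real \<Rightarrow> (real \<Rightarrow> real) \<Rightarrow> real \<Rightarrow> real \<Rightarrow> (real \<Rightarrow> real) \<Rightarrow> bool" where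
  "NP_solution \<alpha> q0 lam \<delta> u \<longleftrightarrow> SL_operator \<alpha> q0 u (\<lambda>x. lam * u x + \<delta> * (u x) ^ 3)"

definition roots :: "(real \<Rightarrow> real) \<Rightarrow> real set" where
  "roots u = {x \<in> {0<..<pi}. u x = 0}"

definition pairwise_distinct :: "nat set \<Rightarrow> (nat \<Rightarrow> real \<Rightarrow> real) \<Rightarrow> bool" where
  "pairwise_distinct I u \<longleftrightarrow>
     (\<forall>l\<in>I. \<forall>m\<in>I. l \<noteq> m \<longrightarrow> (\<exists>x\<in>{0..pi}. u l x \<noteq> u m x))"

end

theory Submission
  imports Defs
begin

text \<open>
  With \<open>Q\<close> the indefinite integral of \<open>q0\<close>, \<open>H\<close> the sum of \<open>Q\<close> and an affine function, and
  \<open>h' = H\<close>, put \<open>u = exp h * v\<close> and \<open>y = exp (2 * h) * v'\<close>. The equation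
  \<open>- u'' + q0 * u = lam * u + \<delta> * u^3\<close> becomes a planar system
  \<open>v' = P * y\<close>, \<open>y' = - (R + lam * W + \<delta> * S * v^2) * v\<close> with continuous coefficients, in which
  \<open>q0\<close> occurs only through \<open>Q\<close>. In polar coordinates a nonzero solution is one whose angle runs from
  a fixed start angle to a fixed end angle plus \<open>n * pi\<close>, and \<open>n\<close> is its number of roots.
  Sturm comparison of this angle with that of the linear problem gives the nonexistence statements and
  identifies the eigenvalues.

  For existence, the nonlinearity is truncated and one shoots with the amplitude \<open>s\<close> as parameter:
  for \<open>s = 0\<close> the final angle is that of the linear problem; for large \<open>s\<close> it is large if \<open>\<delta> = 1\<close> and
  small if \<open>\<delta> = - 1\<close>. Solutions with a prescribed final angle are bounded independently of the truncation,
  by an energy estimate if \<open>\<delta> = 1\<close> and by a maximum principle if \<open>\<delta> = - 1\<close>.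
\<close>

subsection \<open>Differential inequalities and initial value problems\<close>

text \<open>The obstacle is that \<open>q0\<close> is only square integrable: \<open>u''\<close>
  need not be continuous, so classical existence theory and pointwise derivative arguments do not
  apply to the equation as it stands. The transformation turns weak solutions into classical
  solutions of a system with continuous coefficients.

  A nonlinear solution is treated as a solution of the linear system whose potential is frozen along
  it, so comparison and root counting are needed for linear systems only. The angle has derivative
  \<open>P > 0\<close> whenever it is a multiple of \<open>pi\<close>, whatever the potential; this
  is why it counts roots.

  The truncation caps \<open>v^2 + y^2\<close> and not \<open>v^2\<close>. This makes the equations
  globally Lipschitz in the angle and the logarithm of the radius. For large amplitude the cap is
  attained on all of \<open>[0, pi]\<close>; the potential then depends on \<open>x\<close> and the
  angle alone, and its rotation can be estimated directly.\<close>

lemma has_real_derivative_cong_on: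
  assumes "x \<in> S" "\<And>y. y \<in> S \<Longrightarrow> g y = f y" "(f has_real_derivative D) (at x within S)"
  shows "(g has_real_derivative D) (at x within S)"
  using has_vector_derivative_transform[OF assms(1,2)] assms(3)
  by (simp add: has_real_derivative_iff_has_vector_derivative)

lemma derivative_le_imp_le:
  fixes f :: "real \<Rightarrow> real"
  assumes "\<And>x. x \<in> {a..b} \<Longrightarrow> (f has_real_derivative f' x) (at x within {a..b})"
    and "\<And>x. x \<in> {a..b} \<Longrightarrow> f' x \<le> c"
    and "a \<le> x" "x \<le> y" "y \<le> b"
  shows "f y - f x \<le> c * (y - x)"
proof -
  have "\<exists>t\<in>{x..y}. f y - f x = f' t * (y - x)"
  proof (rule mvt_very_simple[OF \<open>x \<le> y\<close>, of f "\<lambda>t h. f' t * h"])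
    fix t assume "x \<le> t" "t \<le> y"
    then have "(f has_real_derivative f' t) (at t within {x..y})"
      using assms by (intro DERIV_subset[OF assms(1)]) auto
    then show "(f has_derivative (\<lambda>h. f' t * h)) (at t within {x..y})"
      by (simp add: has_field_derivative_def)
  qed
  then obtain t where "t \<in> {x..y}" "f y - f x = f' t * (y - x)" ..
  moreover from this have "f' t * (y - x) \<le> c * (y - x)"
    using assms by (intro mult_right_mono) auto
  ultimately show ?thesis by simp
qed

lemma derivative_nonneg_imp_mono:
  fixes f :: "real \<Rightarrow> real"
  assumes "\<And>x. x \<in> {a..b} \<Longrightarrow> (f has_real_derivative f' x) (at x within {a..b})"
    and "\<And>x. x \<in> {a..b} \<Longrightarrow> 0 \<le> f' x"
    and "a \<le> x" "x \<le> y" "y \<le> b"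
  shows "f x \<le> f y"
  using derivative_le_imp_le[of a b "\<lambda>x. - f x" "\<lambda>x. - f' x" 0 x y] assms
  by (auto intro!: derivative_eq_intros)

text \<open>After multiplication by the integrating factor \<open>exp (- k (t - a))\<close> the
  derivative is at most \<open>e\<close> times that factor. Bounding the factor by 1 gives the term
  \<open>e * (x - a)\<close>, which also makes sense for \<open>k = 0\<close>.\<close>

lemma gronwall:
  fixes f :: "real \<Rightarrow> real"
  assumes der: "\<And>x. x \<in> {a..b} \<Longrightarrow> (f has_real_derivative f' x) (at x within {a..b})"
    and bd: "\<And>x. x \<in> {a..b} \<Longrightarrow> f' x \<le> k * f x + e"
    and ke: "0 \<le> k" "0 \<le> e" and x: "x \<in> {a..b}"
  shows "f x \<le> (f a + e * (x - a)) * exp (k * (x - a))"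
proof -
  define g where "g t = f t * exp (- (k * (t - a))) - e * (t - a)" for t
  have "g x - g a \<le> 0 * (x - a)"
  proof (rule derivative_le_imp_le[of a b g])
    fix t assume t: "t \<in> {a..b}"
    show "(g has_real_derivative (f' t - k * f t) * exp (- (k * (t - a))) - e) (at t within {a..b})"
      unfolding g_def using der[OF t] by (auto intro!: derivative_eq_intros simp: algebra_simps)
    have "(f' t - k * f t) * exp (- (k * (t - a))) \<le> e * exp (- (k * (t - a)))"
      using bd[OF t] by (intro mult_right_mono) auto
    also have "\<dots> \<le> e * 1"
      using ke t by (intro mult_left_mono) auto
    finally show "(f' t - k * f t) * exp (- (k * (t - a))) - e \<le> 0" by simp
  qed (use x in auto)
  then have "f x * exp (- (k * (x - a))) \<le> f a + e * (x - a)" by (simp add: g_def)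
  then have "f x * exp (- (k * (x - a))) * exp (k * (x - a)) \<le> (f a + e * (x - a)) * exp (k * (x - a))"
    by (intro mult_right_mono) auto
  then show ?thesis by (simp add: mult.assoc flip: exp_add)
qed

lemma gronwall_backward:
  fixes f :: "real \<Rightarrow> real"
  assumes der: "\<And>x. x \<in> {a..b} \<Longrightarrow> (f has_real_derivative f' x) (at x within {a..b})"
    and bd: "\<And>x. x \<in> {a..b} \<Longrightarrow> - f' x \<le> k * f x + e"
    and ke: "0 \<le> k" "0 \<le> e" and x: "x \<in> {a..b}"
  shows "f x \<le> (f b + e * (b - x)) * exp (k * (b - x))"
proof -
  have "(f \<circ> uminus) (- x) \<le> ((f \<circ> uminus) (- b) + e * (- x - - b)) * exp (k * (- x - - b))"
  proof (rule gronwall[where b="- a" and f'="\<lambda>t. - f' (- t)"])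
    fix t assume t: "t \<in> {- b..- a}"
    have im: "uminus ` {- b..- a} = {a..b}" by (simp add: image_uminus_atLeastAtMost)
    have "(f \<circ> uminus has_real_derivative f' (- t) * - 1) (at t within {- b..- a})"
      by (rule DERIV_image_chain) (use der[of "- t"] t in \<open>auto simp: im intro!: derivative_eq_intros\<close>)
    then show "(f \<circ> uminus has_real_derivative - f' (- t)) (at t within {- b..- a})" by simp
    show "- f' (- t) \<le> k * (f \<circ> uminus) t + e" using bd[of "- t"] t by auto
  qed (use ke x in auto)
  then show ?thesis by simp
qed

text \<open>At the first point where \<open>g\<close> ceases to be positive, \<open>g\<close>
  vanishes and its values to the left are positive, yet the positive derivative there makes them
  negative. This drives both the passage of an angle through multiples of \<open>pi\<close> and the
  barrier for decreasing angles.\<close>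

lemma pos_if_upcrossing:
  fixes g :: "real \<Rightarrow> real"
  assumes cont: "continuous_on {a..b} g"
    and up: "\<And>x. x \<in> {a..b} \<Longrightarrow> g x = 0 \<Longrightarrow>
      \<exists>D>0. (g has_real_derivative D) (at x within {a..b})"
    and "0 \<le> g a" "a < x" "x \<le> b"
  shows "0 < g x"
proof (rule ccontr)
  assume neg: "\<not> 0 < g x"
  obtain x0 where x0: "a \<le> x0" "x0 < x" "0 < g x0"
  proof (cases "g a = 0")
    case True
    have "a \<in> {a..b}" using assms by auto
    from up[OF this True] obtain D where "D > 0" "(g has_real_derivative D) (at a within {a..b})"
      by blast
    from has_real_derivative_pos_inc_right[OF this(2,1)] obtain d
      where d: "d > 0" "\<And>h. h > 0 \<Longrightarrow> a + h \<in> {a..b} \<Longrightarrow> h < d \<Longrightarrow> g a < g (a + h)" by auto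
    define h where "h = min (d / 2) ((x - a) / 2)"
    have "h > 0" "h < d" "a + h < x" using d(1) \<open>a < x\<close> by (auto simp: h_def min_def field_simps)
    with d(2)[of h] True \<open>x \<le> b\<close> show ?thesis by (intro that[of "a + h"]) auto
  next
    case False
    with assms show ?thesis by (intro that[of a]) auto
  qed
  define Z where "Z = {t \<in> {x0..x}. g t \<le> 0}"
  have "continuous_on {x0..x} g"
    using x0 \<open>x \<le> b\<close> by (auto intro: continuous_on_subset[OF cont])
  then have "closed Z"
    
    using continuous_closed_preimage[of "{x0..x}" g "{..0}"]
    by (simp add: Z_def vimage_def Int_def)
  then have Z: "closed Z" "x \<in> Z" "bdd_below Z"
    using neg x0 by (auto simp: Z_def intro!: bdd_belowI)
  define c where "c = Inf Z"
  have "c \<in> Z" unfolding c_def using Z by (intro closed_contains_Inf) auto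
  then have c: "x0 < c" "c \<le> x" "g c \<le> 0" using x0 by (auto simp: Z_def less_le)
  have before: "0 < g t" if "x0 \<le> t" "t < c" for t
    using cInf_lower[OF _ Z(3), of t] that c by (force simp: Z_def c_def)
  have gc: "g c = 0"
  proof (rule antisym[OF c(3)])
    have "\<exists>t\<ge>x0. t \<le> c \<and> g t = 0"
      using c x0 \<open>x \<le> b\<close> by (intro IVT2') (auto intro: continuous_on_subset[OF cont])
    then show "0 \<le> g c" using before by force
  qed
  from up[of c] gc c x0 \<open>x \<le> b\<close> obtain D where "D > 0" "(g has_real_derivative D) (at c within {a..b})"
    by auto
  from has_real_derivative_pos_inc_left[OF this(2,1)] obtain d
    where d: "d > 0" "\<And>h. h > 0 \<Longrightarrow> c - h \<in> {a..b} \<Longrightarrow> h < d \<Longrightarrow> g (c - h) < g c" by auto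
  define h where "h = min (d / 2) ((c - x0) / 2)"
  have "h > 0" "h < d" "x0 < c - h" using d(1) c by (auto simp: h_def min_def field_simps)
  with d(2)[of h] before[of "c - h"] gc c x0 \<open>x \<le> b\<close> show False by auto
qed

text \<open>A continuity argument: the first point where \<open>f\<close> reaches \<open>c\<close>
  satisfies the premise of the improvement, which makes \<open>f\<close> strictly smaller there. It
  is needed because the energy estimate holds only as long as the truncation is not active.\<close>

lemma less_if_bound_improves:
  fixes f :: "real \<Rightarrow> real"
  assumes cont: "continuous_on {a..b} f" and a: "f a < c"
    and imp: "\<And>t. t \<in> {a..b} \<Longrightarrow> (\<And>s. s \<in> {a..t} \<Longrightarrow> f s \<le> c) \<Longrightarrow> f t < c"
    and t: "t \<in> {a..b}"
  shows "f t < c"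
proof (rule ccontr)
  assume "\<not> f t < c"
  define Z where "Z = {s \<in> {a..t}. c \<le> f s}"
  have "continuous_on {a..t} f" using cont t by (auto intro: continuous_on_subset)
  then have "closed Z"
    using continuous_closed_preimage[of "{a..t}" f "{c..}"] by (simp add: Z_def vimage_def Int_def)
  moreover have "t \<in> Z" "bdd_below Z"
    using \<open>\<not> f t < c\<close> t by (auto simp: Z_def intro!: bdd_belowI)
  ultimately have "Inf Z \<in> Z" by (intro closed_contains_Inf) auto
  define z where "z = Inf Z"
  have z: "a \<le> z" "z \<le> t" "c \<le> f z" using \<open>Inf Z \<in> Z\<close> by (auto simp: Z_def z_def)
  have before: "f s < c" if "a \<le> s" "s < z" for s
    using cInf_lower[OF _ \<open>bdd_below Z\<close>, of s] that z by (force simp: Z_def z_def)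
  obtain s where s: "a \<le> s" "s \<le> z" "f s = c"
    using IVT'[of f a c z] a z t continuous_on_subset[OF cont, of "{a..z}"] by force
  have "f z = c" using before[of s] s by (cases "s < z") auto
  then have "f s \<le> c" if "s \<in> {a..z}" for s
    using before[of s] that by (cases "s < z") auto
  from imp[OF _ this] have "f z < c" using z t by auto
  with z show False by simp
qed

lemma less_if_bound_improves_backward:
  fixes f :: "real \<Rightarrow> real"
  assumes cont: "continuous_on {a..b} f" and b: "f b < c"
    and imp: "\<And>t. t \<in> {a..b} \<Longrightarrow> (\<And>s. s \<in> {t..b} \<Longrightarrow> f s \<le> c) \<Longrightarrow> f t < c"
    and t: "t \<in> {a..b}"
  shows "f t < c"
proof -
  have "(\<lambda>x. f (- x)) (- t) < c"
  proof (rule less_if_bound_improves[where a="- b" and b="- a" and f="\<lambda>x. f (- x)"])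
    show "continuous_on {- b..- a} (\<lambda>x. f (- x))"
      by (rule continuous_on_compose2[OF cont]) (auto intro!: continuous_intros)
    fix s assume s: "s \<in> {- b..- a}" and le: "\<And>r. r \<in> {- b..s} \<Longrightarrow> f (- r) \<le> c"
    show "f (- s) < c"
    proof (rule imp)
      fix r assume "r \<in> {- s..b}"
      then show "f r \<le> c" using le[of "- r"] by auto
    qed (use s in auto)
  qed (use b t in auto)
  then show ?thesis by simp
qed

section \<open>Initial value problems depending continuously on a parameter\<close>

text \<open>Picard iteration is carried out for all parameters at once, on bounded continuous
  functions of \<open>(p, x)\<close>; continuity of \<open>z p T\<close> in \<open>p\<close> is then
  part of the fixed point. The unknown is \<open>exp (- K x) * z\<close>, so that the map contracts
  on the whole interval without a smallness condition on \<open>T\<close>.\<close>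

lemma ode_solution_with_parameter:
  fixes F :: "real \<Rightarrow> real \<Rightarrow> 'a::euclidean_space \<Rightarrow> 'a"
  assumes AB: "A \<le> B" and T: "0 \<le> T"
    and cont: "continuous_on ({A..B} \<times> {0..T} \<times> UNIV) (\<lambda>(p, x, z). F p x z)"
    and lip: "\<And>p x z z'. p \<in> {A..B} \<Longrightarrow> x \<in> {0..T} \<Longrightarrow> norm (F p x z - F p x z') \<le> L * norm (z - z')"
  obtains z where "\<And>p. p \<in> {A..B} \<Longrightarrow> z p 0 = z0"
    and "\<And>p x. p \<in> {A..B} \<Longrightarrow> x \<in> {0..T} \<Longrightarrow>
      (z p has_vector_derivative F p x (z p x)) (at x within {0..T})"
    and "continuous_on {A..B} (\<lambda>p. z p T)"
proof -
  \<comment> \<open>With \<open>L <= K / 2\<close> the weighted integral operator has Lipschitz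
    constant 1/2; the maximum with 1 keeps \<open>K\<close> positive.\<close>
  define K where "K = 2 * max L 1"
  have K: "K > 0" "L \<le> K / 2" by (auto simp: K_def)
  define D where "D = cbox (A, 0::real) (B, T)"
  have D: "D = {A..B} \<times> {0..T}" by (auto simp: D_def cbox_Pair_eq)
  \<comment> \<open>The integral over \<open>[0, x]\<close> is rescaled to \<open>[0, 1]\<close>, so
    that \<open>P f\<close> is an integral over a constant domain with parameter
    \<open>q = (p, x)\<close> and depends continuously on it.\<close>
  define G where "G f q t = F (fst q) (snd q * t) (exp (K * (snd q * t)) *\<^sub>R f (fst q, snd q * t))"
    for f :: "real \<times> real \<Rightarrow> 'a" and q t
  define P where "P f q = exp (- (K * snd q)) *\<^sub>R (z0 + snd q *\<^sub>R integral (cbox 0 1) (G f q))"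
    for f :: "real \<times> real \<Rightarrow> 'a" and q :: "real \<times> real"
  have scaled: "x * t \<in> {0..T}" if "x \<in> {0..T}" "t \<in> {0..1}" for x t :: real
    using that mult_mono[of x T t 1] by auto
  have contG: "continuous_on (D \<times> cbox 0 1) (\<lambda>(q, t). G f q t)" if "continuous_on D f" for f
  proof -
    have "continuous_on (D \<times> cbox 0 1) (\<lambda>y. f (fst (fst y), snd (fst y) * snd y))"
      by (rule continuous_on_compose2[OF that], intro continuous_intros) (use scaled in \<open>fastforce simp: D\<close>)
    then have "continuous_on (D \<times> cbox 0 1) (\<lambda>y. (fst (fst y), snd (fst y) * snd y,
        exp (K * (snd (fst y) * snd y)) *\<^sub>R f (fst (fst y), snd (fst y) * snd y)))"
      by (intro continuous_intros) auto
    from continuous_on_compose2[OF cont this] show ?thesis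
      using scaled by (fastforce simp: D G_def split_beta)
  qed
  have contP: "continuous_on D (P f)" if "continuous_on D f" for f
    unfolding P_def by (intro continuous_intros integral_continuous_on_param contG that)
  \<comment> \<open>Clamping extends \<open>P f\<close> from the rectangle to the plane, so that the
    contraction acts on the complete space of bounded continuous functions.\<close>
  define \<Phi> where "\<Phi> f = Bcontfun (ext_cont (P (apply_bcontfun f)) (A, 0) (B, T))" for f
  have \<Phi>: "apply_bcontfun (\<Phi> f) = ext_cont (P (apply_bcontfun f)) (A, 0) (B, T)" for f
    unfolding \<Phi>_def
  proof (rule Bcontfun_inverse)
    have c: "continuous_on (cbox (A, 0) (B, T)) (P (apply_bcontfun f))"
      using contP[of "apply_bcontfun f"] by (simp add: D_def)
    then show "ext_cont (P (apply_bcontfun f)) (A, 0) (B, T) \<in> bcontfun"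
      unfolding bcontfun_def mem_Collect_eq ext_cont_def
      by (intro conjI clamp_continuous_on clamp_bounded compact_imp_bounded
          compact_continuous_image compact_cbox)
  qed
  have intG: "G f q integrable_on cbox 0 1" if "continuous_on D f" "q \<in> D" for f q
  proof (rule integrable_continuous)
    have "continuous_on (cbox 0 1) (\<lambda>t. (q, t))" by (intro continuous_intros)
    from continuous_on_compose2[OF contG[OF that(1)] this] that(2) show "continuous_on (cbox 0 1) (G f q)"
      by auto
  qed
  have contr: "dist (P f q) (P g q) \<le> 1/2 * d"
    if f: "continuous_on D f" and g: "continuous_on D g" and d: "\<And>q. dist (f q) (g q) \<le> d"
      and q: "q \<in> D" for f g d q
  proof -
    obtain p x where px: "q = (p, x)" "p \<in> {A..B}" "x \<in> {0..T}" using q by (auto simp: D)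
    have d0: "0 \<le> d" using d[of q] zero_le_dist order_trans by blast
    have E: "((\<lambda>t. x * exp (K * (x * t))) has_integral exp (K * (x * 1)) / K - exp (K * (x * 0)) / K) {0..1}"
      using K(1) by (intro fundamental_theorem_of_calculus)
        (auto intro!: derivative_eq_intros simp flip: has_real_derivative_iff_has_vector_derivative)
    have "norm (x *\<^sub>R integral (cbox 0 1) (\<lambda>t. G f q t - G g q t)) =
        norm (integral (cbox 0 1) (\<lambda>t. x *\<^sub>R (G f q t - G g q t)))" by simp
    also have "\<dots> \<le> integral (cbox 0 1) (\<lambda>t. K / 2 * d * (x * exp (K * (x * t))))"
    proof (rule integral_norm_bound_integral)
      show "(\<lambda>t. x *\<^sub>R (G f q t - G g q t)) integrable_on cbox 0 1"
        by (intro integrable_cmul integrable_diff intG f g q)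
      show "(\<lambda>t. K / 2 * d * (x * exp (K * (x * t)))) integrable_on cbox 0 1"
        by (intro integrable_continuous continuous_intros)
      fix t :: real assume "t \<in> cbox 0 1"
      then have xt: "x * t \<in> {0..T}" using scaled[OF px(3)] by auto
      have "norm (G f q t - G g q t) \<le>
          L * norm (exp (K * (x * t)) *\<^sub>R f (p, x * t) - exp (K * (x * t)) *\<^sub>R g (p, x * t))"
        using lip[OF px(2) xt] by (simp add: G_def px)
      also have "\<dots> = L * (exp (K * (x * t)) * norm (f (p, x * t) - g (p, x * t)))"
        by (simp flip: scaleR_diff_right)
      also have "\<dots> \<le> K / 2 * (exp (K * (x * t)) * d)"
        using K d[of "(p, x * t)"] by (intro mult_mono) (auto simp: dist_norm)
      finally have "x * norm (G f q t - G g q t) \<le> x * (K / 2 * (exp (K * (x * t)) * d))"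
        using px by (intro mult_left_mono) auto
      then show "norm (x *\<^sub>R (G f q t - G g q t)) \<le> K / 2 * d * (x * exp (K * (x * t)))"
        using px by (simp add: mult_ac)
    qed
    also have "\<dots> = K / 2 * d * (exp (K * x) / K - 1 / K)"
      using integral_unique[OF E] by simp
    also have "\<dots> \<le> 1/2 * d * exp (K * x)"
      using K d0 by (simp add: field_simps)
    finally have *: "norm (x *\<^sub>R integral (cbox 0 1) (\<lambda>t. G f q t - G g q t)) \<le> 1/2 * d * exp (K * x)" .
    have "P f q - P g q = exp (- (K * x)) *\<^sub>R (x *\<^sub>R integral (cbox 0 1) (\<lambda>t. G f q t - G g q t))"
      unfolding integral_diff[OF intG[OF f q] intG[OF g q]]
      by (simp add: P_def px algebra_simps)
    then have "dist (P f q) (P g q) = exp (- (K * x)) * norm (x *\<^sub>R integral (cbox 0 1) (\<lambda>t. G f q t - G g q t))"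
      by (simp only: dist_norm norm_scaleR) simp
    also have "\<dots> \<le> exp (- (K * x)) * (1/2 * d * exp (K * x))"
      using * by (intro mult_left_mono) auto
    also have "\<dots> = 1/2 * d" by (simp add: exp_minus field_simps)
    finally show ?thesis .
  qed
  have cl: "clamp (A, 0) (B, T) q \<in> D" for q :: "real \<times> real"
    unfolding D_def by (rule clamp_in_interval) (use AB T in \<open>auto simp: Basis_prod_def\<close>)
  have "\<exists>!f. \<Phi> f = f"
  proof (rule banach_fix_type)
    show "\<forall>f g. dist (\<Phi> f) (\<Phi> g) \<le> 1/2 * dist f g"
    proof (intro allI dist_bound)
      fix f g :: "(real \<times> real) \<Rightarrow>\<^sub>C 'a" and q
      show "dist (\<Phi> f q) (\<Phi> g q) \<le> 1/2 * dist f g"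
        unfolding \<Phi> ext_cont_def by (rule contr) (auto intro: cl dist_bounded)
    qed
  qed auto
  then obtain f where f: "\<Phi> f = f" by auto
  have fP: "f q = P f q" if "q \<in> D" for q
    by (subst f[symmetric], subst \<Phi>) (use that in \<open>simp add: D_def\<close>)
  define z where "z p x = exp (K * x) *\<^sub>R f (p, x)" for p x
  have contz: "continuous_on D (\<lambda>q. z (fst q) (snd q))"
    unfolding z_def by (intro continuous_intros) simp
  show ?thesis
  proof (rule that)
    show "z p 0 = z0" if "p \<in> {A..B}" for p
      using fP[of "(p, 0)"] that T by (simp add: z_def P_def D)
    show "continuous_on {A..B} (\<lambda>p. z p T)"
    proof -
      have "continuous_on {A..B} (\<lambda>p. (p, T))" by (intro continuous_intros)
      moreover have "(\<lambda>p. (p, T)) ` {A..B} \<subseteq> D" using T by (auto simp: D)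
      ultimately have "continuous_on {A..B} ((\<lambda>q. z (fst q) (snd q)) \<circ> (\<lambda>p. (p, T)))"
        using contz by (blast intro: continuous_on_compose continuous_on_subset)
      then show ?thesis by (simp add: o_def)
    qed
    fix p x assume p: "p \<in> {A..B}" and x: "x \<in> {0..T}"
    have "continuous_on {0..T} (\<lambda>t. z p t)"
    proof -
      have "continuous_on {0..T} (\<lambda>t. (p, t))" by (intro continuous_intros)
      moreover have "(\<lambda>t. (p, t)) ` {0..T} \<subseteq> D" using p by (auto simp: D)
      ultimately have "continuous_on {0..T} ((\<lambda>q. z (fst q) (snd q)) \<circ> (\<lambda>t. (p, t)))"
        using contz by (blast intro: continuous_on_compose continuous_on_subset)
      then show ?thesis by (simp add: o_def)
    qed
    then have "continuous_on {0..T} (\<lambda>t. (p, t, z p t))" by (intro continuous_intros)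
    moreover have "(\<lambda>t. (p, t, z p t)) ` {0..T} \<subseteq> {A..B} \<times> {0..T} \<times> UNIV" using p by auto
    ultimately have "continuous_on {0..T} ((\<lambda>(p, x, z). F p x z) \<circ> (\<lambda>t. (p, t, z p t)))"
      using cont by (blast intro: continuous_on_compose continuous_on_subset)
    then have c: "continuous_on {0..T} (\<lambda>t. F p t (z p t))" by (simp add: o_def)
    define H where "H s = integral {0..s} (\<lambda>t. F p t (z p t))" for s
    have H: "(H has_vector_derivative F p s (z p s)) (at s within {0..T})" if "s \<in> {0..T}" for s
      unfolding H_def using that by (rule integral_has_vector_derivative[OF c])
    \<comment> \<open>The fixed point equation lives on \<open>[0, 1]\<close>; the substitution
      \<open>t -> s * t\<close> in the antiderivative \<open>H\<close> brings it back to
      \<open>[0, s]\<close>, where it can be differentiated.\<close>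
    have zH: "z p s = z0 + H s" if s: "s \<in> {0..T}" for s
    proof -
      have "((\<lambda>t. s *\<^sub>R F p (s * t) (z p (s * t))) has_integral (H \<circ> (\<lambda>t. s * t)) 1 - (H \<circ> (\<lambda>t. s * t)) 0) {0..1}"
      proof (rule fundamental_theorem_of_calculus)
        fix t :: real assume t: "t \<in> {0..1}"
        show "((H \<circ> (\<lambda>t. s * t)) has_vector_derivative s *\<^sub>R F p (s * t) (z p (s * t))) (at t within {0..1})"
        proof (rule vector_diff_chain_within)
          show "((\<lambda>t. s * t) has_vector_derivative s) (at t within {0..1})"
            by (auto intro!: derivative_eq_intros simp flip: has_real_derivative_iff_has_vector_derivative)
          show "(H has_vector_derivative F p (s * t) (z p (s * t))) (at (s * t) within (\<lambda>t. s * t) ` {0..1})"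
            using scaled[OF s] by (intro has_vector_derivative_within_subset[OF H[OF scaled[OF s t]]]) blast
        qed
      qed auto
      then have "s *\<^sub>R integral {0..1} (\<lambda>t. F p (s * t) (z p (s * t))) = H s"
        by (auto simp: H_def has_integral_iff)
      moreover have "z p s = z0 + s *\<^sub>R integral {0..1} (\<lambda>t. F p (s * t) (z p (s * t)))"
        using fP[of "(p, s)"] p s by (simp add: z_def P_def G_def[abs_def] D exp_minus)
      ultimately show ?thesis by simp
    qed
    show "(z p has_vector_derivative F p x (z p x)) (at x within {0..T})"
    proof (rule has_vector_derivative_transform[OF x])
      show "((\<lambda>s. z0 + H s) has_vector_derivative F p x (z p x)) (at x within {0..T})"
        using has_vector_derivative_add[OF has_vector_derivative_const H[OF x]] by simp
    qed (rule zH)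
  qed
qed

subsection \<open>Weak derivatives\<close>

lemma integrable_iff_absolutely_integrable:
  fixes f :: "real \<Rightarrow> real"
  shows "integrable (lebesgue_on {a<..<b}) f \<longleftrightarrow> f absolutely_integrable_on {a..b}"
  unfolding absolutely_integrable_on_Icc_iff_Ioo unfolding set_integrable_def
  by (subst integrable_restrict_space) auto

lemma lebesgue_integral_Ioo:
  fixes f :: "real \<Rightarrow> real"
  assumes "f absolutely_integrable_on {a..b}"
  shows "(LINT x|lebesgue_on {a<..<b}. f x) = integral {a..b} f"
  using assms lebesgue_integral_eq_integral[of "{a<..<b}" f]
  by (simp add: integrable_iff_absolutely_integrable integral_open_interval_real)

lemma absolutely_integrable_mult_continuous:
  fixes f g :: "real \<Rightarrow> real"
  assumes "f absolutely_integrable_on {a..b}" "continuous_on {a..b} g"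
  shows "(\<lambda>x. f x * g x) absolutely_integrable_on {a..b}"
proof -
  have "(\<lambda>x. g x * f x) absolutely_integrable_on {a..b}"
    using assms by (intro absolutely_integrable_bounded_measurable_product_real
        continuous_imp_measurable_on_sets_lebesgue compact_imp_bounded compact_continuous_image) auto
  then show ?thesis by (simp add: mult.commute)
qed

lemma continuous_imp_measurable_Ioo:
  fixes g :: "real \<Rightarrow> real"
  shows "continuous_on {a..b} g \<Longrightarrow> g \<in> borel_measurable (lebesgue_on {a<..<b})"
  by (rule continuous_imp_measurable_on_sets_lebesgue) (auto intro: continuous_on_subset)

lemma L2I_bound:
  assumes "f \<in> borel_measurable (lebesgue_on {0<..<pi})" "integrable (lebesgue_on {0<..<pi}) g"
    and "\<And>x. x \<in> {0<..<pi} \<Longrightarrow> (f x)\<^sup>2 \<le> g x"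
  shows "f \<in> L2"
proof -
  have "integrable (lebesgue_on {0<..<pi}) (\<lambda>x. (f x)\<^sup>2)"
  proof (rule Bochner_Integration.integrable_bound[OF assms(2)])
    show "(\<lambda>x. (f x)\<^sup>2) \<in> borel_measurable (lebesgue_on {0<..<pi})" using assms(1) by measurable
    show "AE x in lebesgue_on {0<..<pi}. norm ((f x)\<^sup>2) \<le> norm (g x)"
      using assms(3) by (intro AE_I2) (force simp: space_restrict_space)
  qed
  then show ?thesis using assms(1) by (simp add: L2_def)
qed

lemma continuous_imp_L2:
  assumes "continuous_on {0..pi} g"
  shows "g \<in> L2"
proof (rule L2I_bound)
  show "integrable (lebesgue_on {0<..<pi}) (\<lambda>x. (g x)\<^sup>2)"
    using assms by (auto simp: integrable_iff_absolutely_integrable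
        intro!: absolutely_integrable_continuous_real continuous_intros)
qed (use assms continuous_imp_measurable_Ioo in auto)

lemma L2_diff:
  assumes "f \<in> L2" "g \<in> L2"
  shows "(\<lambda>x. f x - g x) \<in> L2"
proof (rule L2I_bound)
  show "integrable (lebesgue_on {0<..<pi}) (\<lambda>x. 2 * (f x)\<^sup>2 + 2 * (g x)\<^sup>2)"
    using assms by (auto simp: L2_def)
  show "(f x - g x)\<^sup>2 \<le> 2 * (f x)\<^sup>2 + 2 * (g x)\<^sup>2" for x
    using zero_le_power2[of "f x + g x"] by (simp add: power2_eq_square algebra_simps)
qed (use assms in \<open>auto simp: L2_def\<close>)

lemma L2_mult_continuous:
  assumes "f \<in> L2" "continuous_on {0..pi} g"
  shows "(\<lambda>x. f x * g x) \<in> L2"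
proof -
  have "bounded (g ` {0..pi})"
    using assms by (intro compact_imp_bounded compact_continuous_image) auto
  then obtain C where C: "\<And>x. x \<in> {0..pi} \<Longrightarrow> \<bar>g x\<bar> \<le> C"
    by (metis bounded_iff imageI real_norm_def)
  show ?thesis
  proof (rule L2I_bound)
    show "integrable (lebesgue_on {0<..<pi}) (\<lambda>x. (f x)\<^sup>2 * C\<^sup>2)"
      using assms by (auto simp: L2_def)
    show "(f x * g x)\<^sup>2 \<le> (f x)\<^sup>2 * C\<^sup>2" if "x \<in> {0<..<pi}" for x
      using C[of x] that by (auto simp: power_mult_distrib intro!: mult_left_mono) 
        (metis abs_ge_zero power2_abs power_mono)
  qed (use assms continuous_imp_measurable_Ioo in \<open>auto simp: L2_def\<close>)
qed

lemma L2_imp_absolutely_integrable: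
  assumes "f \<in> L2"
  shows "f absolutely_integrable_on {0..pi}"
proof -
  have "integrable (lebesgue_on {0<..<pi}) f"
  proof (rule Bochner_Integration.integrable_bound)
    have "integrable (lebesgue_on {0<..<pi}) (\<lambda>x. 1 :: real)"
      by (auto simp: integrable_iff_absolutely_integrable
        intro!: absolutely_integrable_continuous_real continuous_intros)
    then show "integrable (lebesgue_on {0<..<pi}) (\<lambda>x. 1 + (f x)\<^sup>2)"
      using assms by (auto simp: L2_def)
    have "norm (f x) \<le> norm (1 + (f x)\<^sup>2)" for x
      using zero_le_power2[of "\<bar>f x\<bar> - 1/2"] by (auto simp: power2_eq_square algebra_simps)
    then show "AE x in lebesgue_on {0<..<pi}. norm (f x) \<le> norm (1 + (f x)\<^sup>2)" by auto
  qed (use assms in \<open>auto simp: L2_def\<close>)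
  then show ?thesis by (simp add: integrable_iff_absolutely_integrable)
qed

text \<open>The product rule for an indefinite integral \<open>Q\<close> of an integrable function: the increment of the
  defect \<open>D\<close> over \<open>[s, t]\<close> is at most \<open>2 K (t - s)\<close> times the integral of \<open>\<bar>q\<bar>\<close> over \<open>[s, t]\<close>,
  so \<open>D\<close> has derivative zero everywhere.\<close>
lemma product_indefinite_integral:
  fixes q \<psi> \<psi>' :: "real \<Rightarrow> real"
  assumes q: "q absolutely_integrable_on {0..b}"
    and der: "\<And>x. x \<in> {0..b} \<Longrightarrow> (\<psi> has_real_derivative \<psi>' x) (at x within {0..b})"
    and cont': "continuous_on {0..b} \<psi>'" and x: "x \<in> {0..b}"
  shows "integral {0..x} q * \<psi> x = integral {0..x} (\<lambda>t. q t * \<psi> t + integral {0..t} q * \<psi>' t)"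
proof -
  define Q where "Q x = integral {0..x} q" for x
  define I where "I x = integral {0..x} (\<lambda>t. \<bar>q t\<bar>)" for x
  define g where "g t = q t * \<psi> t + Q t * \<psi>' t" for t
  have cont: "continuous_on {0..b} \<psi>"
    using der by (intro DERIV_continuous_on)
  have qi: "q integrable_on {0..b}" "(\<lambda>t. \<bar>q t\<bar>) integrable_on {0..b}"
    using q by (auto simp: absolutely_integrable_on_def)
  have cQ: "continuous_on {0..b} Q" and cI: "continuous_on {0..b} I"
    unfolding Q_def[abs_def] I_def[abs_def] by (intro indefinite_integral_continuous_1 qi)+
  have gi: "g integrable_on {0..b}"
  proof -
    have "(\<lambda>t. q t * \<psi> t) integrable_on {0..b}"
      using absolutely_integrable_mult_continuous[OF q cont] by (simp add: absolutely_integrable_on_def)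
    moreover have "(\<lambda>t. Q t * \<psi>' t) integrable_on {0..b}"
      by (intro integrable_continuous_real continuous_intros cQ cont')
    ultimately show ?thesis unfolding g_def[abs_def] by (rule integrable_add)
  qed
  have part: "(f has_integral integral {0..t} f - integral {0..s} f) {s..t}"
    if "f integrable_on {0..b}" "0 \<le> s" "s \<le> t" "t \<le> b" for s t and f :: "real \<Rightarrow> real"
  proof -
    have "f integrable_on {0..t}" "f integrable_on {s..t}"
      using that by (auto intro: integrable_on_subinterval[OF that(1)])
    then show ?thesis
      using Henstock_Kurzweil_Integration.integral_combine[of 0 s t f] that
      by (auto simp: has_integral_iff)
  qed
  have "compact (\<psi>' ` {0..b})" using cont' by (intro compact_continuous_image) auto
  then obtain K where K: "\<And>t. t \<in> {0..b} \<Longrightarrow> \<bar>\<psi>' t\<bar> \<le> K"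
    by (metis compact_imp_bounded bounded_iff imageI real_norm_def)
  have K0: "0 \<le> K" using K[OF x] by linarith
  define D where "D x = Q x * \<psi> x - integral {0..x} g" for x
  have \<psi>: "\<bar>\<psi> t - \<psi> s\<bar> \<le> K * (t - s)" if "0 \<le> s" "s \<le> t" "t \<le> b" for s t
  proof -
    have "\<psi> t - \<psi> s \<le> K * (t - s)"
      using K that by (intro derivative_le_imp_le[OF der]) force+
    moreover have "- \<psi> t - - \<psi> s \<le> K * (t - s)"
      using K that by (intro derivative_le_imp_le[where f="\<lambda>x. - \<psi> x" and f'="\<lambda>x. - \<psi>' x" and a=0 and b=b])
        (force intro!: DERIV_minus der)+
    ultimately show ?thesis by linarith
  qed
  have QI: "\<bar>Q t - Q s\<bar> \<le> I t - I s" if "0 \<le> s" "s \<le> t" "t \<le> b" for s t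
    using Henstock_Kurzweil_Integration.integral_norm_bound_integral[of q "{s..t}" "\<lambda>t. \<bar>q t\<bar>"] part[OF qi(1) that] part[OF qi(2) that]
    by (auto simp: Q_def I_def has_integral_iff)
  have incr: "\<bar>D t - D s\<bar> \<le> 2 * K * (t - s) * (I t - I s)" if st: "0 \<le> s" "s \<le> t" "t \<le> b" for s t
  proof -
    have d: "(\<psi>' has_integral \<psi> t - \<psi> s) {s..t}"
      using st by (intro fundamental_theorem_of_calculus)
        (auto intro!: DERIV_subset[OF der] simp flip: has_real_derivative_iff_has_vector_derivative)
    have h: "((\<lambda>r. q r * \<psi> s + Q t * \<psi>' r - g r) has_integral
        (Q t - Q s) * \<psi> s + Q t * (\<psi> t - \<psi> s) - (integral {0..t} g - integral {0..s} g)) {s..t}"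
      using part[OF qi(1) st] part[OF gi st] d
      by (intro has_integral_diff has_integral_add has_integral_mult_left has_integral_mult_right)
         (auto simp: Q_def)
    have e: "((\<lambda>r. \<bar>q r\<bar> * (K * (t - s)) + (I t - I s) * K) has_integral
        (I t - I s) * (K * (t - s)) + (t - s) * ((I t - I s) * K)) {s..t}"
      using part[OF qi(2) st] has_integral_const_real[of "(I t - I s) * K" s t] st
      by (intro has_integral_add has_integral_mult_left) (auto simp: I_def)
    have "norm (integral {s..t} (\<lambda>r. q r * \<psi> s + Q t * \<psi>' r - g r))
        \<le> integral {s..t} (\<lambda>r. \<bar>q r\<bar> * (K * (t - s)) + (I t - I s) * K)"
    proof (rule Henstock_Kurzweil_Integration.integral_norm_bound_integral)
      show "(\<lambda>r. q r * \<psi> s + Q t * \<psi>' r - g r) integrable_on {s..t}" using h by blast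
      show "(\<lambda>r. \<bar>q r\<bar> * (K * (t - s)) + (I t - I s) * K) integrable_on {s..t}" using e by blast
      fix r assume r: "r \<in> {s..t}"
      have 1: "\<bar>q r * (\<psi> s - \<psi> r)\<bar> \<le> \<bar>q r\<bar> * (K * (t - s))"
        using \<psi>[of s r] r st K0 mult_left_mono[of r t K] unfolding abs_mult
        by (intro mult_left_mono) (auto simp: algebra_simps)
      have "\<bar>Q t - Q r\<bar> \<le> I t - I s"
        using QI[of r t] QI[of s r] r st by auto
      then have 2: "\<bar>(Q t - Q r) * \<psi>' r\<bar> \<le> (I t - I s) * K"
        unfolding abs_mult using K[of r] r st by (intro mult_mono) auto
      have "q r * \<psi> s + Q t * \<psi>' r - g r = q r * (\<psi> s - \<psi> r) + (Q t - Q r) * \<psi>' r"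
        by (simp add: g_def algebra_simps)
      with 1 2 show "norm (q r * \<psi> s + Q t * \<psi>' r - g r) \<le> \<bar>q r\<bar> * (K * (t - s)) + (I t - I s) * K"
        unfolding real_norm_def by linarith
    qed
    then show ?thesis
      unfolding integral_unique[OF h] integral_unique[OF e] real_norm_def by (simp add: D_def algebra_simps)
  qed
  \<comment> \<open>The difference quotient is at most \<open>2 * K * \<bar>I y - I s\<bar>\<close>,
    which tends to 0 because the indefinite integral \<open>I\<close> is continuous; this works at
    every point \<open>s\<close>, not just almost everywhere.\<close>
  have "(D has_real_derivative 0) (at s within {0..b})" if s: "s \<in> {0..b}" for s
    unfolding has_field_derivative_iff
  proof (rule Lim_null_comparison)
    have "((\<lambda>y. 2 * K * \<bar>I y - I s\<bar>) \<longlongrightarrow> 2 * K * \<bar>I s - I s\<bar>) (at s within {0..b})"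
      using cI s by (intro tendsto_intros) (auto simp: continuous_on_def)
    then show "((\<lambda>y. 2 * K * \<bar>I y - I s\<bar>) \<longlongrightarrow> 0) (at s within {0..b})" by simp
    have "norm ((D y - D s) / (y - s)) \<le> 2 * K * \<bar>I y - I s\<bar>" if y: "y \<in> {0..b}" "y \<noteq> s" for y
    proof -
      have "\<bar>D y - D s\<bar> \<le> 2 * K * \<bar>I y - I s\<bar> * \<bar>y - s\<bar>"
        using incr[of s y] incr[of y s] QI[of s y] QI[of y s] y s
        by (cases "s \<le> y") (auto simp: algebra_simps abs_minus_commute)
      then show ?thesis using y by (simp add: field_simps)
    qed
    then show "\<forall>\<^sub>F y in at s within {0..b}. norm ((D y - D s) / (y - s)) \<le> 2 * K * \<bar>I y - I s\<bar>"
      by (auto simp: eventually_at_filter)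
  qed
  then obtain c where c: "\<And>s. s \<in> {0..b} \<Longrightarrow> D s = c"
    using has_field_derivative_zero_constant[of "{0..b}" D] by auto
  have "D x = D 0" using c[of x] c[of 0] x by auto
  then show ?thesis by (simp add: D_def Q_def g_def[abs_def])
qed

section \<open>Vanishing weak derivatives and the classical description of the Sobolev space\<close>

text \<open>At 0 the difference quotient is bounded by the absolute value of its argument. Being
  continuously differentiable, this square serves both to build test functions and to apply Gronwall
  to the negative part of a difference.\<close>

lemma has_real_derivative_positive_part_square:
  "((\<lambda>t. (max 0 t)\<^sup>2) has_real_derivative 2 * max 0 t) (at t)" for t :: real
proof -
  consider "t < 0" | "t = 0" | "t > 0" by linarith
  then show ?thesis
  proof cases
    case 1
    have "((\<lambda>t. 0) has_real_derivative 0) (at t)" by simp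
    then have "((\<lambda>t. (max 0 t)\<^sup>2) has_real_derivative 0) (at t)"
      by (rule has_field_derivative_transform_within_open[where S="{..<0}"]) (use 1 in auto)
    then show ?thesis using 1 by simp
  next
    case 3
    have "((\<lambda>t. t\<^sup>2) has_real_derivative 2 * t) (at t)" by (auto intro!: derivative_eq_intros)
    then have "((\<lambda>t. (max 0 t)\<^sup>2) has_real_derivative 2 * t) (at t)"
      by (rule has_field_derivative_transform_within_open[where S="{0<..}"]) (use 3 in auto)
    then show ?thesis using 3 by simp
  next
    case 2
    have "((\<lambda>y :: real. (max 0 y)\<^sup>2 / y) \<longlongrightarrow> 0) (at 0)"
    proof (rule Lim_null_comparison)
      show "\<forall>\<^sub>F y :: real in at 0. norm ((max 0 y)\<^sup>2 / y) \<le> \<bar>y\<bar>"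
        by (intro always_eventually allI) (auto simp: max_def power2_eq_square)
      show "((\<lambda>y :: real. \<bar>y\<bar>) \<longlongrightarrow> 0) (at 0)" by (auto intro!: tendsto_eq_intros)
    qed
    then show ?thesis using 2 by (simp add: has_field_derivative_iff)
  qed
qed

text \<open>A \<open>C\<^sup>1\<close> test function whose derivative is a tent at \<open>x2\<close> minus a tent at \<open>x1\<close>.\<close>
lemma constant_if_weak_derivative_zero_aux:
  fixes f :: "real \<Rightarrow> real"
  assumes cont: "continuous_on {0..pi} f"
    and z: "\<And>\<phi>. \<phi> \<in> test_functions \<Longrightarrow> (LINT x|lebesgue_on {0<..<pi}. f x * deriv \<phi> x) = 0"
    and x1: "x1 \<in> {0<..<pi}" and x2: "x2 \<in> {0<..<pi}"
  shows "f x2 \<le> f x1"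
proof (rule ccontr)
  assume less: "\<not> f x2 \<le> f x1"
  \<comment> \<open>\<open>m\<close> separates the two values: \<open>f\<close> is below
    \<open>m\<close> near \<open>x1\<close> and above \<open>m\<close> near \<open>x2\<close>. The
    radius \<open>r\<close> below is also small enough to keep the support of the test function
    inside \<open>(0, pi)\<close>.\<close>
  define m where "m = (f x1 + f x2) / 2"
  have m: "f x1 < m" "m < f x2" using less by (auto simp: m_def)
  have iso: "isCont f x1" "isCont f x2"
    using cont x1 x2 continuous_on_interior[of "{0..pi}" f] by (auto simp: interior_atLeastAtMost_real)
  have "\<forall>\<^sub>F x in nhds x1. f x < m" "\<forall>\<^sub>F x in nhds x2. m < f x"
    using iso m order_tendstoD by (auto simp: isCont_def tendsto_at_iff_tendsto_nhds)
  then obtain e1 e2 where e: "e1 > 0" "\<And>x. dist x x1 < e1 \<Longrightarrow> f x < m"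
      "e2 > 0" "\<And>x. dist x x2 < e2 \<Longrightarrow> m < f x"
    by (auto simp: eventually_nhds_metric)
  define r where "r = min (min e1 e2) (min (min x1 (pi - x1)) (min x2 (pi - x2))) / 2"
  have r: "r > 0" "r < e1" "r < e2" "r < x1" "r < pi - x1" "r < x2" "r < pi - x2"
    using e x1 x2 by (auto simp: r_def min_def field_simps)
  \<comment> \<open>\<open>k\<close> is a second difference of the positive part, a tent of height
    \<open>r\<close> on \<open>[- r, r]\<close>; its antiderivative \<open>K\<close> rises from 0 to
    \<open>r^2\<close>. The difference of two translates of \<open>K\<close> therefore has compact
    support.\<close>
  define p where "p t = max 0 t" for t :: real
  define k where "k t = p (t + r) - 2 * p t + p (t - r)" for t
  define K where "K t = ((p (t + r))\<^sup>2 - 2 * (p t)\<^sup>2 + (p (t - r))\<^sup>2) / 2" for t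
  have dK: "(K has_real_derivative k t) (at t)" for t
  proof -
    have "((\<lambda>t. (p (t + c))\<^sup>2) has_real_derivative 2 * p (t + c) * 1) (at t)" for c
      unfolding p_def
      by (rule DERIV_chain2[where f="\<lambda>t. (max 0 t)\<^sup>2" and g="\<lambda>t. t + c"])
         (auto intro!: has_real_derivative_positive_part_square derivative_eq_intros)
    then have *: "((\<lambda>t. (p (t + c))\<^sup>2) has_real_derivative 2 * p (t + c)) (at t)" for c by simp
    show ?thesis
      unfolding K_def[abs_def] k_def
      using DERIV_cdivide[OF DERIV_add[OF DERIV_diff[OF *[of r] DERIV_cmult[OF *[of 0], of 2]] *[of "- r"]], of 2]
      by (simp add: add_divide_distrib diff_divide_distrib)
  qed
  have ck: "continuous_on S k" for S
    unfolding k_def[abs_def] p_def[abs_def] by (intro continuous_intros)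
  have k0: "k t = 0" if "\<bar>t\<bar> \<ge> r" for t using that r by (auto simp: k_def p_def max_def)
  have knn: "k t \<ge> 0" for t using r by (auto simp: k_def p_def max_def)
  have K0: "K t = 0" if "t \<le> - r" for t using that r by (auto simp: K_def p_def max_def)
  have Kr: "K t = r\<^sup>2" if "t \<ge> r" for t
    using that r by (auto simp: K_def p_def max_def power2_eq_square algebra_simps)
  define \<phi> where "\<phi> x = K (x - x2) - K (x - x1)" for x
  define \<phi>' where "\<phi>' x = k (x - x2) - k (x - x1)" for x
  have d\<phi>: "(\<phi> has_real_derivative \<phi>' x) (at x)" for x
    unfolding \<phi>_def[abs_def] \<phi>'_def using DERIV_shift[of K] dK
    by (auto intro!: derivative_eq_intros DERIV_chain2[OF dK])
  have c\<phi>': "continuous_on S \<phi>'" for S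
    unfolding \<phi>'_def[abs_def]
    by (intro continuous_intros continuous_on_compose2[OF ck[of UNIV]]) auto
  define lo where "lo = min x1 x2 - r"
  define hi where "hi = max x1 x2 + r"
  have lohi: "0 < lo" "hi < pi" using r by (auto simp: lo_def hi_def)
  have outside: "\<phi> x = 0" if "x \<notin> {lo..hi}" for x
  proof (cases "x < lo")
    case True
    then have "x - x2 \<le> - r" "x - x1 \<le> - r" by (auto simp: lo_def)
    then show ?thesis by (simp add: \<phi>_def K0)
  next
    case False
    then have "x - x2 \<ge> r" "x - x1 \<ge> r" using that by (auto simp: hi_def)
    then show ?thesis by (simp add: \<phi>_def Kr)
  qed
  have "\<phi> \<in> test_functions"
    unfolding test_functions_def C1_differentiable_on_def mem_Collect_eq
    using lohi outside d\<phi> c\<phi>' by (auto simp flip: has_real_derivative_iff_has_vector_derivative)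
  from z[OF this] have z0: "(LINT x|lebesgue_on {0<..<pi}. f x * \<phi>' x) = 0"
    using DERIV_imp_deriv[OF d\<phi>] by simp
  have "integral {0..pi} (\<lambda>x. f x * \<phi>' x) = 0"
    using lebesgue_integral_Ioo[of 0 pi "\<lambda>x. f x * \<phi>' x"] z0 cont c\<phi>'
    by (auto intro!: absolutely_integrable_continuous_real continuous_intros)
  moreover have "(\<phi>' has_integral \<phi> pi - \<phi> 0) {0..pi}"
    by (rule fundamental_theorem_of_calculus)
       (auto intro: has_field_derivative_at_within d\<phi> simp flip: has_real_derivative_iff_has_vector_derivative)
  then have "integral {0..pi} \<phi>' = 0" using outside[of pi] outside[of 0] lohi by (auto simp: has_integral_iff)
  moreover have "integral {0..pi} (\<lambda>x. (f x - m) * \<phi>' x) =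
      integral {0..pi} (\<lambda>x. f x * \<phi>' x) - integral {0..pi} (\<lambda>x. m * \<phi>' x)"
    unfolding left_diff_distrib using cont c\<phi>'
    by (intro integral_diff integrable_continuous_real continuous_intros)
  ultimately have zero: "integral {0..pi} (\<lambda>x. (f x - m) * \<phi>' x) = 0" by simp
  \<comment> \<open>The tent at \<open>x2\<close> has a plus sign and lives where
    \<open>f > m\<close>, the one at \<open>x1\<close> a minus sign and lives where
    \<open>f < m\<close>. As the integral vanishes, the product is zero everywhere, contradicting
    \<open>\<phi>' x2 = r\<close>.\<close>
  have nn: "0 \<le> (f x - m) * \<phi>' x" for x
  proof -
    have "k (x - x1) = 0 \<or> f x < m" "k (x - x2) = 0 \<or> m < f x"
      using k0[of "x - x1"] k0[of "x - x2"] e(2)[of x] e(4)[of x] r by (force simp: dist_real_def)+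
    then show ?thesis using knn[of "x - x1"] knn[of "x - x2"]
      by (auto simp: \<phi>'_def mult_nonpos_nonpos mult_nonpos_nonneg)
  qed
  have "\<forall>x\<in>{0..pi}. (f x - m) * \<phi>' x = 0"
    using zero nn cont c\<phi>' by (subst (asm) integral_eq_0_iff) (auto intro!: continuous_intros)
  then have "\<phi>' x2 = 0" using m x2 by auto
  moreover have "k (x2 - x1) = 0"
    using k0[of "x2 - x1"] e(2)[of x2] m r by (force simp: dist_real_def)
  moreover have "k 0 = r" using r by (simp add: k_def p_def)
  ultimately show False using r by (simp add: \<phi>'_def)
qed

lemma constant_if_weak_derivative_zero:
  fixes f :: "real \<Rightarrow> real"
  assumes cont: "continuous_on {0..pi} f"
    and z: "\<And>\<phi>. \<phi> \<in> test_functions \<Longrightarrow> (LINT x|lebesgue_on {0<..<pi}. f x * deriv \<phi> x) = 0"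
    and x: "x \<in> {0..pi}"
  shows "f x = f 0"
proof -
  have eq: "f y = f (pi / 2)" if "y \<in> {0<..<pi}" for y
    using that by (intro antisym constant_if_weak_derivative_zero_aux[OF cont z]) auto
  have "f y = f (pi / 2)" if "y \<in> {0..pi}" for y
  proof (rule continuous_constant_on_closure[where S="{0<..<pi}" and f=f])
    show "continuous_on (closure {0<..<pi}) f" using cont by simp
    show "y \<in> closure {0<..<pi}" using that by simp
  qed (use eq in blast)
  from this[OF x] this[of 0] show ?thesis by simp
qed

lemma test_functionsD:
  assumes "\<phi> \<in> test_functions"
  shows "(\<phi> has_real_derivative deriv \<phi> x) (at x within S)" "continuous_on S (deriv \<phi>)"
    "\<phi> 0 = 0" "\<phi> pi = 0"
proof -
  obtain D a b where D: "\<And>x. (\<phi> has_real_derivative D x) (at x)" "continuous_on UNIV D"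
      "0 < a" "b < pi" "\<And>x. x \<notin> {a..b} \<Longrightarrow> \<phi> x = 0"
    using assms by (auto simp: test_functions_def C1_differentiable_on_def
        simp flip: has_real_derivative_iff_has_vector_derivative)
  then have "deriv \<phi> = D" by (intro ext DERIV_imp_deriv)
  with D show "(\<phi> has_real_derivative deriv \<phi> x) (at x within S)" "continuous_on S (deriv \<phi>)"
    by (auto intro: has_field_derivative_at_within continuous_on_subset)
  show "\<phi> 0 = 0" "\<phi> pi = 0" using D(3-5) by auto
qed

lemma integral_indefinite_integral_deriv:
  assumes v: "v absolutely_integrable_on {0..pi}" and \<phi>: "\<phi> \<in> test_functions"
  shows "integral {0..pi} (\<lambda>t. integral {0..t} v * deriv \<phi> t) = - integral {0..pi} (\<lambda>t. v t * \<phi> t)"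
proof -
  note T = test_functionsD[OF \<phi>]
  have c\<phi>: "continuous_on {0..pi} \<phi>" using T(1) by (intro DERIV_continuous_on)
  have "v integrable_on {0..pi}" using v by (simp add: absolutely_integrable_on_def)
  then have cV: "continuous_on {0..pi} (\<lambda>t. integral {0..t} v)" by (rule indefinite_integral_continuous_1)
  have "0 = integral {0..pi} (\<lambda>t. v t * \<phi> t + integral {0..t} v * deriv \<phi> t)"
    using product_indefinite_integral[OF v T(1,2), of pi] T(4) by simp
  also have "\<dots> = integral {0..pi} (\<lambda>t. v t * \<phi> t) + integral {0..pi} (\<lambda>t. integral {0..t} v * deriv \<phi> t)"
  proof (rule integral_add)
    show "(\<lambda>t. v t * \<phi> t) integrable_on {0..pi}"
      using absolutely_integrable_mult_continuous[OF v c\<phi>] by (simp add: absolutely_integrable_on_def)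
    show "(\<lambda>t. integral {0..t} v * deriv \<phi> t) integrable_on {0..pi}"
      by (intro integrable_continuous_real continuous_intros cV T)
  qed
  finally show ?thesis by simp
qed

text \<open>By integration by parts the indefinite integral of \<open>v\<close> has weak derivative
  \<open>v\<close>. The claim thus reduces to the lemma of du Bois-Reymond for \<open>u\<close>
  minus this integral: its weak derivative is zero exactly if it is constant.\<close>

lemma weak_derivative_iff_indefinite_integral:
  assumes v: "v absolutely_integrable_on {0..pi}" and u: "continuous_on {0..pi} u"
  shows "weak_derivative u v \<longleftrightarrow> (\<forall>x\<in>{0..pi}. u x = u 0 + integral {0..x} v)"
proof -
  define f where "f x = u x - integral {0..x} v" for x
  have "v integrable_on {0..pi}" using v by (simp add: absolutely_integrable_on_def)
  then have cV: "continuous_on {0..pi} (\<lambda>t. integral {0..t} v)" by (rule indefinite_integral_continuous_1)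
  have cf: "continuous_on {0..pi} f" unfolding f_def[abs_def] by (intro continuous_intros u cV)
  have key: "(LINT x|lebesgue_on {0<..<pi}. u x * deriv \<phi> x) = - (LINT x|lebesgue_on {0<..<pi}. v x * \<phi> x)
      \<longleftrightarrow> (LINT x|lebesgue_on {0<..<pi}. f x * deriv \<phi> x) = 0" if \<phi>: "\<phi> \<in> test_functions" for \<phi>
  proof -
    note T = test_functionsD[OF \<phi>]
    have c\<phi>: "continuous_on {0..pi} \<phi>" using T(1) by (intro DERIV_continuous_on)
    have L: "(LINT x|lebesgue_on {0<..<pi}. g x * deriv \<phi> x) = integral {0..pi} (\<lambda>x. g x * deriv \<phi> x)"
      if "continuous_on {0..pi} g" for g
      using that T(2) by (intro lebesgue_integral_Ioo absolutely_integrable_continuous_real continuous_intros)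
    have "integral {0..pi} (\<lambda>x. f x * deriv \<phi> x) =
        integral {0..pi} (\<lambda>x. u x * deriv \<phi> x) - integral {0..pi} (\<lambda>x. integral {0..x} v * deriv \<phi> x)"
      unfolding f_def left_diff_distrib
      by (intro integral_diff integrable_continuous_real continuous_intros u cV T)
    moreover have "(LINT x|lebesgue_on {0<..<pi}. v x * \<phi> x) = integral {0..pi} (\<lambda>x. v x * \<phi> x)"
      by (rule lebesgue_integral_Ioo[OF absolutely_integrable_mult_continuous[OF v c\<phi>]])
    ultimately show ?thesis
      unfolding L[OF u] L[OF cf] integral_indefinite_integral_deriv[OF v \<phi>] by auto
  qed
  show ?thesis
  proof
    assume "weak_derivative u v"
    then have *: "f x = f 0" if "x \<in> {0..pi}" for x
      using that key by (intro constant_if_weak_derivative_zero[OF cf]) (auto simp: weak_derivative_def)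
    have "f 0 = u 0" by (simp add: f_def)
    then have "u x = u 0 + integral {0..x} v" if "x \<in> {0..pi}" for x
      using *[OF that] unfolding f_def[of x] by linarith
    then show "\<forall>x\<in>{0..pi}. u x = u 0 + integral {0..x} v" by blast
  next
    assume "\<forall>x\<in>{0..pi}. u x = u 0 + integral {0..x} v"
    then have f: "f x = u 0" if "x \<in> {0..pi}" for x
      unfolding f_def using that by (metis add_diff_cancel_right')
    have "(LINT x|lebesgue_on {0<..<pi}. f x * deriv \<phi> x) = 0" if \<phi>: "\<phi> \<in> test_functions" for \<phi>
    proof -
      note T = test_functionsD[OF \<phi>]
      have "(deriv \<phi> has_integral \<phi> pi - \<phi> 0) {0..pi}"
        by (rule fundamental_theorem_of_calculus)
           (auto intro: T simp flip: has_real_derivative_iff_has_vector_derivative)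
      then have "integral {0..pi} (deriv \<phi>) = 0" using T by (simp add: has_integral_iff)
      moreover have "(LINT x|lebesgue_on {0<..<pi}. f x * deriv \<phi> x) = integral {0..pi} (\<lambda>x. f x * deriv \<phi> x)"
        using cf T(2) by (intro lebesgue_integral_Ioo absolutely_integrable_continuous_real continuous_intros)
      moreover have "\<dots> = integral {0..pi} (\<lambda>x. u 0 * deriv \<phi> x)"
        using f by (intro integral_cong) auto
      ultimately show ?thesis by simp
    qed
    then show "weak_derivative u v" using key by (auto simp: weak_derivative_def)
  qed
qed

text \<open>From here on the weak formulation is replaced by this one. Absolute continuity of
  \<open>v\<close> is expressed through an integral, so that no almost everywhere derivative has to
  be handled.\<close>

lemma W22_iff:
  "W22 u v w \<longleftrightarrow> w \<in> L2 \<and> continuous_on {0..pi} v \<and>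
     (\<forall>x\<in>{0..pi}. (u has_real_derivative v x) (at x within {0..pi})) \<and>
     (\<forall>x\<in>{0..pi}. v x = v 0 + integral {0..x} w)"
  (is "_ = ?rhs")
proof
  assume W: "W22 u v w"
  then have uv: "continuous_on {0..pi} u" "continuous_on {0..pi} v" "v \<in> L2" "w \<in> L2" by (auto simp: W22_def)
  note ai = L2_imp_absolutely_integrable[OF uv(3)] L2_imp_absolutely_integrable[OF uv(4)]
  have u: "\<forall>x\<in>{0..pi}. u x = u 0 + integral {0..x} v" and v: "\<forall>x\<in>{0..pi}. v x = v 0 + integral {0..x} w"
    using W weak_derivative_iff_indefinite_integral[OF ai(1) uv(1)]
      weak_derivative_iff_indefinite_integral[OF ai(2) uv(2)] unfolding W22_def by blast+
  have "(u has_real_derivative v x) (at x within {0..pi})" if x: "x \<in> {0..pi}" for x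
  proof (rule has_real_derivative_cong_on[OF x])
    show "((\<lambda>x. u 0 + integral {0..x} v) has_real_derivative v x) (at x within {0..pi})"
      using integral_has_real_derivative[OF uv(2) x] by (auto intro!: derivative_eq_intros)
 qed (use u in blast)
  then show ?rhs using uv v by blast
next
  assume R: ?rhs
  then have "\<And>x. x \<in> {0..pi} \<Longrightarrow> (u has_real_derivative v x) (at x within {0..pi})" by blast
  note d = this
  then have u: "continuous_on {0..pi} u" by (rule DERIV_continuous_on)
  have 1: "weak_derivative v w"
    using R weak_derivative_iff_indefinite_integral[OF L2_imp_absolutely_integrable, of w v] by blast
  have "u x = u 0 + integral {0..x} v" if x: "x \<in> {0..pi}" for x
  proof -
    have "(v has_integral u x - u 0) {0..x}"
      using x by (intro fundamental_theorem_of_calculus)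
        (auto intro!: DERIV_subset[OF d] simp flip: has_real_derivative_iff_has_vector_derivative)
    then show ?thesis by (simp add: has_integral_iff)
  qed
  then have "weak_derivative u v"
    using R u weak_derivative_iff_indefinite_integral[OF absolutely_integrable_continuous_real, of v u] by blast
  with R u 1 show "W22 u v w" unfolding W22_def by (blast intro: continuous_imp_L2)
qed

subsection \<open>Pruefer angles\<close>

text \<open>The equation of \<open>\<theta>\<close> in \<open>v = exp \<rho> * sin \<theta>\<close>,
  \<open>y = exp \<rho> * cos \<theta>\<close> for \<open>v' = P * y\<close>,
  \<open>y' = - q * v\<close>. Here \<open>q\<close> is a function of \<open>x\<close> only; a
  potential that depends on the solution is inserted after evaluation along that solution.\<close>

definition prufer_angle :: "(real \<Rightarrow> real) \<Rightarrow> (real \<Rightarrow> real) \<Rightarrow> (real \<Rightarrow> real) \<Rightarrow> bool" where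
  "prufer_angle P q \<theta> \<longleftrightarrow> (\<forall>x\<in>{0..pi}. (\<theta> has_real_derivative
     P x * (cos (\<theta> x))\<^sup>2 + q x * (sin (\<theta> x))\<^sup>2) (at x within {0..pi}))"

text \<open>\<open>\<rho>\<close> is the logarithm of the radius, so the radius never
  vanishes.\<close>

definition prufer_amplitude ::
    "(real \<Rightarrow> real) \<Rightarrow> (real \<Rightarrow> real) \<Rightarrow> (real \<Rightarrow> real) \<Rightarrow> (real \<Rightarrow> real) \<Rightarrow> bool" where
  "prufer_amplitude P q \<theta> \<rho> \<longleftrightarrow> (\<forall>x\<in>{0..pi}. (\<rho> has_real_derivative
     sin (\<theta> x) * cos (\<theta> x) * (P x - q x)) (at x within {0..pi}))"

definition planar_system ::
    "(real \<Rightarrow> real) \<Rightarrow> (real \<Rightarrow> real) \<Rightarrow> (real \<Rightarrow> real) \<Rightarrow> (real \<Rightarrow> real) \<Rightarrow> bool" where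
  "planar_system P q v y \<longleftrightarrow> (\<forall>x\<in>{0..pi}.
     (v has_real_derivative P x * y x) (at x within {0..pi}) \<and>
     (y has_real_derivative - (q x * v x)) (at x within {0..pi}))"

lemma prufer_angleD:
  "prufer_angle P q \<theta> \<Longrightarrow> x \<in> {0..pi} \<Longrightarrow> (\<theta> has_real_derivative
     P x * (cos (\<theta> x))\<^sup>2 + q x * (sin (\<theta> x))\<^sup>2) (at x within {0..pi})"
  by (auto simp: prufer_angle_def)

lemma prufer_amplitudeD:
  "prufer_amplitude P q \<theta> \<rho> \<Longrightarrow> x \<in> {0..pi} \<Longrightarrow> (\<rho> has_real_derivative
     sin (\<theta> x) * cos (\<theta> x) * (P x - q x)) (at x within {0..pi})"
  by (auto simp: prufer_amplitude_def)

lemma planar_systemD: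
  assumes "planar_system P q v y" "x \<in> {0..pi}"
  shows "(v has_real_derivative P x * y x) (at x within {0..pi})"
    "(y has_real_derivative - (q x * v x)) (at x within {0..pi})"
  using assms by (auto simp: planar_system_def)

lemma cont_prufer_angle: "prufer_angle P q \<theta> \<Longrightarrow> continuous_on {0..pi} \<theta>"
  by (rule DERIV_continuous_on[OF prufer_angleD])

lemma cont_prufer_amplitude: "prufer_amplitude P q \<theta> \<rho> \<Longrightarrow> continuous_on {0..pi} \<rho>"
  by (rule DERIV_continuous_on[OF prufer_amplitudeD])

lemma cont_planar_system:
  assumes "planar_system P q v y"
  shows "continuous_on {0..pi} v" "continuous_on {0..pi} y"
  by (rule DERIV_continuous_on, erule planar_systemD[OF assms])+

lemma continuous_on_Icc_bounded:
  fixes f :: "real \<Rightarrow> real"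
  assumes "continuous_on {a..b} f"
  obtains C where "C > 0" "\<And>x. x \<in> {a..b} \<Longrightarrow> \<bar>f x\<bar> \<le> C"
proof -
  have "bounded (f ` {a..b})" using assms by (intro compact_imp_bounded compact_continuous_image) auto
  then show ?thesis using that unfolding bounded_pos by (auto simp del: atLeastAtMost_iff)
qed

lemma continuous_on_Icc_pos_lower_bound:
  fixes f :: "real \<Rightarrow> real"
  assumes "continuous_on {a..b} f" "\<And>x. x \<in> {a..b} \<Longrightarrow> f x > 0"
  obtains c where "c > 0" "\<And>x. x \<in> {a..b} \<Longrightarrow> c \<le> f x"
proof (cases "{a..b} = {}")
  case True
  show ?thesis by (rule that[of 1]) (use True in auto)
next
  case False
  then obtain x where "x \<in> {a..b}" "\<forall>y\<in>{a..b}. f x \<le> f y"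
    using continuous_attains_inf[OF compact_Icc False assms(1)] by blast
  then show ?thesis using assms(2) by (intro that[of "f x"]) auto
qed

section \<open>Existence and uniqueness for the polar equations\<close>

text \<open>Boundedness is included because a product of Lipschitz functions is again Lipschitz if
  the factors are bounded. The constants are uniform in the parameter, as the fixed point argument
  requires.\<close>

definition bdd_lipschitz ::
    "real set \<Rightarrow> (real \<Rightarrow> real \<Rightarrow> 'a::metric_space \<Rightarrow> real) \<Rightarrow> bool" where
  "bdd_lipschitz S f \<longleftrightarrow> (\<exists>B\<ge>0. \<exists>L\<ge>0. \<forall>p\<in>S. \<forall>x\<in>{0..pi}. \<forall>z z'.
     \<bar>f p x z\<bar> \<le> B \<and> \<bar>f p x z - f p x z'\<bar> \<le> L * dist z z')"

lemma bdd_lipschitzI: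
  assumes "0 \<le> B" "0 \<le> L" "\<And>p x z. p \<in> S \<Longrightarrow> x \<in> {0..pi} \<Longrightarrow> \<bar>f p x z\<bar> \<le> B"
    and "\<And>p x z z'. p \<in> S \<Longrightarrow> x \<in> {0..pi} \<Longrightarrow> \<bar>f p x z - f p x z'\<bar> \<le> L * dist z z'"
  shows "bdd_lipschitz S f"
  using assms unfolding bdd_lipschitz_def by blast

lemma bdd_lipschitz_add:
  assumes "bdd_lipschitz S f" "bdd_lipschitz S g"
  shows "bdd_lipschitz S (\<lambda>p x z. f p x z + g p x z)"
proof -
  let ?bl = "\<lambda>f B L. \<forall>p\<in>S. \<forall>x\<in>{0..pi}. \<forall>z z'. \<bar>f p x z\<bar> \<le> B \<and> \<bar>f p x z - f p x z'\<bar> \<le> L * dist z z'"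
  obtain B L where 1: "B \<ge> 0" "L \<ge> 0" "?bl f B L"
    using assms(1) unfolding bdd_lipschitz_def by blast
  obtain B' L' where 2: "B' \<ge> 0" "L' \<ge> 0" "?bl g B' L'"
    using assms(2) unfolding bdd_lipschitz_def by blast
  show ?thesis
  proof (rule bdd_lipschitzI)
    fix p x z z' assume px: "p \<in> S" "x \<in> {0..pi}"
    show "\<bar>f p x z + g p x z\<bar> \<le> B + B'"
      using 1(3)[rule_format, OF px, of z] 2(3)[rule_format, OF px, of z] by force
    show "\<bar>f p x z + g p x z - (f p x z' + g p x z')\<bar> \<le> (L + L') * dist z z'"
      using 1(3)[rule_format, OF px, of z z'] 2(3)[rule_format, OF px, of z z'] by (auto simp: distrib_right)
  qed (use 1 2 in auto)
qed

lemma bdd_lipschitz_mult: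
  assumes "bdd_lipschitz S f" "bdd_lipschitz S g"
  shows "bdd_lipschitz S (\<lambda>p x z. f p x z * g p x z)"
proof -
  let ?bl = "\<lambda>f B L. \<forall>p\<in>S. \<forall>x\<in>{0..pi}. \<forall>z z'. \<bar>f p x z\<bar> \<le> B \<and> \<bar>f p x z - f p x z'\<bar> \<le> L * dist z z'"
  obtain B L where 1: "B \<ge> 0" "L \<ge> 0" "?bl f B L"
    using assms(1) unfolding bdd_lipschitz_def by blast
  obtain B' L' where 2: "B' \<ge> 0" "L' \<ge> 0" "?bl g B' L'"
    using assms(2) unfolding bdd_lipschitz_def by blast
  show ?thesis
  proof (rule bdd_lipschitzI)
    fix p x z z' assume px: "p \<in> S" "x \<in> {0..pi}"
    show "\<bar>f p x z * g p x z\<bar> \<le> B * B'"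
      unfolding abs_mult using 1(1) 1(3)[rule_format, OF px, of z] 2(3)[rule_format, OF px, of z] by (intro mult_mono) auto
    have "\<bar>f p x z * g p x z - f p x z' * g p x z'\<bar>
        = \<bar>f p x z * (g p x z - g p x z') + g p x z' * (f p x z - f p x z')\<bar>"
      by (simp add: algebra_simps)
    also have "\<dots> \<le> \<bar>f p x z\<bar> * \<bar>g p x z - g p x z'\<bar> + \<bar>g p x z'\<bar> * \<bar>f p x z - f p x z'\<bar>"
      unfolding abs_mult[symmetric] by (rule abs_triangle_ineq)
    also have "\<dots> \<le> B * (L' * dist z z') + B' * (L * dist z z')"
      using 1(1) 2(1) 1(3)[rule_format, OF px, of z z'] 2(3)[rule_format, OF px, of z z'] 2(3)[rule_format, OF px, of z' z]
      by (intro add_mono mult_mono) auto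
    finally show "\<bar>f p x z * g p x z - f p x z' * g p x z'\<bar> \<le> (B * L' + B' * L) * dist z z'"
      by (simp add: algebra_simps)
  qed (use 1 2 in auto)
qed

lemma bdd_lipschitz_const:
  assumes "\<And>p x. p \<in> S \<Longrightarrow> x \<in> {0..pi} \<Longrightarrow> \<bar>f p x\<bar> \<le> B"
  shows "bdd_lipschitz S (\<lambda>p x z. f p x)"
  by (rule bdd_lipschitzI[of "max B 0" 0]) (use assms in \<open>auto simp: le_max_iff_disj\<close>)

lemma bdd_lipschitz_uminus:
  "bdd_lipschitz S f \<Longrightarrow> bdd_lipschitz S (\<lambda>p x z. - f p x z)"
  using bdd_lipschitz_mult[OF bdd_lipschitz_const[of S "\<lambda>p x. -1" 1], of f] by simp

lemma bdd_lipschitz_diff: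
  "bdd_lipschitz S f \<Longrightarrow> bdd_lipschitz S g \<Longrightarrow> bdd_lipschitz S (\<lambda>p x z. f p x z - g p x z)"
  using bdd_lipschitz_add[OF _ bdd_lipschitz_uminus, of S f g] by simp

lemma abs_sin_diff_le: "\<bar>sin a - sin b\<bar> \<le> \<bar>a - b\<bar>" for a b :: real
proof -
  have "\<bar>sin a - sin b\<bar> = 2 * \<bar>sin ((a - b) / 2)\<bar> * \<bar>cos ((a + b) / 2)\<bar>"
    by (simp add: sin_diff_sin abs_mult)
  also have "\<dots> \<le> 2 * \<bar>(a - b) / 2\<bar> * 1"
    using abs_sin_x_le_abs_x[of "(a - b) / 2"] by (intro mult_mono) auto
  finally show ?thesis by simp
qed

lemma abs_diff_fst_le_dist:
  fixes z z' :: "real \<times> 'a::metric_space" and a b :: real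
  shows "\<bar>a - b\<bar> \<le> \<bar>fst z - fst z'\<bar> \<Longrightarrow> \<bar>a - b\<bar> \<le> dist z z'"
  using dist_fst_le[of z z'] by (simp add: dist_real_def)

lemma bdd_lipschitz_sin_fst: "bdd_lipschitz S (\<lambda>p x z. sin (fst z))"
  by (intro bdd_lipschitzI[of 1 1]) (simp_all add: abs_diff_fst_le_dist abs_sin_diff_le)

lemma bdd_lipschitz_cos_fst: "bdd_lipschitz S (\<lambda>p x z. cos (fst z))"
proof -
  have "\<bar>cos a - cos b\<bar> \<le> \<bar>a - b\<bar>" for a b :: real
    using abs_sin_diff_le[of "a + pi/2" "b + pi/2"] by (simp add: sin_add)
  then show ?thesis by (intro bdd_lipschitzI[of 1 1]) (simp_all add: abs_diff_fst_le_dist)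
qed

text \<open>Where \<open>p^2 * exp (2 * t)\<close> lies below \<open>M\<close>, its derivative is
  twice its value, hence at most \<open>2 * M\<close>; beyond, the minimum is constant. So the
  Lipschitz constant is uniform in \<open>p\<close>. The inequality
  \<open>1 - d <= exp (- d)\<close> avoids differentiating at the corner.\<close>

lemma bdd_lipschitz_trunc_exp:
  assumes M: "M > 0"
  shows "bdd_lipschitz S (\<lambda>p x z. min (p\<^sup>2 * exp (2 * snd z)) M)"
proof -
  have mono: "min (p\<^sup>2 * exp (2 * t)) M - min (p\<^sup>2 * exp (2 * s)) M \<le> 2 * M * (t - s)" if "s \<le> t" for p s t :: real
  proof -
    define a d where "a = p\<^sup>2 * exp (2 * t)" and "d = 2 * (t - s)"
    have s: "p\<^sup>2 * exp (2 * s) = a * exp (- d)"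
      by (simp add: a_def d_def mult.assoc flip: exp_add)
    have a0: "a \<ge> 0" and d0: "d \<ge> 0" using that by (simp_all add: a_def d_def)
    have e: "1 - d \<le> exp (- d)" "exp (- d) \<le> 1"
      using exp_ge_add_one_self[of "- d"] d0 by (linarith, simp)
    have "min a M * (1 - d) \<le> min a M * exp (- d)"
      using e a0 M by (intro mult_left_mono) auto
    also have "\<dots> \<le> min (a * exp (- d)) M"
    proof (rule min.boundedI)
      show "min a M * exp (- d) \<le> a * exp (- d)" by (intro mult_right_mono) auto
      have "min a M * exp (- d) \<le> M * 1" using e M by (intro mult_mono) auto
      then show "min a M * exp (- d) \<le> M" by simp
    qed
    finally have "min a M - min (a * exp (- d)) M \<le> min a M * d"
      unfolding right_diff_distrib mult_1_right by linarith
    also have "\<dots> \<le> M * d" using d0 by (intro mult_right_mono) auto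
    finally show ?thesis unfolding s a_def[symmetric] by (simp add: d_def mult.assoc mult.left_commute)
  qed
  have le: "min (p\<^sup>2 * exp (2 * s)) M \<le> min (p\<^sup>2 * exp (2 * t)) M" if "s \<le> t" for p s t :: real
    using that by (intro min.mono mult_left_mono) auto
  have "\<bar>min (p\<^sup>2 * exp (2 * t)) M - min (p\<^sup>2 * exp (2 * s)) M\<bar> \<le> 2 * M * \<bar>t - s\<bar>" for p s t :: real
    using mono[of s t p] mono[of t s p] le[of s t p] le[of t s p] by (cases "s \<le> t") auto
  moreover have "2 * M * \<bar>snd z - snd z'\<bar> \<le> 2 * M * dist z z'" for z z' :: "'a \<times> real"
    using dist_snd_le[of z z'] M by (intro mult_left_mono) (auto simp: dist_real_def)
  ultimately have "\<bar>min (p\<^sup>2 * exp (2 * snd z)) M - min (p\<^sup>2 * exp (2 * snd z')) M\<bar> \<le> 2 * M * dist z z'"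
    for p :: real and z z' :: "'a \<times> real"
    by (meson order_trans)
  then show ?thesis
    using M by (intro bdd_lipschitzI[of M "2 * M"]) (auto simp: abs_if min_def mult_less_0_iff)
qed

lemma prufer_family:
  fixes q :: "real \<Rightarrow> real \<Rightarrow> real \<times> real \<Rightarrow> real"
  assumes "A \<le> B" and P: "continuous_on {0..pi} P"
    and q: "continuous_on ({A..B} \<times> {0..pi} \<times> UNIV) (\<lambda>(p, x, z). q p x z)" "bdd_lipschitz {A..B} q"
  obtains \<theta> \<rho> where "\<And>p. p \<in> {A..B} \<Longrightarrow> \<theta> p 0 = \<beta> \<and> \<rho> p 0 = 0 \<and>
      prufer_angle P (\<lambda>x. q p x (\<theta> p x, \<rho> p x)) (\<theta> p) \<and>
      prufer_amplitude P (\<lambda>x. q p x (\<theta> p x, \<rho> p x)) (\<theta> p) (\<rho> p)"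
    "continuous_on {A..B} (\<lambda>p. \<theta> p pi)"
proof -
  define F1 where "F1 p x z = P x * (cos (fst z) * cos (fst z)) + q p x z * (sin (fst z) * sin (fst z))" for p x z
  define F2 where "F2 p x z = sin (fst z) * cos (fst z) * (P x - q p x z)" for p x z
  obtain C where C: "\<And>x. x \<in> {0..pi} \<Longrightarrow> \<bar>P x\<bar> \<le> C" using continuous_on_Icc_bounded[OF P] by metis
  note bl = bdd_lipschitz_add bdd_lipschitz_mult bdd_lipschitz_diff q(2)
    bdd_lipschitz_sin_fst bdd_lipschitz_cos_fst bdd_lipschitz_const[OF C]
  have "bdd_lipschitz {A..B} F1" "bdd_lipschitz {A..B} F2"
    unfolding F1_def[abs_def] F2_def[abs_def] by (intro bl; assumption)+
  then obtain L1 L2 where L: "L1 \<ge> 0" "L2 \<ge> 0"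
      "\<And>p x z z'. p \<in> {A..B} \<Longrightarrow> x \<in> {0..pi} \<Longrightarrow> \<bar>F1 p x z - F1 p x z'\<bar> \<le> L1 * dist z z'"
      "\<And>p x z z'. p \<in> {A..B} \<Longrightarrow> x \<in> {0..pi} \<Longrightarrow> \<bar>F2 p x z - F2 p x z'\<bar> \<le> L2 * dist z z'"
    unfolding bdd_lipschitz_def by blast
  define D where "D = {A..B} \<times> {0..pi} \<times> (UNIV :: (real \<times> real) set)"
  have cP: "continuous_on D (\<lambda>w. P (fst (snd w)))"
    by (rule continuous_on_compose2[OF P]) (auto simp: D_def intro!: continuous_intros)
  have cq: "continuous_on D (\<lambda>w. q (fst w) (fst (snd w)) (snd (snd w)))"
    using q(1) by (simp add: D_def split_beta)
  have cF: "continuous_on D (\<lambda>(p, x, z). (F1 p x z, F2 p x z))"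
    unfolding split_beta F1_def F2_def by (intro continuous_intros cP cq)
  obtain z where z: "\<And>p. p \<in> {A..B} \<Longrightarrow> z p 0 = (\<beta>, 0)"
      "\<And>p x. p \<in> {A..B} \<Longrightarrow> x \<in> {0..pi} \<Longrightarrow>
        (z p has_vector_derivative (F1 p x (z p x), F2 p x (z p x))) (at x within {0..pi})"
      "continuous_on {A..B} (\<lambda>p. z p pi)"
  proof (rule ode_solution_with_parameter[of A B pi "\<lambda>p x z. (F1 p x z, F2 p x z)" "L1 + L2" "(\<beta>, 0)"])
    fix p x and z z' :: "real \<times> real" assume px: "p \<in> {A..B}" "x \<in> {0..pi}"
    have "norm ((F1 p x z, F2 p x z) - (F1 p x z', F2 p x z')) \<le>
        \<bar>F1 p x z - F1 p x z'\<bar> + \<bar>F2 p x z - F2 p x z'\<bar>"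
      by (metis diff_Pair norm_Pair_le real_norm_def)
    also have "\<dots> \<le> (L1 + L2) * norm (z - z')"
      using L(3,4)[OF px, of z z'] by (simp add: distrib_right dist_norm)
    finally show "norm ((F1 p x z, F2 p x z) - (F1 p x z', F2 p x z')) \<le> (L1 + L2) * norm (z - z')" .
  qed (use \<open>A \<le> B\<close> cF in \<open>auto simp: D_def\<close>)
  show ?thesis
  proof (rule that[of "\<lambda>p x. fst (z p x)" "\<lambda>p x. snd (z p x)"])
    fix p assume p: "p \<in> {A..B}"
    have "((\<lambda>x. fst (z p x)) has_real_derivative F1 p x (z p x)) (at x within {0..pi})"
      "((\<lambda>x. snd (z p x)) has_real_derivative F2 p x (z p x)) (at x within {0..pi})" if "x \<in> {0..pi}" for x
      using bounded_linear.has_vector_derivative[OF bounded_linear_fst z(2)[OF p that]]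
        bounded_linear.has_vector_derivative[OF bounded_linear_snd z(2)[OF p that]]
      by (simp_all add: has_real_derivative_iff_has_vector_derivative)
    then show "fst (z p 0) = \<beta> \<and> snd (z p 0) = 0 \<and>
        prufer_angle P (\<lambda>x. q p x (fst (z p x), snd (z p x))) (\<lambda>x. fst (z p x)) \<and>
        prufer_amplitude P (\<lambda>x. q p x (fst (z p x), snd (z p x))) (\<lambda>x. fst (z p x)) (\<lambda>x. snd (z p x))"
      using z(1)[OF p] by (simp add: prufer_angle_def prufer_amplitude_def F1_def F2_def power2_eq_square)
  qed (intro continuous_intros z)
qed

lemma prufer_exists:
  assumes P: "continuous_on {0..pi} P" and q: "continuous_on {0..pi} q"
  obtains \<theta> \<rho> where "\<theta> 0 = \<beta>" "\<rho> 0 = 0" "prufer_angle P q \<theta>" "prufer_amplitude P q \<theta> \<rho>"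
proof -
  obtain C where C: "\<And>x. x \<in> {0..pi} \<Longrightarrow> \<bar>q x\<bar> \<le> C" using continuous_on_Icc_bounded[OF q] by metis
  have c: "continuous_on ({0..0::real} \<times> {0..pi} \<times> (UNIV :: (real \<times> real) set)) (\<lambda>(p, x, z). q x)"
    unfolding split_beta
    by (rule continuous_on_compose2[OF q]) (auto intro!: continuous_intros)
  show ?thesis
  proof (rule prufer_family[OF order_refl P c, where \<beta>=\<beta>])
    show "bdd_lipschitz {0..0} (\<lambda>p x (z :: real \<times> real). q x)"
      by (rule bdd_lipschitz_const[OF C])
    fix \<theta> \<rho> assume *: "\<And>p :: real. p \<in> {0..0} \<Longrightarrow> \<theta> p 0 = \<beta> \<and> \<rho> p 0 = 0 \<and>
      prufer_angle P q (\<theta> p) \<and> prufer_amplitude P q (\<theta> p) (\<rho> p)"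
    show thesis
      using *[of 0] by (intro that[of "\<theta> 0" "\<rho> 0"]) auto
  qed
qed

lemma planar_system_prufer:
  assumes "prufer_angle P q \<theta>" "prufer_amplitude P q \<theta> \<rho>"
  shows "planar_system P q (\<lambda>x. c * exp (\<rho> x) * sin (\<theta> x)) (\<lambda>x. c * exp (\<rho> x) * cos (\<theta> x))"
  unfolding planar_system_def
proof (intro ballI conjI)
  fix x assume x: "x \<in> {0..pi}"
  note d = prufer_angleD[OF assms(1) x] prufer_amplitudeD[OF assms(2) x]
  have s: "(sin (\<theta> x))\<^sup>2 = 1 - (cos (\<theta> x))\<^sup>2" by (rule sin_squared_eq)
  show "((\<lambda>x. c * exp (\<rho> x) * sin (\<theta> x)) has_real_derivative P x * (c * exp (\<rho> x) * cos (\<theta> x)))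
      (at x within {0..pi})"
  proof (rule DERIV_cong)
    show "((\<lambda>x. c * exp (\<rho> x) * sin (\<theta> x)) has_real_derivative
      c * (exp (\<rho> x) * (sin (\<theta> x) * cos (\<theta> x) * (P x - q x))) * sin (\<theta> x) +
      cos (\<theta> x) * (P x * (cos (\<theta> x))\<^sup>2 + q x * (sin (\<theta> x))\<^sup>2) * (c * exp (\<rho> x)))
      (at x within {0..pi})"
      (is "(_ has_real_derivative ?L) _")
      by (intro DERIV_mult DERIV_cmult d DERIV_chain2[OF DERIV_exp] DERIV_chain2[OF DERIV_sin])
    have "sin (\<theta> x) * cos (\<theta> x) * (P x - q x) * sin (\<theta> x) +
        cos (\<theta> x) * (P x * (cos (\<theta> x))\<^sup>2 + q x * (sin (\<theta> x))\<^sup>2) =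
        P x * cos (\<theta> x) * ((sin (\<theta> x))\<^sup>2 + (cos (\<theta> x))\<^sup>2)"
      by algebra
    also have "\<dots> = P x * cos (\<theta> x)" by simp
    finally have *: "sin (\<theta> x) * cos (\<theta> x) * (P x - q x) * sin (\<theta> x) + cos (\<theta> x) * (P x * (cos (\<theta> x))\<^sup>2 + q x * (sin (\<theta> x))\<^sup>2) = P x * cos (\<theta> x)" .
    have "c * (exp (\<rho> x) * a) * s + b * (c * exp (\<rho> x)) = (c * exp (\<rho> x)) * (a * s + b)" for a b s
      by (simp add: algebra_simps)
    then show "?L
      = P x * (c * exp (\<rho> x) * cos (\<theta> x))"
      by (simp only: *) simp
  qed
  show "((\<lambda>x. c * exp (\<rho> x) * cos (\<theta> x)) has_real_derivative - (q x * (c * exp (\<rho> x) * sin (\<theta> x))))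
      (at x within {0..pi})"
  proof (rule DERIV_cong)
    show "((\<lambda>x. c * exp (\<rho> x) * cos (\<theta> x)) has_real_derivative
      c * (exp (\<rho> x) * (sin (\<theta> x) * cos (\<theta> x) * (P x - q x))) * cos (\<theta> x) +
      - sin (\<theta> x) * (P x * (cos (\<theta> x))\<^sup>2 + q x * (sin (\<theta> x))\<^sup>2) * (c * exp (\<rho> x)))
      (at x within {0..pi})"
      (is "(_ has_real_derivative ?L) _")
      by (intro DERIV_mult DERIV_cmult d DERIV_chain2[OF DERIV_exp] DERIV_chain2[OF DERIV_cos])
    have "sin (\<theta> x) * cos (\<theta> x) * (P x - q x) * cos (\<theta> x) +
        - sin (\<theta> x) * (P x * (cos (\<theta> x))\<^sup>2 + q x * (sin (\<theta> x))\<^sup>2) =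
        - (q x * sin (\<theta> x) * ((sin (\<theta> x))\<^sup>2 + (cos (\<theta> x))\<^sup>2))"
      by algebra
    also have "\<dots> = - (q x * sin (\<theta> x))" by simp
    finally have *: "sin (\<theta> x) * cos (\<theta> x) * (P x - q x) * cos (\<theta> x) + - sin (\<theta> x) * (P x * (cos (\<theta> x))\<^sup>2 + q x * (sin (\<theta> x))\<^sup>2) = - (q x * sin (\<theta> x))" .
    have "c * (exp (\<rho> x) * a) * s + b * (c * exp (\<rho> x)) = (c * exp (\<rho> x)) * (a * s + b)" for a b s
      by (simp add: algebra_simps)
    then show "?L
      = - (q x * (c * exp (\<rho> x) * sin (\<theta> x)))"
      by (simp only: *) simp
  qed
qed

text \<open>For the difference of two solutions, \<open>v^2 + y^2\<close> has derivative
  \<open>2 * v * y * (P - q)\<close>, at most \<open>C * (v^2 + y^2)\<close>, so Gronwall keeps it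
  at zero.\<close>

lemma planar_system_unique:
  assumes P: "continuous_on {0..pi} P" and q: "continuous_on {0..pi} q"
    and 1: "planar_system P q v1 y1" and 2: "planar_system P q v2 y2"
    and init: "v1 0 = v2 0" "y1 0 = y2 0" and x: "x \<in> {0..pi}"
  shows "v1 x = v2 x \<and> y1 x = y2 x"
proof -
  define v where "v x = v1 x - v2 x" for x
  define y where "y x = y1 x - y2 x" for x
  obtain C where C: "C > 0" "\<And>x. x \<in> {0..pi} \<Longrightarrow> \<bar>P x - q x\<bar> \<le> C"
    using continuous_on_Icc_bounded[OF continuous_on_diff[OF P q]] by metis
  have d: "(v has_real_derivative P x * y x) (at x within {0..pi})"
    "(y has_real_derivative - (q x * v x)) (at x within {0..pi})" if "x \<in> {0..pi}" for x
    unfolding v_def[abs_def] y_def[abs_def]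
    using DERIV_diff[OF planar_systemD(1)[OF 1 that] planar_systemD(1)[OF 2 that]]
      DERIV_diff[OF planar_systemD(2)[OF 1 that] planar_systemD(2)[OF 2 that]]
    by (simp_all add: algebra_simps)
  have "(v x)\<^sup>2 + (y x)\<^sup>2 \<le> ((v 0)\<^sup>2 + (y 0)\<^sup>2 + 0 * (x - 0)) * exp (C * (x - 0))"
  proof (rule gronwall[where b=pi])
    fix t assume t: "t \<in> {0..pi}"
    show "((\<lambda>x. (v x)\<^sup>2 + (y x)\<^sup>2) has_real_derivative 2 * v t * y t * (P t - q t)) (at t within {0..pi})"
      using d[OF t] by (auto intro!: derivative_eq_intros simp: algebra_simps)
    have "2 * v t * y t * (P t - q t) \<le> \<bar>2 * v t * y t\<bar> * \<bar>P t - q t\<bar>"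
      by (metis abs_ge_self abs_mult)
    also have "\<dots> \<le> ((v t)\<^sup>2 + (y t)\<^sup>2) * C"
      using C(2)[OF t] zero_le_power2[of "v t - y t"] zero_le_power2[of "v t + y t"]
      by (intro mult_mono) (auto simp: power2_eq_square algebra_simps abs_if)
    finally show "2 * v t * y t * (P t - q t) \<le> C * ((v t)\<^sup>2 + (y t)\<^sup>2) + 0" by (simp add: mult.commute)
  qed (use C x in auto)
  also have "\<dots> = 0" using init by (simp add: v_def y_def)
  finally have "(v x)\<^sup>2 + (y x)\<^sup>2 \<le> 0" .
  then have "v x = 0 \<and> y x = 0"
    by (metis add_nonneg_eq_0_iff antisym power2_eq_iff zero_eq_power2 zero_le_power2 add_nonneg_nonneg)
  then show ?thesis by (simp add: v_def y_def)
qed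

section \<open>Sturm comparison and the counting of roots\<close>

lemma sin_squared_diff: "(sin a)\<^sup>2 - (sin b)\<^sup>2 = sin (a + b) * sin (a - b)" for a b :: real
proof -
  have "sin (a + b) * sin (a - b) = (sin a)\<^sup>2 * (cos b)\<^sup>2 - (cos a)\<^sup>2 * (sin b)\<^sup>2"
    by (simp add: sin_add sin_diff power2_eq_square algebra_simps)
  then show ?thesis by (simp add: cos_squared_eq algebra_simps)
qed

lemma abs_sin_squared_diff_le: "\<bar>(sin a)\<^sup>2 - (sin b)\<^sup>2\<bar> \<le> \<bar>a - b\<bar>" for a b :: real
proof -
  have "\<bar>(sin a)\<^sup>2 - (sin b)\<^sup>2\<bar> \<le> 1 * \<bar>a - b\<bar>"
    unfolding sin_squared_diff abs_mult
    using abs_sin_x_le_abs_x[of "a - b"] by (intro mult_mono) auto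
  then show ?thesis by simp
qed

text \<open>Sturm comparison: the angles cannot stay equal, since \<open>sin \<theta>2\<close> would then vanish identically
  although \<open>\<theta>2\<close> increases at each zero of \<open>sin \<theta>2\<close>.\<close>
lemma
  assumes P: "continuous_on {0..pi} P" "\<And>x. x \<in> {0..pi} \<Longrightarrow> P x > 0"
    and q1c: "continuous_on {0..pi} q1"
    and 1: "prufer_angle P q1 \<theta>1" and 2: "prufer_angle P q2 \<theta>2" and init: "\<theta>1 0 = \<theta>2 0"
    and le: "\<And>x. x \<in> {0..pi} \<Longrightarrow> q1 x \<le> q2 x"
  shows prufer_angle_mono: "x \<in> {0..pi} \<Longrightarrow> \<theta>1 x \<le> \<theta>2 x"
    and prufer_angle_strict_mono:
      "(\<And>x. x \<in> {0..pi} \<Longrightarrow> q1 x = q2 x \<Longrightarrow> sin (\<theta>1 x) = 0 \<or> sin (\<theta>2 x) = 0)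
        \<Longrightarrow> \<theta>1 pi < \<theta>2 pi"
proof -
  define w where "w x = \<theta>2 x - \<theta>1 x" for x
  define e where "e x = (q2 x - q1 x) * (sin (\<theta>2 x))\<^sup>2" for x
  \<comment> \<open>The derivative of \<open>w\<close> splits into a part controlled by
    \<open>C * \<bar>w\<bar>\<close> and the forcing \<open>e >= 0\<close>, which carries the gap
    between the potentials.\<close>
  define w' where "w' x = (q1 x - P x) * ((sin (\<theta>2 x))\<^sup>2 - (sin (\<theta>1 x))\<^sup>2) + e x" for x
  obtain C where C: "C > 0" "\<And>x. x \<in> {0..pi} \<Longrightarrow> \<bar>q1 x - P x\<bar> \<le> C"
    using continuous_on_Icc_bounded[OF continuous_on_diff[OF q1c P(1)]] by metis
  have e0: "e x \<ge> 0" if "x \<in> {0..pi}" for x using le[OF that] by (simp add: e_def)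
  have dw: "(w has_real_derivative w' x) (at x within {0..pi})" if "x \<in> {0..pi}" for x
  proof -
    have "P x * (cos (\<theta>2 x))\<^sup>2 + q2 x * (sin (\<theta>2 x))\<^sup>2 - (P x * (cos (\<theta>1 x))\<^sup>2 + q1 x * (sin (\<theta>1 x))\<^sup>2) = w' x"
      by (simp add: w'_def e_def cos_squared_eq algebra_simps)
    with DERIV_diff[OF prufer_angleD[OF 2 that] prufer_angleD[OF 1 that]] show ?thesis
      unfolding w_def[abs_def] by simp
  qed
  have w'lb: "w' x \<ge> - C * \<bar>w x\<bar> + e x" if x: "x \<in> {0..pi}" for x
  proof -
    have "\<bar>(q1 x - P x) * ((sin (\<theta>2 x))\<^sup>2 - (sin (\<theta>1 x))\<^sup>2)\<bar> \<le> C * \<bar>w x\<bar>"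
      unfolding abs_mult w_def using C x abs_sin_squared_diff_le by (intro mult_mono) auto
    then show ?thesis unfolding w'_def by linarith
  qed
  have nn: "w x \<ge> 0" if x: "x \<in> {0..pi}" for x
  proof -
    have "(max 0 (- w x))\<^sup>2 \<le> ((max 0 (- w 0))\<^sup>2 + 0 * (x - 0)) * exp (2 * C * (x - 0))"
    proof (rule gronwall[where b=pi])
      fix t assume t: "t \<in> {0..pi}"
      show "((\<lambda>x. (max 0 (- w x))\<^sup>2) has_real_derivative 2 * max 0 (- w t) * - w' t) (at t within {0..pi})"
        by (rule DERIV_chain2[where f="\<lambda>t. (max 0 t)\<^sup>2" and g="\<lambda>x. - w x"])
           (auto intro!: has_real_derivative_positive_part_square DERIV_minus dw t)
      define m where "m = max 0 (- w t)"
      have "m * - w' t \<le> m * (C * \<bar>w t\<bar>)"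
        using w'lb[OF t] e0[OF t] by (intro mult_left_mono) (auto simp: m_def)
      also have "\<dots> = C * m\<^sup>2" by (auto simp: m_def max_def power2_eq_square)
      finally have "2 * m * - w' t \<le> 2 * C * m\<^sup>2 + 0" by simp
      then show "2 * max 0 (- w t) * - w' t \<le> 2 * C * (max 0 (- w t))\<^sup>2 + 0"
        unfolding m_def .
    qed (use C x in auto)
    then have "(max 0 (- w x))\<^sup>2 \<le> 0" using init by (simp add: w_def)
    then show ?thesis by (simp add: max_def split: if_splits)
  qed
  then show "x \<in> {0..pi} \<Longrightarrow> \<theta>1 x \<le> \<theta>2 x" by (simp add: w_def)
  assume strict: "\<And>x. x \<in> {0..pi} \<Longrightarrow> q1 x = q2 x \<Longrightarrow> sin (\<theta>1 x) = 0 \<or> sin (\<theta>2 x) = 0"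
  \<comment> \<open>\<open>w * exp (C * x)\<close> is nondecreasing, so equality of the angles at
    \<open>pi\<close> would force equality on all of \<open>[0, pi]\<close>, and the forcing would
    vanish in the interior.\<close>
  have mono: "w x * exp (C * x) \<le> w pi * exp (C * pi)" if x: "x \<in> {0..pi}" for x
  proof (rule derivative_nonneg_imp_mono[where a=0 and b=pi and f="\<lambda>x. w x * exp (C * x)"])
    fix t assume t: "t \<in> {0..pi}"
    show "((\<lambda>x. w x * exp (C * x)) has_real_derivative (w' t + C * w t) * exp (C * t)) (at t within {0..pi})"
      using dw[OF t] by (auto intro!: derivative_eq_intros simp: algebra_simps)
    show "0 \<le> (w' t + C * w t) * exp (C * t)"
      using w'lb[OF t] e0[OF t] nn[OF t] by simp
  qed (use x in auto)
  have "w pi \<noteq> 0"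
  proof
    assume "w pi = 0"
    then have w0: "w x = 0" if "x \<in> {0..pi}" for x
      using mono[OF that] nn[OF that] by (simp add: mult_le_0_iff)
    have at: "at x within {0..pi} = at x" if "x \<in> {0<..<pi}" for x
      using that by (intro at_within_interior) auto
    have s0: "sin (\<theta>2 x) = 0" if x: "x \<in> {0<..<pi}" for x
    proof -
      have xI: "x \<in> {0..pi}" using x by auto
      have "(w has_real_derivative 0) (at x within {0..pi})"
        by (rule has_real_derivative_cong_on[OF xI w0]) auto
      with dw[OF xI] have "w' x = 0" using DERIV_unique at[OF x] by metis
      moreover have eq: "\<theta>2 x = \<theta>1 x" using w0[OF xI] by (simp add: w_def)
      ultimately have "e x = 0" by (simp add: w'_def)
      then show ?thesis using strict[OF xI] eq by (auto simp: e_def)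
    qed
    define m where "m = pi / 2"
    have m: "m \<in> {0<..<pi}" "m \<in> {0..pi}" by (auto simp: m_def)
    have "((\<lambda>x. sin (\<theta>2 x)) has_real_derivative cos (\<theta>2 m) * (P m * (cos (\<theta>2 m))\<^sup>2 + q2 m * (sin (\<theta>2 m))\<^sup>2)) (at m)"
      using DERIV_chain2[OF DERIV_sin prufer_angleD[OF 2 m(2)]] at[OF m(1)] by simp
    moreover have "((\<lambda>x. sin (\<theta>2 x)) has_real_derivative 0) (at m)"
      by (rule has_field_derivative_transform_within_open[where f="\<lambda>x. 0" and S="{0<..<pi}"])
         (use m s0 in auto)
    ultimately have "cos (\<theta>2 m) * (P m * (cos (\<theta>2 m))\<^sup>2 + q2 m * (sin (\<theta>2 m))\<^sup>2) = 0"
      by (rule DERIV_unique)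
    with s0[OF m(1)] P(2)[OF m(2)] have "cos (\<theta>2 m) = 0" by auto
    with s0[OF m(1)] show False by (metis sin_zero_abs_cos_one abs_zero zero_neq_one)
  qed
  with nn[of pi] show "\<theta>1 pi < \<theta>2 pi" by (simp add: w_def)
qed

text \<open>At a multiple of \<open>pi\<close> the sine vanishes and the derivative of the angle is
  \<open>P > 0\<close>, independently of \<open>q\<close>; so a multiple once reached is left behind
  for good.\<close>

lemma prufer_angle_crosses_up:
  assumes P: "\<And>x. x \<in> {0..pi} \<Longrightarrow> P x > 0" and \<theta>: "prufer_angle P q \<theta>"
    and ab: "0 \<le> a" "a < x" "x \<le> pi" and a: "real_of_int j * pi \<le> \<theta> a"
  shows "real_of_int j * pi < \<theta> x"
proof -
  have "0 < \<theta> x - real_of_int j * pi"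
  proof (rule pos_if_upcrossing[where a=a and b=x and g="\<lambda>x. \<theta> x - real_of_int j * pi"])
    show "continuous_on {a..x} (\<lambda>x. \<theta> x - real_of_int j * pi)"
      using ab by (intro continuous_intros continuous_on_subset[OF cont_prufer_angle[OF \<theta>]]) auto
    fix t assume t: "t \<in> {a..x}" "\<theta> t - real_of_int j * pi = 0"
    have tI: "t \<in> {0..pi}" using t ab by auto
    have th: "\<theta> t = pi * real_of_int j" using t by (simp add: mult.commute)
    have s: "sin (\<theta> t) = 0" unfolding th by (auto simp: sin_zero_iff_int2)
    then have c: "(cos (\<theta> t))\<^sup>2 = 1" by (simp add: cos_squared_eq)
    have "(\<theta> has_real_derivative P t) (at t within {0..pi})"
      using prufer_angleD[OF \<theta> tI] by (simp add: s c)
    then have "((\<lambda>x. \<theta> x - real_of_int j * pi) has_real_derivative P t) (at t within {a..x})"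
      using ab by (auto intro!: derivative_eq_intros intro: DERIV_subset)
    then show "\<exists>D>0. ((\<lambda>x. \<theta> x - real_of_int j * pi) has_real_derivative D) (at t within {a..x})"
      using P[OF tI] by blast
  qed (use ab a in auto)
  then show ?thesis by simp
qed

text \<open>Each \<open>j * pi\<close> with \<open>1 <= j <= n\<close> is attained by the
  intermediate value theorem, and only once since it is crossed upwards. Taking
  \<open>\<beta>\<close> in \<open>(0, pi]\<close> leaves a zero at the right end point out of the
  count: for \<open>\<beta> = pi\<close> the multiple \<open>(n + 1) * pi\<close> is reached at
  \<open>pi\<close> only.\<close>

lemma prufer_angle_root_count:
  assumes P: "\<And>x. x \<in> {0..pi} \<Longrightarrow> P x > 0" and \<theta>: "prufer_angle P q \<theta>"
    and init: "0 \<le> \<theta> 0" "\<theta> 0 < pi" and fin: "\<theta> pi = \<beta> + real n * pi" "0 < \<beta>" "\<beta> \<le> pi"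
  shows "finite {x \<in> {0<..<pi}. sin (\<theta> x) = 0} \<and> card {x \<in> {0<..<pi}. sin (\<theta> x) = 0} = n"
proof -
  let ?Z = "{x \<in> {0<..<pi}. sin (\<theta> x) = 0}"
  note up = prufer_angle_crosses_up[OF P \<theta>]
  have inj: "x = y" if "\<theta> x = real_of_int j * pi" "\<theta> y = real_of_int j * pi" "x \<in> {0<..<pi}" "y \<in> {0<..<pi}" for x y j
    using up[of x y j] up[of y x j] that by (cases x y rule: linorder_cases) auto
  have ex: "\<exists>x\<in>?Z. \<theta> x = real j * pi" if j: "j \<in> {1..n}" for j
  proof -
    have "1 * pi \<le> real j * pi" "real j * pi \<le> real n * pi"
      using j by (intro mult_right_mono; simp)+
    then have lt: "\<theta> 0 < real j * pi" "real j * pi < \<theta> pi" using init fin by linarith+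
    obtain x where x: "0 \<le> x" "x \<le> pi" "\<theta> x = real j * pi"
      using IVT'[of \<theta> 0 "real j * pi" pi] lt cont_prufer_angle[OF \<theta>] by force
    moreover have "x \<noteq> 0" "x \<noteq> pi" using x lt by auto
    ultimately show ?thesis by (intro bexI[of _ x]) auto
  qed
  then obtain f where f: "\<And>j. j \<in> {1..n} \<Longrightarrow> f j \<in> ?Z \<and> \<theta> (f j) = real j * pi" by metis
  have "bij_betw f {1..n} ?Z"
    unfolding bij_betw_def
  proof (intro conjI inj_onI subset_antisym subsetI)
    fix i j assume "i \<in> {1..n}" "j \<in> {1..n}" "f i = f j"
    then have "real i * pi = real j * pi" using f by metis
    then show "i = j" by simp
  next
    fix x assume "x \<in> f ` {1..n}"
    then show "x \<in> ?Z" using f by auto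
  next
    fix x assume x: "x \<in> ?Z"
    then obtain i where i: "\<theta> x = real_of_int i * pi" by (auto simp: sin_zero_iff_int2)
    have "0 < \<theta> x" using up[of 0 x 0] x init by auto
    then have "0 < i" by (simp add: i zero_less_mult_iff)
    have "real_of_int i * pi < \<theta> pi" using up[of x pi i] x i by auto
    also have "\<dots> \<le> (real n + 1) * pi" using fin by (simp add: algebra_simps)
    finally have "i < int n + 1" by (simp add: mult_less_cancel_right) 
    then have n: "nat i \<in> {1..n}" using \<open>0 < i\<close> by auto
    have "real (nat i) = real_of_int i" using \<open>0 < i\<close> by simp
    then have "\<theta> (f (nat i)) = real_of_int i * pi" using f[OF n] by metis
    moreover have "f (nat i) \<in> ?Z" using f[OF n] by blast
    ultimately have "x = f (nat i)" using inj[OF i] x by blast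
    then show "x \<in> f ` {1..n}" using n by blast
  qed
  then have "finite {1..n} = finite ?Z" "card {1..n} = card ?Z"
    by (rule bij_betw_finite, rule bij_betw_same_card)
  then show ?thesis by simp
qed

text \<open>The function \<open>\<tau>\<close> is the continuous branch of \<open>arctan (K * tan \<theta>)\<close>.\<close>
lemma rotation_lower_bound:
  fixes \<theta> :: "real \<Rightarrow> real"
  assumes d: "\<And>x. x \<in> {0..pi} \<Longrightarrow> (\<theta> has_real_derivative \<theta>' x) (at x within {0..pi})"
    and lb: "\<And>x. x \<in> {0..pi} \<Longrightarrow> p * ((cos (\<theta> x))\<^sup>2 + K\<^sup>2 * (sin (\<theta> x))\<^sup>2) \<le> \<theta>' x"
    and K: "K > 0"
  shows "\<theta> 0 - pi + K * p * pi \<le> \<theta> pi"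
proof -
  \<comment> \<open>\<open>N t / D t\<close> is the tangent of \<open>\<tau> t - t\<close> when
    \<open>tan (\<tau> t) = K * tan t\<close>. Since \<open>D > 0\<close>, there are no poles and
    the formula stays on one branch.\<close>
  define N where "N t = (K - 1) * (sin t * cos t)" for t
  define D where "D t = (cos t)\<^sup>2 + K * (sin t)\<^sup>2" for t
  define \<tau> where "\<tau> t = t + arctan (N t / D t)" for t
  define E where "E t = (cos t)\<^sup>2 + K\<^sup>2 * (sin t)\<^sup>2" for t
  have D0: "D t > 0" and E0: "E t > 0" for t
  proof -
    have "sin t \<noteq> 0 \<or> cos t \<noteq> 0" by (metis sin_zero_abs_cos_one abs_zero zero_neq_one)
    then show "D t > 0" "E t > 0"
      using K by (auto simp: D_def E_def add_pos_nonneg add_nonneg_pos)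
  qed
  have d\<tau>: "(\<tau> has_real_derivative K / E t) (at t)" for t
  proof -
    define s c where "s = sin t" and "c = cos t"
    have sc: "s\<^sup>2 = 1 - c\<^sup>2" by (simp add: s_def c_def sin_squared_eq)
    have ND: "(N t)\<^sup>2 + (D t)\<^sup>2 = E t"
      unfolding N_def D_def E_def s_def[symmetric] c_def[symmetric] power_mult_distrib sc
      by (simp add: power2_eq_square algebra_simps)
    have dN: "(N has_real_derivative (K - 1) * (c\<^sup>2 - s\<^sup>2)) (at t)"
      unfolding N_def[abs_def] s_def c_def
      by (auto intro!: derivative_eq_intros simp: power2_eq_square algebra_simps)
    have dD: "(D has_real_derivative 2 * (K - 1) * (s * c)) (at t)"
      unfolding D_def[abs_def] s_def c_def
      by (auto intro!: derivative_eq_intros simp: power2_eq_square algebra_simps)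
    have "((\<lambda>t. N t / D t) has_real_derivative
        ((K - 1) * (c\<^sup>2 - s\<^sup>2) * D t - N t * (2 * (K - 1) * (s * c))) / (D t * D t)) (at t)"
      by (rule DERIV_divide[OF dN dD]) (use D0[of t] in auto)
    then have "(\<tau> has_real_derivative 1 + inverse (1 + (N t / D t)\<^sup>2) *
        (((K - 1) * (c\<^sup>2 - s\<^sup>2) * D t - N t * (2 * (K - 1) * (s * c))) / (D t * D t))) (at t)"
      unfolding \<tau>_def[abs_def]
      by (intro DERIV_add DERIV_ident DERIV_chain2[OF DERIV_arctan])
    moreover have "inverse (1 + (N t / D t)\<^sup>2) / (D t * D t) = 1 / E t"
    proof -
      have "(1 + (N t / D t)\<^sup>2) * (D t * D t) = E t"
        using D0[of t] ND by (simp add: field_simps power2_eq_square)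
      then show ?thesis by (metis divide_inverse inverse_mult_distrib mult_1)
    qed
    moreover have "E t + ((K - 1) * (c\<^sup>2 - s\<^sup>2) * D t - N t * (2 * (K - 1) * (s * c))) = K"
    proof -
      have "(s * c) * (s * c) = s\<^sup>2 * c\<^sup>2" by (simp add: power2_eq_square)
      then have "N t * (2 * (K - 1) * (s * c)) = 2 * (K - 1)\<^sup>2 * (s\<^sup>2 * c\<^sup>2)"
        by (simp add: N_def s_def c_def power2_eq_square)
      then show ?thesis
        unfolding D_def E_def s_def[symmetric] c_def[symmetric] sc
        by (simp add: power2_eq_square algebra_simps)
    qed
    ultimately show ?thesis
      using E0[of t] by (simp add: divide_inverse mult.assoc add_divide_distrib)
         (simp add: field_simps)
  qed
  \<comment> \<open>In the new angle the speed is at least \<open>K * p\<close>; the new angle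
    differs from the old one by less than \<open>pi / 2\<close> at either end, which costs
    \<open>pi\<close> in total.\<close>
  have "- \<tau> (\<theta> pi) - - \<tau> (\<theta> 0) \<le> - (K * p) * (pi - 0)"
  proof (rule derivative_le_imp_le[where a=0 and b=pi and f="\<lambda>x. - \<tau> (\<theta> x)"])
    fix x assume x: "x \<in> {0..pi}"
    show "((\<lambda>x. - \<tau> (\<theta> x)) has_real_derivative - (K / E (\<theta> x) * \<theta>' x)) (at x within {0..pi})"
      by (intro DERIV_minus DERIV_chain2[OF d\<tau> d[OF x]])
    have "K * p = K / E (\<theta> x) * (p * E (\<theta> x))" using E0[of "\<theta> x"] by simp
    also have "\<dots> \<le> K / E (\<theta> x) * \<theta>' x"
      using lb[OF x] K E0[of "\<theta> x"] by (intro mult_left_mono) (auto simp: E_def)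
    finally show "- (K / E (\<theta> x) * \<theta>' x) \<le> - (K * p)" by simp
  qed auto
  moreover have "\<tau> (\<theta> pi) < \<theta> pi + pi/2" "\<theta> 0 - pi/2 < \<tau> (\<theta> 0)"
    unfolding \<tau>_def using arctan_bounded by (smt (verit))+
  ultimately show ?thesis by (simp add: algebra_simps)
qed

text \<open>The line from \<open>3 * pi / 4\<close> down to \<open>pi / 4\<close> with slope
  \<open>- 1/2\<close> is a barrier: on it the squared sine is at least 1/2, so an angle touching it
  decreases faster than the line does.\<close>

lemma rotation_upper_bound:
  fixes \<theta> :: "real \<Rightarrow> real"
  assumes d: "\<And>x. x \<in> {0..pi} \<Longrightarrow> (\<theta> has_real_derivative \<theta>' x) (at x within {0..pi})"
    and ub: "\<And>x. x \<in> {0..pi} \<Longrightarrow> 1/2 \<le> (sin (\<theta> x))\<^sup>2 \<Longrightarrow> \<theta>' x \<le> - 1"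
    and init: "\<theta> 0 \<le> 3 * pi / 4"
  shows "\<theta> pi < pi / 4"
proof -
  have "0 < (3 * pi / 4 - pi / 2) - \<theta> pi"
  proof (rule pos_if_upcrossing[where a=0 and b=pi and g="\<lambda>x. (3 * pi / 4 - x / 2) - \<theta> x"])
    show "continuous_on {0..pi} (\<lambda>x. (3 * pi / 4 - x / 2) - \<theta> x)"
      by (intro continuous_intros DERIV_continuous_on[OF d]) auto
    fix x assume x: "x \<in> {0..pi}" and z: "3 * pi / 4 - x / 2 - \<theta> x = 0"
    have "cos (2 * \<theta> x) \<le> 0"
    proof -
      have "\<theta> x = 3 * pi / 4 - x / 2" using z by simp
      then have "2 * \<theta> x - pi = pi / 2 - x" by (simp add: field_simps)
      then have "cos (2 * \<theta> x - pi) = cos (pi / 2 - x)" by (rule arg_cong)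
      moreover have "cos (pi / 2 - x) = sin x" by (simp add: cos_diff)
      ultimately show ?thesis using x sin_ge_zero[of x] by (simp add: cos_diff)
    qed
    then have "1/2 \<le> (sin (\<theta> x))\<^sup>2" by (simp add: cos_double_sin)
    from ub[OF x this] have "0 < - (1/2) - \<theta>' x" by simp
    moreover have "((\<lambda>x. (3 * pi / 4 - x / 2) - \<theta> x) has_real_derivative (- (1/2) - \<theta>' x)) (at x within {0..pi})"
      using d[OF x] by (auto intro!: derivative_eq_intros)
    ultimately show "\<exists>D>0. ((\<lambda>x. (3 * pi / 4 - x / 2) - \<theta> x) has_real_derivative D) (at x within {0..pi})" by blast
  qed (use init in auto)
  then show ?thesis by simp
qed

subsection \<open>Transformation to a planar system\<close>

locale sturm_liouville =
  fixes \<alpha> :: real and q0 :: "real \<Rightarrow> real"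
  assumes q0: "q0 \<in> L2"
begin

definition Q :: "real \<Rightarrow> real" where "Q x = integral {0..x} q0"

text \<open>The affine part of \<open>H\<close> is chosen so that the boundary conditions for the transformed unknowns
  force \<open>v * y\<close> to be positive at \<open>0\<close> and negative at \<open>pi\<close> (unless \<open>v\<close> vanishes there).
  If \<open>sin \<alpha> = 0\<close>, the quotient is \<open>0\<close>.\<close>
definition offset :: real where "offset = - (cos \<alpha> / sin \<alpha>) - 1"
definition slope :: real where "slope = (2 - Q pi) / pi"
definition H :: "real \<Rightarrow> real" where "H x = Q x + (offset + slope * x)"

definition h :: "real \<Rightarrow> real" where "h x = integral {0..x} H"

definition P :: "real \<Rightarrow> real" where "P x = exp (- (2 * h x))"
definition W :: "real \<Rightarrow> real" where "W x = exp (2 * h x)"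
definition S :: "real \<Rightarrow> real" where "S x = exp (4 * h x)"
text \<open>The substitution \<open>u = exp h * v\<close> leaves the term
  \<open>h'' + h'^2 - q0\<close>. Formally \<open>h'' = q0 + slope\<close>, so \<open>q0\<close>
  cancels and the continuous function \<open>slope + H^2\<close> remains.\<close>

definition R :: "real \<Rightarrow> real" where "R x = exp (2 * h x) * (slope + (H x)\<^sup>2)"

text \<open>If \<open>sin \<alpha>\<close> is not 0, these say in terms of \<open>v' = P * y\<close>
  that \<open>v' = v\<close> at 0, where \<open>P = 1\<close> because \<open>h 0 = 0\<close>, and
  \<open>v' = - v\<close> at \<open>pi\<close>.\<close>

definition boundary_conditions :: "(real \<Rightarrow> real) \<Rightarrow> (real \<Rightarrow> real) \<Rightarrow> bool" where
  "boundary_conditions v y \<longleftrightarrow> (if sin \<alpha> = 0 then v 0 = 0 \<and> v pi = 0 else y 0 = v 0 \<and> v pi = - (P pi * y pi))"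

definition start_angle :: real where "start_angle = (if sin \<alpha> = 0 then 0 else pi / 4)"
text \<open>The boundary condition at \<open>pi\<close> fixes the angle modulo \<open>pi\<close>;
  the representative is taken in \<open>(0, pi]\<close>. The Dirichlet case uses \<open>pi\<close>
  and not 0, so that in either case \<open>final_angle n\<close> belongs to \<open>n\<close>
  interior roots.\<close>

definition end_angle :: real where "end_angle = (if sin \<alpha> = 0 then pi else pi - arctan (P pi))"

abbreviation final_angle :: "nat \<Rightarrow> real" where "final_angle n \<equiv> end_angle + real n * pi"

lemma start_angle: "0 \<le> start_angle" "start_angle \<le> pi / 4" "start_angle < pi"
  by (auto simp: start_angle_def)

lemma end_angle: "pi / 2 < end_angle" "end_angle \<le> pi" "0 < end_angle"
  using arctan_ubound[of "P pi"] zero_less_arctan_iff[of "P pi"] pi_gt_zero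
  by (auto simp: end_angle_def P_def less_divide_eq intro: less_trans[of _ "pi / 2"])

lemma q0_integrable: "q0 absolutely_integrable_on {0..pi}" "q0 integrable_on {0..pi}"
  using L2_imp_absolutely_integrable[OF q0] by (auto simp: absolutely_integrable_on_def)

lemma continuous_on_Q: "continuous_on {0..pi} Q"
  unfolding Q_def[abs_def] by (rule indefinite_integral_continuous_1[OF q0_integrable(2)])

lemma continuous_on_H: "continuous_on {0..pi} H"
  unfolding H_def[abs_def] by (intro continuous_intros continuous_on_Q)

lemma h_deriv: "x \<in> {0..pi} \<Longrightarrow> (h has_real_derivative H x) (at x within {0..pi})"
  unfolding h_def[abs_def] by (rule integral_has_real_derivative[OF continuous_on_H])

lemma continuous_on_h: "continuous_on {0..pi} h"
  by (rule DERIV_continuous_on[OF h_deriv])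

lemma cont_coefficients:
  "continuous_on {0..pi} P" "continuous_on {0..pi} W" "continuous_on {0..pi} S" "continuous_on {0..pi} R"
  unfolding P_def[abs_def] W_def[abs_def] S_def[abs_def] R_def[abs_def]
  by (intro continuous_intros continuous_on_h continuous_on_H)+

lemma coefficients_pos: "P x > 0" "W x > 0" "S x > 0"
  by (auto simp: P_def W_def S_def)

lemma boundary_values: "h 0 = 0" "Q 0 = 0" "H 0 = - (cos \<alpha> / sin \<alpha>) - 1" "H pi = 1 - cos \<alpha> / sin \<alpha>"
  by (auto simp: h_def Q_def H_def slope_def offset_def)

text \<open>Since \<open>u' - Q u\<close> is continuously differentiable, \<open>q0\<close> enters the equation only through \<open>Q\<close>.\<close>
lemma quasi_derivative:
  assumes u: "\<And>x. x \<in> {0..pi} \<Longrightarrow> (u has_real_derivative d x) (at x within {0..pi})"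
    and d: "continuous_on {0..pi} d" and g: "continuous_on {0..pi} g"
  shows "(\<forall>x\<in>{0..pi}. d x = d 0 + integral {0..x} (\<lambda>t. q0 t * u t - g t)) \<longleftrightarrow>
    (\<forall>x\<in>{0..pi}. ((\<lambda>x. d x - Q x * u x) has_real_derivative - (g x + Q x * d x)) (at x within {0..pi}))"
proof -
  define G where "G x = integral {0..x} (\<lambda>t. g t + Q t * d t)" for x
  have cu: "continuous_on {0..pi} u" by (rule DERIV_continuous_on[OF u])
  have c: "continuous_on {0..pi} (\<lambda>t. g t + Q t * d t)" "continuous_on {0..pi} (\<lambda>t. Q t * d t)"
    by (intro continuous_intros g d continuous_on_Q)+
  have dG: "(G has_real_derivative g x + Q x * d x) (at x within {0..pi})" if "x \<in> {0..pi}" for x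
    unfolding G_def[abs_def] by (rule integral_has_real_derivative[OF c(1) that])
  have eq: "integral {0..x} (\<lambda>t. q0 t * u t - g t) = Q x * u x - G x" if x: "x \<in> {0..pi}" for x
  proof -
    have sub: "{0..x} \<subseteq> {0..pi}" using x by auto
    have i1: "(\<lambda>t. q0 t * u t) integrable_on {0..x}"
      using absolutely_integrable_mult_continuous[OF q0_integrable(1) cu] sub
      by (auto simp: absolutely_integrable_on_def intro: integrable_on_subinterval)
    have i2: "g integrable_on {0..x}" "(\<lambda>t. Q t * d t) integrable_on {0..x}"
      by (intro integrable_continuous_real continuous_on_subset[OF g sub] continuous_on_subset[OF c(2) sub])+
    have "Q x * u x = integral {0..x} (\<lambda>t. q0 t * u t) + integral {0..x} (\<lambda>t. Q t * d t)"
      using product_indefinite_integral[OF q0_integrable(1) u d x] integral_add[OF i1 i2(2)]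
      by (simp add: Q_def)
    moreover have "G x = integral {0..x} g + integral {0..x} (\<lambda>t. Q t * d t)"
      unfolding G_def by (rule integral_add[OF i2])
    moreover have "integral {0..x} (\<lambda>t. q0 t * u t - g t) = integral {0..x} (\<lambda>t. q0 t * u t) - integral {0..x} g"
      by (rule integral_diff[OF i1 i2(1)])
    ultimately show ?thesis by simp
  qed
  show ?thesis
  proof
    assume L: "\<forall>x\<in>{0..pi}. d x = d 0 + integral {0..x} (\<lambda>t. q0 t * u t - g t)"
    have "d x - Q x * u x = d 0 - G x" if x: "x \<in> {0..pi}" for x
    proof -
      have "d x = d 0 + integral {0..x} (\<lambda>t. q0 t * u t - g t)" using L x by blast
      then show ?thesis using eq[OF x] by linarith
    qed
    note * = this
    show "\<forall>x\<in>{0..pi}. ((\<lambda>x. d x - Q x * u x) has_real_derivative - (g x + Q x * d x)) (at x within {0..pi})"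
    proof
      fix x assume x: "x \<in> {0..pi}"
      have "((\<lambda>x. d 0 - G x) has_real_derivative - (g x + Q x * d x)) (at x within {0..pi})"
        using DERIV_diff[OF DERIV_const dG[OF x]] by simp
      then show "((\<lambda>x. d x - Q x * u x) has_real_derivative - (g x + Q x * d x)) (at x within {0..pi})"
        by (rule has_real_derivative_cong_on[OF x, rotated]) (rule *)
    qed
  next
    assume Rr: "\<forall>x\<in>{0..pi}. ((\<lambda>x. d x - Q x * u x) has_real_derivative - (g x + Q x * d x)) (at x within {0..pi})"
    define k where "k x = d x - Q x * u x + G x" for x
    have "(k has_real_derivative 0) (at x within {0..pi})" if "x \<in> {0..pi}" for x
      unfolding k_def[abs_def] using DERIV_add[OF bspec[OF Rr that] dG[OF that]] by simp
    then obtain C where C: "\<And>x. x \<in> {0..pi} \<Longrightarrow> k x = C"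
      using has_field_derivative_zero_constant[of "{0..pi}" k] by (metis convex_real_interval(5))
    have "d x = d 0 + integral {0..x} (\<lambda>t. q0 t * u t - g t)" if x: "x \<in> {0..pi}" for x
    proof -
      have "k x = k 0" using C x by (metis atLeastAtMost_iff order_refl pi_ge_zero)
      moreover have "k 0 = d 0" by (simp add: k_def G_def boundary_values)
      ultimately show ?thesis using eq[OF x] by (simp add: k_def)
    qed
    then show "\<forall>x\<in>{0..pi}. d x = d 0 + integral {0..x} (\<lambda>t. q0 t * u t - g t)" by blast
  qed
qed

definition potential :: "real \<Rightarrow> real \<Rightarrow> (real \<Rightarrow> real) \<Rightarrow> real \<Rightarrow> real" where
  "potential lam \<delta> v x = R x + lam * W x + \<delta> * S x * (v x)\<^sup>2"

lemma continuous_on_potential: "continuous_on {0..pi} v \<Longrightarrow> continuous_on {0..pi} (potential lam \<delta> v)"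
  unfolding potential_def[abs_def] by (intro continuous_intros cont_coefficients)

lemma SL_operator_imp_planar_system:
  assumes SL: "SL_operator \<alpha> q0 u (\<lambda>x. lam * u x + \<delta> * (u x) ^ 3)"
  obtains v y where "planar_system P (potential lam \<delta> v) v y" "boundary_conditions v y"
    "\<And>x. x \<in> {0..pi} \<Longrightarrow> u x = exp (h x) * v x"
proof -
  define g where "g x = lam * u x + \<delta> * (u x) ^ 3" for x
  obtain d w where W: "W22 u d w" and bc: "u 0 * cos \<alpha> + d 0 * sin \<alpha> = 0" "u pi * cos \<alpha> + d pi * sin \<alpha> = 0"
    and ae: "AE x in lebesgue_on {0<..<pi}. - w x + q0 x * u x = g x"
    using SL unfolding SL_operator_def g_def by blast
  have d: "continuous_on {0..pi} d"
    and u': "\<And>x. x \<in> {0..pi} \<Longrightarrow> (u has_real_derivative d x) (at x within {0..pi})"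
    and dw: "\<And>x. x \<in> {0..pi} \<Longrightarrow> d x = d 0 + integral {0..x} w"
    using W unfolding W22_iff by blast+
  have cu: "continuous_on {0..pi} u" by (rule DERIV_continuous_on[OF u'])
  have cg: "continuous_on {0..pi} g" unfolding g_def[abs_def] by (intro continuous_intros cu)
  have "AE x in lebesgue. x \<in> {0<..<pi} \<longrightarrow> - w x + q0 x * u x = g x"
    using ae by (subst (asm) AE_restrict_space_iff) auto
  then obtain N where N: "N \<in> null_sets lebesgue" "{x. \<not> (x \<in> {0<..<pi} \<longrightarrow> - w x + q0 x * u x = g x)} \<subseteq> N"
    by (auto simp: eventually_ae_filter)
  have neg: "negligible (insert 0 (insert pi N))" using N by (simp add: negligible_iff_null_sets[symmetric])
  have "integral {0..x} w = integral {0..x} (\<lambda>t. q0 t * u t - g t)" if x: "x \<in> {0..pi}" for x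
  proof (rule integral_spike[OF neg])
    fix t assume "t \<in> {0..x} - insert 0 (insert pi N)"
    then have "t \<in> {0<..<pi}" "t \<notin> N" using x by auto
    then have "- w t + q0 t * u t = g t" using N(2) by blast
    then show "q0 t * u t - g t = w t" by simp
  qed
  with dw have "\<forall>x\<in>{0..pi}. d x = d 0 + integral {0..x} (\<lambda>t. q0 t * u t - g t)" by metis
  then have qd: "((\<lambda>x. d x - Q x * u x) has_real_derivative - (g x + Q x * d x)) (at x within {0..pi})"
    if "x \<in> {0..pi}" for x
    using quasi_derivative[OF u' d cg] that by blast
  define v where "v x = exp (- h x) * u x" for x
  \<comment> \<open>This is \<open>exp (2 * h) * v'\<close>, that is
    \<open>exp h * (u' - H * u)\<close>, grouped around \<open>u' - Q * u\<close> because that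
    combination has a classical derivative while \<open>u'\<close> alone need not.\<close>
  define y where "y x = exp (h x) * (d x - Q x * u x - (offset + slope * x) * u x)" for x
  have uv: "u x = exp (h x) * v x" for x by (simp add: v_def exp_minus)
  have yH: "y x = exp (h x) * (d x - H x * u x)" for x by (simp add: y_def H_def algebra_simps)
  have "planar_system P (potential lam \<delta> v) v y"
    unfolding planar_system_def
  proof (intro ballI conjI)
    fix x assume x: "x \<in> {0..pi}"
    show "(v has_real_derivative P x * y x) (at x within {0..pi})"
    proof (rule DERIV_cong)
      show "(v has_real_derivative exp (- h x) * - H x * u x + d x * exp (- h x)) (at x within {0..pi})"
        unfolding v_def[abs_def]
        by (intro DERIV_mult DERIV_chain2[OF DERIV_exp] DERIV_minus h_deriv[OF x] u'[OF x])
      have "P x * y x = (exp (- (2 * h x)) * exp (h x)) * (d x - H x * u x)" by (simp add: P_def yH)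
      also have "exp (- (2 * h x)) * exp (h x) = exp (- h x)" by (simp flip: exp_add)
      finally show "exp (- h x) * - H x * u x + d x * exp (- h x) = P x * y x" by (simp add: algebra_simps)
    qed
    show "(y has_real_derivative - (potential lam \<delta> v x * v x)) (at x within {0..pi})"
    proof (rule DERIV_cong)
      show "(y has_real_derivative exp (h x) * H x * (d x - Q x * u x - (offset + slope * x) * u x) +
          (- (g x + Q x * d x) - (slope * u x + d x * (offset + slope * x))) * exp (h x)) (at x within {0..pi})"
        (is "(_ has_real_derivative ?L) _")
        unfolding y_def[abs_def]
        by (intro DERIV_mult DERIV_diff DERIV_chain2[OF DERIV_exp] h_deriv[OF x] u'[OF x] qd[OF x])
           (auto intro!: derivative_eq_intros)
      have "?L
          = - exp (h x) * ((slope + (H x)\<^sup>2) * u x + g x)"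
        unfolding H_def by (simp add: algebra_simps power2_eq_square)
      also have "\<dots> = - (exp (h x) * exp (h x) * (slope + (H x)\<^sup>2) * v x + lam * (exp (h x) * exp (h x)) * v x
          + \<delta> * (exp (h x) * exp (h x) * exp (h x) * exp (h x)) * v x ^ 3)"
        unfolding g_def uv by (simp add: algebra_simps power3_eq_cube)
      also have "\<dots> = - (potential lam \<delta> v x * v x)"
        unfolding potential_def R_def W_def S_def
        by (simp add: algebra_simps power3_eq_cube power2_eq_square flip: exp_add)
      finally show "?L
          = - (potential lam \<delta> v x * v x)" .
    qed
  qed
  moreover have "boundary_conditions v y"
  proof (cases "sin \<alpha> = 0")
    case True
    then have "cos \<alpha> \<noteq> 0" by (metis sin_zero_abs_cos_one abs_zero zero_neq_one)
    with True bc show ?thesis by (simp add: boundary_conditions_def v_def)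
  next
    case False
    then have "d 0 = - (cos \<alpha> / sin \<alpha>) * u 0" "d pi = - (cos \<alpha> / sin \<alpha>) * u pi"
      using bc by (simp_all add: field_simps)
    then have "y 0 = v 0" and y: "y pi = - (exp (h pi) * u pi)"
      by (simp_all add: yH v_def boundary_values algebra_simps)
    moreover have "P pi * y pi = - ((exp (- (2 * h pi)) * exp (h pi)) * u pi)" by (simp add: P_def y)
    then have "P pi * y pi = - v pi" by (simp add: v_def flip: exp_add)
    ultimately show ?thesis using False by (simp add: boundary_conditions_def)
  qed
  ultimately show ?thesis by (rule that) (rule uv)
qed

lemma planar_system_imp_SL_operator:
  assumes pl: "planar_system P (potential lam \<delta> v) v y" and bc: "boundary_conditions v y"
  shows "SL_operator \<alpha> q0 (\<lambda>x. exp (h x) * v x)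
    (\<lambda>x. lam * (exp (h x) * v x) + \<delta> * (exp (h x) * v x) ^ 3)"
proof -
  define u where "u x = exp (h x) * v x" for x
  define g where "g x = lam * u x + \<delta> * (u x) ^ 3" for x
  define d where "d x = H x * u x + exp (- h x) * y x" for x
  \<comment> \<open>Defining the second derivative by the equation makes the latter hold at every
    point; what remains is that this function is in \<open>L2\<close> and integrates to
    \<open>d\<close>.\<close>
  define w where "w x = q0 x * u x - g x" for x
  note D = planar_systemD[OF pl]
  have cv: "continuous_on {0..pi} v" "continuous_on {0..pi} y" by (rule cont_planar_system[OF pl])+
  have cu: "continuous_on {0..pi} u" unfolding u_def[abs_def] by (intro continuous_intros continuous_on_h cv)
  have cg: "continuous_on {0..pi} g" unfolding g_def[abs_def] by (intro continuous_intros cu)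
  have cd: "continuous_on {0..pi} d"
    unfolding d_def[abs_def] by (intro continuous_intros cu continuous_on_H continuous_on_h cv)
  have u': "(u has_real_derivative d x) (at x within {0..pi})" if x: "x \<in> {0..pi}" for x
  proof (rule DERIV_cong)
    show "(u has_real_derivative exp (h x) * H x * v x + P x * y x * exp (h x)) (at x within {0..pi})"
      unfolding u_def[abs_def] by (intro DERIV_mult DERIV_chain2[OF DERIV_exp] h_deriv[OF x] D(1)[OF x])
    have "P x * exp (h x) = exp (- h x)" by (simp add: P_def flip: exp_add)
    then show "exp (h x) * H x * v x + P x * y x * exp (h x) = d x"
      by (simp add: d_def u_def mult.commute mult.left_commute)
  qed
  have qd: "((\<lambda>x. d x - Q x * u x) has_real_derivative - (g x + Q x * d x)) (at x within {0..pi})"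
    if x: "x \<in> {0..pi}" for x
  proof -
    have eq: "d x - Q x * u x = (offset + slope * x) * u x + exp (- h x) * y x" for x
      by (simp add: d_def H_def algebra_simps)
    have "((\<lambda>x. (offset + slope * x) * u x + exp (- h x) * y x) has_real_derivative
        slope * u x + d x * (offset + slope * x) +
        (exp (- h x) * - H x * y x + - (potential lam \<delta> v x * v x) * exp (- h x))) (at x within {0..pi})"
      by (intro DERIV_add DERIV_mult DERIV_minus DERIV_chain2[OF DERIV_exp] h_deriv[OF x] u'[OF x] D(2)[OF x])
         (auto intro!: derivative_eq_intros)
    moreover have "potential lam \<delta> v x * v x * exp (- h x) = (slope + (H x)\<^sup>2) * u x + g x"
    proof -
      have 2: "exp (2 * h x) * exp (- h x) = exp (h x)" by (simp flip: exp_add)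
      have 4: "exp (4 * h x) * exp (- h x) = exp (h x) * exp (h x) * exp (h x)" by (simp flip: exp_add)
      have "potential lam \<delta> v x * v x * exp (- h x) = (slope + (H x)\<^sup>2 + lam) * v x * (exp (2 * h x) * exp (- h x))
          + \<delta> * v x ^ 3 * (exp (4 * h x) * exp (- h x))"
        unfolding potential_def R_def W_def S_def by (simp add: algebra_simps power3_eq_cube power2_eq_square)
      also have "\<dots> = (slope + (H x)\<^sup>2) * u x + g x"
        unfolding 2 4 g_def u_def by (simp add: algebra_simps power3_eq_cube)
      finally show ?thesis .
    qed
    moreover have "exp (- h x) * y x = d x - H x * u x" by (simp add: d_def)
    then have "exp (- h x) * - H x * y x = - H x * (d x - H x * u x)" by (metis mult.assoc mult.commute)
    moreover have "- (potential lam \<delta> v x * v x) * exp (- h x) = - (potential lam \<delta> v x * v x * exp (- h x))"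
      by simp
    ultimately have "((\<lambda>x. (offset + slope * x) * u x + exp (- h x) * y x) has_real_derivative
        slope * u x + d x * (offset + slope * x) +
        (- H x * (d x - H x * u x) + - ((slope + (H x)\<^sup>2) * u x + g x))) (at x within {0..pi})"
        (is "(_ has_real_derivative ?D) _")
      by (simp only:)
    moreover have "?D = - (g x + Q x * d x)"
      unfolding H_def by (simp add: algebra_simps power2_eq_square)
    ultimately show ?thesis unfolding eq by (simp only:)
  qed
  have "W22 u d w"
    unfolding W22_iff
  proof (intro conjI ballI u' cd)
    show "w \<in> L2"
      unfolding w_def[abs_def] by (intro L2_diff L2_mult_continuous q0 cu continuous_imp_L2 cg)
    show "\<And>x. x \<in> {0..pi} \<Longrightarrow> d x = d 0 + integral {0..x} w"
      using quasi_derivative[OF u' cd cg] qd unfolding w_def[abs_def] by blast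
  qed
  moreover have "u 0 * cos \<alpha> + d 0 * sin \<alpha> = 0 \<and> u pi * cos \<alpha> + d pi * sin \<alpha> = 0"
  proof (cases "sin \<alpha> = 0")
    case True
    then show ?thesis using bc by (simp add: boundary_conditions_def u_def)
  next
    case False
    then have y: "y 0 = v 0" "v pi = - (P pi * y pi)" using bc by (simp_all add: boundary_conditions_def)
    have "exp (h pi) * P pi = exp (- h pi)" by (simp add: P_def flip: exp_add)
    then have "u pi = - (exp (- h pi) * y pi)" by (simp add: u_def y(2) mult.assoc[symmetric])
    then have "d pi = - (cos \<alpha> / sin \<alpha>) * u pi"
      by (simp add: d_def boundary_values algebra_simps)
    moreover have "d 0 = - (cos \<alpha> / sin \<alpha>) * u 0"
      by (simp add: d_def boundary_values y(1) u_def algebra_simps)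
    ultimately show ?thesis using False by simp
  qed
  moreover have "AE x in lebesgue_on {0<..<pi}. - w x + q0 x * u x = lam * u x + \<delta> * (u x) ^ 3"
    by (simp add: w_def g_def)
  ultimately show ?thesis unfolding SL_operator_def u_def[symmetric] by blast
qed

section \<open>Correspondence between boundary value problems and final angles\<close>

text \<open>If \<open>sin \<alpha>\<close> is not 0 and \<open>A = arctan (P pi)\<close>, then
  \<open>sin (t - end_angle)\<close> equals \<open>- cos A * (sin t + P pi * cos t)\<close> with
  \<open>cos A > 0\<close>. Both types of boundary condition thus become one equation modulo
  \<open>pi\<close>.\<close>

lemma end_condition_iff:
  assumes "c \<noteq> 0"
  shows "(if sin \<alpha> = 0 then c * sin t = 0 else c * sin t = - (P pi * (c * cos t))) \<longleftrightarrow> sin (t - end_angle) = 0"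
proof (cases "sin \<alpha> = 0")
  case True
  then show ?thesis using assms by (simp add: end_angle_def sin_diff)
next
  case False
  define A where "A = arctan (P pi)"
  have cA: "cos A > 0" unfolding A_def by (simp add: cos_arctan add_pos_nonneg)
  have "tan A = P pi" by (simp add: A_def tan_arctan)
  then have sA: "sin A = P pi * cos A" using cA by (simp add: tan_def field_simps)
  have "sin (t - end_angle) = - (cos A * (sin t + P pi * cos t))"
    using False by (simp add: end_angle_def A_def[symmetric] sin_diff cos_diff sA)
       (simp add: sin_add sA algebra_simps)
  then have "sin (t - end_angle) = 0 \<longleftrightarrow> sin t + P pi * cos t = 0" using cA by auto
  also have "\<dots> \<longleftrightarrow> sin t = - (P pi * cos t)" by linarith
  also have "\<dots> \<longleftrightarrow> c * sin t = c * - (P pi * cos t)" using assms by (metis mult_left_cancel)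
  also have "\<dots> \<longleftrightarrow> c * sin t = - (P pi * (c * cos t))" by (simp add: mult_ac)
  finally show ?thesis using False by simp
qed

lemma prufer_boundary_conditions:
  assumes "c \<noteq> 0" "\<theta> 0 = start_angle" "\<theta> pi = final_angle n"
  shows "boundary_conditions (\<lambda>x. c * exp (\<rho> x) * sin (\<theta> x)) (\<lambda>x. c * exp (\<rho> x) * cos (\<theta> x))"
proof -
  have "sin (\<theta> pi - end_angle) = 0" using assms(3) by simp
  then have "if sin \<alpha> = 0 then c * exp (\<rho> pi) * sin (\<theta> pi) = 0
      else c * exp (\<rho> pi) * sin (\<theta> pi) = - (P pi * (c * exp (\<rho> pi) * cos (\<theta> pi)))"
    by (subst end_condition_iff) (use assms in auto)
  then show ?thesis
    using assms(2) by (auto simp: boundary_conditions_def start_angle_def sin_45 cos_45)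
qed

text \<open>The index is a natural number because the angle starts at a nonnegative value, hence
  ends at a positive one, while \<open>end_angle <= pi\<close>.\<close>

lemma end_angle_if_end_condition:
  assumes \<theta>: "prufer_angle P q \<theta>" "\<theta> 0 = start_angle" and s: "sin (\<theta> pi - end_angle) = 0"
  obtains n :: nat where "\<theta> pi = final_angle n"
proof -
  obtain j where j: "\<theta> pi - end_angle = real_of_int j * pi" using s by (auto simp: sin_zero_iff_int2)
  have "0 < \<theta> pi"
    using prufer_angle_crosses_up[OF coefficients_pos(1) \<theta>(1), of 0 pi 0] \<theta>(2) start_angle by simp
  then have "- 1 * pi < real_of_int j * pi" using j end_angle by linarith
  then have "- 1 < real_of_int j" by (rule mult_right_less_imp_less) simp
  then have "0 \<le> j" by linarith
  then have "\<theta> pi = end_angle + real (nat j) * pi" using j by simp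
  then show ?thesis by (rule that)
qed

lemma planar_system_imp_prufer:
  assumes q: "continuous_on {0..pi} q" and pl: "planar_system P q v y" and bc: "boundary_conditions v y"
    and nz: "x0 \<in> {0..pi}" "v x0 \<noteq> 0"
  obtains \<theta> \<rho> c n where "c \<noteq> 0" "prufer_angle P q \<theta>" "\<theta> 0 = start_angle" "\<theta> pi = final_angle n"
    "\<And>x. x \<in> {0..pi} \<Longrightarrow> v x = c * exp (\<rho> x) * sin (\<theta> x)"
proof -
  obtain \<theta> \<rho> where *: "\<theta> 0 = start_angle" "\<rho> 0 = 0" "prufer_angle P q \<theta>" "prufer_amplitude P q \<theta> \<rho>"
    by (rule prufer_exists[OF cont_coefficients(1) q, where \<beta>=start_angle])
  \<comment> \<open>The left boundary condition leaves one free constant: \<open>y 0\<close> in the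
    Dirichlet case, otherwise \<open>v 0 = y 0 = c * sin (pi / 4)\<close>, whence the factor
    \<open>sqrt 2\<close>.\<close>
  define c where "c = (if sin \<alpha> = 0 then y 0 else v 0 * sqrt 2)"
  have init: "v 0 = c * exp (\<rho> 0) * sin (\<theta> 0)" "y 0 = c * exp (\<rho> 0) * cos (\<theta> 0)"
    using bc by (auto simp: * c_def boundary_conditions_def start_angle_def sin_45 cos_45 split: if_splits)
  have eq: "v x = c * exp (\<rho> x) * sin (\<theta> x) \<and> y x = c * exp (\<rho> x) * cos (\<theta> x)" if "x \<in> {0..pi}" for x
    by (rule planar_system_unique[OF cont_coefficients(1) q pl planar_system_prufer[OF *(3,4)] init that])
  have c: "c \<noteq> 0" using eq[OF nz(1)] nz(2) by auto
  have "if sin \<alpha> = 0 then c * exp (\<rho> pi) * sin (\<theta> pi) = 0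
      else c * exp (\<rho> pi) * sin (\<theta> pi) = - (P pi * (c * exp (\<rho> pi) * cos (\<theta> pi)))"
    using bc eq[of pi] by (auto simp: boundary_conditions_def)
  then have "sin (\<theta> pi - end_angle) = 0"
    by (subst (asm) end_condition_iff) (use c in auto)
  then obtain n :: nat where "\<theta> pi = final_angle n" by (rule end_angle_if_end_condition[OF *(3,1)])
  with c * eq show ?thesis by (intro that[of c \<theta> n \<rho>]) auto
qed

text \<open>The function \<open>v\<close> is returned along with the angle, so that the nonlinear
  potential can be regarded as a given continuous function and compared with the linear one.\<close>

lemma SL_operator_imp_prufer:
  assumes SL: "SL_operator \<alpha> q0 u (\<lambda>x. lam * u x + \<delta> * (u x) ^ 3)" and nz: "nonzero u"
  obtains v \<theta> n where "continuous_on {0..pi} v" "prufer_angle P (potential lam \<delta> v) \<theta>"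
    "\<theta> 0 = start_angle" "\<theta> pi = final_angle n"
    "\<And>x. x \<in> {0..pi} \<Longrightarrow> v x = 0 \<longleftrightarrow> sin (\<theta> x) = 0"
    "finite (roots u)" "card (roots u) = n"
proof -
  obtain v y where pl: "planar_system P (potential lam \<delta> v) v y" and bc: "boundary_conditions v y"
    and uv: "\<And>x. x \<in> {0..pi} \<Longrightarrow> u x = exp (h x) * v x"
    using SL_operator_imp_planar_system[OF SL] by metis
  have cv: "continuous_on {0..pi} v" by (rule cont_planar_system[OF pl])
  obtain x0 where x0: "x0 \<in> {0..pi}" "v x0 \<noteq> 0" using nz uv unfolding nonzero_def by force
  obtain \<theta> \<rho> c n where *: "c \<noteq> 0" "prufer_angle P (potential lam \<delta> v) \<theta>" "\<theta> 0 = start_angle"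
      "\<theta> pi = final_angle n" "\<And>x. x \<in> {0..pi} \<Longrightarrow> v x = c * exp (\<rho> x) * sin (\<theta> x)"
    by (rule planar_system_imp_prufer[OF continuous_on_potential[OF cv] pl bc x0]) blast
  have z: "v x = 0 \<longleftrightarrow> sin (\<theta> x) = 0" if "x \<in> {0..pi}" for x using *(1) *(5)[OF that] by auto
  have r: "roots u = {x \<in> {0<..<pi}. sin (\<theta> x) = 0}"
    unfolding roots_def using uv z by (auto simp: less_imp_le)
  have "finite (roots u) \<and> card (roots u) = n"
    unfolding r by (rule prufer_angle_root_count[OF coefficients_pos(1) *(2) _ _ *(4) end_angle(3,2)])
      (simp_all add: *(3) start_angle)
  with cv * z show ?thesis by (intro that[of v \<theta> n]) auto
qed

lemma prufer_imp_SL_operator: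
  assumes \<theta>: "prufer_angle P (potential lam \<delta> (\<lambda>x. c * exp (\<rho> x) * sin (\<theta> x))) \<theta>"
    and \<rho>: "prufer_amplitude P (potential lam \<delta> (\<lambda>x. c * exp (\<rho> x) * sin (\<theta> x))) \<theta> \<rho>"
    and c: "c \<noteq> 0" and ends: "\<theta> 0 = start_angle" "\<theta> pi = final_angle n"
  obtains u where "SL_operator \<alpha> q0 u (\<lambda>x. lam * u x + \<delta> * (u x) ^ 3)" "nonzero u"
    "finite (roots u)" "card (roots u) = n"
proof (rule that[of "\<lambda>x. exp (h x) * (c * exp (\<rho> x) * sin (\<theta> x))"])
  let ?u = "\<lambda>x. exp (h x) * (c * exp (\<rho> x) * sin (\<theta> x))"
  show "SL_operator \<alpha> q0 ?u (\<lambda>x. lam * ?u x + \<delta> * (?u x) ^ 3)"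
    by (rule planar_system_imp_SL_operator[OF planar_system_prufer[OF \<theta> \<rho>] prufer_boundary_conditions[OF c ends]])
  have r: "roots ?u = {x \<in> {0<..<pi}. sin (\<theta> x) = 0}"
    unfolding roots_def using c by auto
  have f: "finite (roots ?u) \<and> card (roots ?u) = n"
    unfolding r by (rule prufer_angle_root_count[OF coefficients_pos(1) \<theta> _ _ ends(2) end_angle(3,2)])
      (simp_all add: ends(1) start_angle)
  then show "finite (roots ?u)" "card (roots ?u) = n" by auto
  show "nonzero ?u"
  proof (rule ccontr)
    assume "\<not> nonzero ?u"
    then have "{0<..<pi} \<subseteq> roots ?u" by (auto simp: nonzero_def roots_def)
    then have "finite {0<..<pi}" using f finite_subset by blast
    then show False using infinite_Ioo[of 0 pi] by simp
  qed
qed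

section \<open>Rotation for large positive and large negative potentials\<close>

lemma coefficient_bounds:
  obtains pm PB \<sigma> SB w0 CH where "pm > 0" "PB > 0" "\<sigma> > 0" "SB > 0" "w0 > 0" "CH > 0"
    "\<And>x. x \<in> {0..pi} \<Longrightarrow> pm \<le> P x \<and> P x \<le> PB \<and> \<sigma> \<le> S x \<and> S x \<le> SB \<and> w0 \<le> W x \<and> \<bar>H x\<bar> \<le> CH"
proof -
  obtain PB where 1: "PB > 0" "\<And>x. x \<in> {0..pi} \<Longrightarrow> \<bar>P x\<bar> \<le> PB"
    using continuous_on_Icc_bounded[OF cont_coefficients(1)] by metis
  obtain SB where 2: "SB > 0" "\<And>x. x \<in> {0..pi} \<Longrightarrow> \<bar>S x\<bar> \<le> SB"
    using continuous_on_Icc_bounded[OF cont_coefficients(3)] by metis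
  obtain CH where 3: "CH > 0" "\<And>x. x \<in> {0..pi} \<Longrightarrow> \<bar>H x\<bar> \<le> CH"
    using continuous_on_Icc_bounded[OF continuous_on_H] by metis
  obtain pm where 4: "pm > 0" "\<And>x. x \<in> {0..pi} \<Longrightarrow> pm \<le> P x"
    using continuous_on_Icc_pos_lower_bound[OF cont_coefficients(1) coefficients_pos(1)] by metis
  obtain w0 where 5: "w0 > 0" "\<And>x. x \<in> {0..pi} \<Longrightarrow> w0 \<le> W x"
    using continuous_on_Icc_pos_lower_bound[OF cont_coefficients(2) coefficients_pos(2)] by metis
  obtain \<sigma> where 6: "\<sigma> > 0" "\<And>x. x \<in> {0..pi} \<Longrightarrow> \<sigma> \<le> S x"
    using continuous_on_Icc_pos_lower_bound[OF cont_coefficients(3) coefficients_pos(3)] by metis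
  show ?thesis
  proof (rule that[of pm PB \<sigma> SB w0 CH])
    fix x assume x: "x \<in> {0..pi}"
    show "pm \<le> P x \<and> P x \<le> PB \<and> \<sigma> \<le> S x \<and> S x \<le> SB \<and> w0 \<le> W x \<and> \<bar>H x\<bar> \<le> CH"
      using 1(2)[OF x] 2(2)[OF x] 3(2)[OF x] 4(2)[OF x] 5(2)[OF x] 6(2)[OF x] by auto
  qed (use 1 2 3 4 5 6 in auto)
qed

text \<open>A potential of size \<open>m0\<close> times the squared sine is weak where the sine is
  small, but there \<open>P\<close> alone turns the angle. The bound involves the angle because the
  truncated potential has this form once the cap is attained.\<close>

lemma rotation_large:
  fixes n :: nat
  obtains m0 where "m0 > 0" "\<And>q \<theta>. prufer_angle P q \<theta> \<Longrightarrow> 0 \<le> \<theta> 0 \<Longrightarrow>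
    (\<And>x. x \<in> {0..pi} \<Longrightarrow> - C + m0 * (sin (\<theta> x))\<^sup>2 \<le> q x) \<Longrightarrow> (real n + 1) * pi < \<theta> pi"
proof -
  obtain pm where pm: "pm > 0" "\<And>x. x \<in> {0..pi} \<Longrightarrow> pm \<le> P x"
    using coefficient_bounds by metis
  \<comment> \<open>\<open>K * (pm / 2) = n + 3\<close>: one \<open>pi\<close> is lost in the
    rotation bound, and the other surplus makes the conclusion strict.\<close>
  define K where "K = 2 * (real n + 3) / pm"
  have K: "K > 0" "K * (pm / 2) = real n + 3" using pm by (auto simp: K_def add_pos_nonneg)
  define C' where "C' = max 0 C"
  \<comment> \<open>With \<open>t\<close> the squared sine, the required inequality reduces to
    \<open>pm / 2 - G * t + m0 * t^2 >= 0\<close>; the choice \<open>m0 = G^2 / (2 * pm)\<close>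
    makes the left side a multiple of a square.\<close>
  define G where "G = C' + pm * K\<^sup>2 / 2 + pm / 2"
  have G: "G > 0" using pm by (auto simp: G_def C'_def add_nonneg_pos)
  define m0 where "m0 = G\<^sup>2 / (2 * pm)"
  show ?thesis
  proof (rule that)
    show "m0 > 0" using G pm by (simp add: m0_def)
    fix q \<theta> assume \<theta>: "prufer_angle P q \<theta>" "0 \<le> \<theta> 0"
      and lb: "\<And>x. x \<in> {0..pi} \<Longrightarrow> - C + m0 * (sin (\<theta> x))\<^sup>2 \<le> q x"
    have "\<theta> 0 - pi + K * (pm / 2) * pi \<le> \<theta> pi"
    proof (rule rotation_lower_bound[OF prufer_angleD[OF \<theta>(1)] _ K(1)])
      fix x assume x: "x \<in> {0..pi}"
      define t where "t = (sin (\<theta> x))\<^sup>2"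
      have c: "(cos (\<theta> x))\<^sup>2 = 1 - t" by (simp add: t_def cos_squared_eq)
      have t: "0 \<le> t" "t \<le> 1" using c by (auto simp: t_def) (metis zero_le_power2 diff_ge_0_iff_ge)
      have "pm * (1 - t) \<le> P x * (1 - t)" using pm(2)[OF x] t by (intro mult_right_mono) auto
      moreover have "(- C' + m0 * t) * t \<le> q x * t"
        using lb[OF x] t by (intro mult_right_mono) (auto simp: t_def C'_def max_def)
      moreover have "0 \<le> pm / 2 * (1 - G * t / pm)\<^sup>2" using pm by simp
      moreover have "P x * (1 - t) + q x * t - pm / 2 * ((1 - t) + K\<^sup>2 * t) =
          (P x * (1 - t) - pm * (1 - t)) + (q x * t - (- C' + m0 * t) * t) + pm / 2 * (1 - G * t / pm)\<^sup>2"
        using pm by (simp add: m0_def G_def power2_eq_square field_simps)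
      ultimately show "pm / 2 * ((cos (\<theta> x))\<^sup>2 + K\<^sup>2 * (sin (\<theta> x))\<^sup>2) \<le>
          P x * (cos (\<theta> x))\<^sup>2 + q x * (sin (\<theta> x))\<^sup>2"
        unfolding c t_def[symmetric] by linarith
    qed
    then have "(real n + 3) * pi - pi \<le> \<theta> pi" using \<theta>(2) unfolding K(2) by linarith
    moreover have "(real n + 3) * pi - pi = (real n + 1) * pi + pi" by (simp add: algebra_simps)
    ultimately show "(real n + 1) * pi < \<theta> pi" using pi_gt_zero by linarith
  qed
qed

lemma rotation_small:
  obtains m0 where "m0 > 0" "\<And>q \<theta>. prufer_angle P q \<theta> \<Longrightarrow> \<theta> 0 \<le> pi / 4 \<Longrightarrow>
    (\<And>x. x \<in> {0..pi} \<Longrightarrow> q x \<le> C - m0 * (sin (\<theta> x))\<^sup>2) \<Longrightarrow> \<theta> pi < pi / 4"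
proof -
  obtain PB where PB: "PB > 0" "\<And>x. x \<in> {0..pi} \<Longrightarrow> P x \<le> PB"
    using coefficient_bounds by metis
  define C' where "C' = max 0 C"
  \<comment> \<open>Where the squared sine \<open>t\<close> is at least 1/2,
    \<open>m0 * t^2 >= m0 / 4 = PB + C' + 1\<close>, which outweighs the contributions of
    \<open>P\<close> and \<open>C'\<close> by 1.\<close>
  define m0 where "m0 = 4 * (PB + C' + 1)"
  show ?thesis
  proof (rule that)
    show m0: "m0 > 0" using PB by (simp add: m0_def C'_def)
    fix q \<theta> assume \<theta>: "prufer_angle P q \<theta>" "\<theta> 0 \<le> pi / 4"
      and ub: "\<And>x. x \<in> {0..pi} \<Longrightarrow> q x \<le> C - m0 * (sin (\<theta> x))\<^sup>2"
    show "\<theta> pi < pi / 4"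
    proof (rule rotation_upper_bound[OF prufer_angleD[OF \<theta>(1)]])
      fix x assume x: "x \<in> {0..pi}" and s: "1/2 \<le> (sin (\<theta> x))\<^sup>2"
      define t where "t = (sin (\<theta> x))\<^sup>2"
      have c: "(cos (\<theta> x))\<^sup>2 = 1 - t" by (simp add: t_def cos_squared_eq)
      have t: "1/2 \<le> t" "t \<le> 1" using c s by (auto simp: t_def) (metis zero_le_power2 diff_ge_0_iff_ge)
      have "P x * (1 - t) \<le> PB * 1" using PB x t by (intro mult_mono) auto
      moreover have "q x * t \<le> (C' - m0 * t) * t"
        using ub[OF x] t by (intro mult_right_mono) (auto simp: t_def C'_def max_def)
      moreover have "C' * t \<le> C' * 1" using t by (intro mult_left_mono) (auto simp: C'_def)
      moreover have "m0 * (1/2 * (1/2)) \<le> m0 * (t * t)" using t m0 by (intro mult_left_mono mult_mono) auto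
      moreover have "(C' - m0 * t) * t = C' * t - m0 * (t * t)" by (simp add: algebra_simps)
      moreover have "m0 * (1/2 * (1/2)) = PB + C' + 1" by (simp add: m0_def)
      ultimately show "P x * (cos (\<theta> x))\<^sup>2 + q x * (sin (\<theta> x))\<^sup>2 \<le> - 1"
        unfolding c t_def[symmetric] by linarith
    next
      show "\<theta> 0 \<le> 3 * pi / 4" using order_trans[OF \<theta>(2), of "3 * pi / 4"] by simp
    qed
  qed
qed

subsection \<open>The linear problem\<close>

definition lin_potential :: "real \<Rightarrow> real \<Rightarrow> real" where
  "lin_potential lam x = R x + lam * W x"

text \<open>The final angle of the linear problem as a function of the spectral parameter. It is
  well defined because comparing two angles with equal potentials in both directions shows that they
  end equally.\<close>

definition rotation :: "real \<Rightarrow> real" where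
  "rotation lam = (THE t. \<exists>\<theta>. prufer_angle P (lin_potential lam) \<theta> \<and> \<theta> 0 = start_angle \<and> t = \<theta> pi)"

lemma cont_lin_potential: "continuous_on {0..pi} (lin_potential lam)"
  unfolding lin_potential_def[abs_def] by (intro continuous_intros cont_coefficients)

lemma rotation_eq:
  assumes "prufer_angle P (lin_potential lam) \<theta>" "\<theta> 0 = start_angle"
  shows "rotation lam = \<theta> pi"
  unfolding rotation_def
proof (rule the_equality)
  show "\<exists>\<theta>'. prufer_angle P (lin_potential lam) \<theta>' \<and> \<theta>' 0 = start_angle \<and> \<theta> pi = \<theta>' pi"
    using assms by blast
  fix t assume "\<exists>\<theta>'. prufer_angle P (lin_potential lam) \<theta>' \<and> \<theta>' 0 = start_angle \<and> t = \<theta>' pi"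
  then obtain \<theta>' where *: "prufer_angle P (lin_potential lam) \<theta>'" "\<theta>' 0 = start_angle" "t = \<theta>' pi" by blast
  have le: "\<theta>1 pi \<le> \<theta>2 pi" if "prufer_angle P (lin_potential lam) \<theta>1" "\<theta>1 0 = start_angle"
      "prufer_angle P (lin_potential lam) \<theta>2" "\<theta>2 0 = start_angle" for \<theta>1 \<theta>2
  proof (rule prufer_angle_mono[OF cont_coefficients(1) coefficients_pos(1)
      cont_lin_potential that(1) that(3)])
    show "\<theta>1 0 = \<theta>2 0" unfolding that(2,4) ..
  qed auto
  show "t = \<theta> pi"
    unfolding *(3) by (rule antisym[OF le[OF *(1,2) assms] le[OF assms *(1,2)]])
qed

lemma rotation_exists:
  obtains \<theta> where "prufer_angle P (lin_potential lam) \<theta>" "\<theta> 0 = start_angle" "rotation lam = \<theta> pi"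
proof -
  obtain \<theta> \<rho> where "\<theta> 0 = start_angle" "prufer_angle P (lin_potential lam) \<theta>"
    by (rule prufer_exists[OF cont_coefficients(1) cont_lin_potential, where \<beta>=start_angle])
  then show ?thesis by (intro that[of \<theta>] rotation_eq)
qed

lemma rotation_strict_mono:
  assumes "lam < \<mu>"
  shows "rotation lam < rotation \<mu>"
proof -
  obtain \<theta>1 where 1: "prufer_angle P (lin_potential lam) \<theta>1" "\<theta>1 0 = start_angle" "rotation lam = \<theta>1 pi"
    by (rule rotation_exists)
  obtain \<theta>2 where 2: "prufer_angle P (lin_potential \<mu>) \<theta>2" "\<theta>2 0 = start_angle" "rotation \<mu> = \<theta>2 pi"
    by (rule rotation_exists)
  have "lin_potential lam x < lin_potential \<mu> x" for x
    using assms coefficients_pos(2)[of x] by (simp add: lin_potential_def)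
  then show ?thesis
    unfolding 1(3) 2(3) using 1 2
    by (intro prufer_angle_strict_mono[OF cont_coefficients(1) coefficients_pos(1)
          cont_lin_potential 1(1) 2(1)]) (auto intro: less_imp_le simp: less_imp_neq)
qed

lemma rotation_less_iff: "rotation lam < rotation \<mu> \<longleftrightarrow> lam < \<mu>"
  using rotation_strict_mono by (metis less_asym linorder_neqE_linordered_idom less_irrefl)

lemma continuous_on_rotation: "continuous_on {A..B} rotation"
proof (cases "A \<le> B")
  case True
  obtain CR where CR: "\<And>x. x \<in> {0..pi} \<Longrightarrow> \<bar>R x\<bar> \<le> CR"
    using continuous_on_Icc_bounded[OF cont_coefficients(4)] by metis
  obtain CW where CW: "CW > 0" "\<And>x. x \<in> {0..pi} \<Longrightarrow> \<bar>W x\<bar> \<le> CW"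
    using continuous_on_Icc_bounded[OF cont_coefficients(2)] by metis
  have bl: "bdd_lipschitz {A..B} (\<lambda>p x (z :: real \<times> real). lin_potential p x)"
  proof (rule bdd_lipschitz_const)
    fix p x assume p: "p \<in> {A..B}" and x: "x \<in> {0..pi}"
    have "\<bar>lin_potential p x\<bar> \<le> \<bar>R x\<bar> + \<bar>p\<bar> * \<bar>W x\<bar>"
      unfolding lin_potential_def abs_mult[symmetric] by (rule abs_triangle_ineq)
    also have "\<dots> \<le> CR + (\<bar>A\<bar> + \<bar>B\<bar>) * CW"
      using CR[OF x] CW(2)[OF x] p by (intro add_mono mult_mono) auto
    finally show "\<bar>lin_potential p x\<bar> \<le> CR + (\<bar>A\<bar> + \<bar>B\<bar>) * CW" .
  qed
  have cR: "continuous_on ({A..B} \<times> {0..pi} \<times> (UNIV :: (real \<times> real) set)) (\<lambda>w. R (fst (snd w)))"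
    by (rule continuous_on_compose2[OF cont_coefficients(4)]) (auto intro!: continuous_intros)
  have cW: "continuous_on ({A..B} \<times> {0..pi} \<times> (UNIV :: (real \<times> real) set)) (\<lambda>w. W (fst (snd w)))"
    by (rule continuous_on_compose2[OF cont_coefficients(2)]) (auto intro!: continuous_intros)
  have c: "continuous_on ({A..B} \<times> {0..pi} \<times> (UNIV :: (real \<times> real) set)) (\<lambda>(p, x, z). lin_potential p x)"
    unfolding split_beta lin_potential_def by (intro continuous_intros cR cW)
  show ?thesis
  proof (rule prufer_family[OF True cont_coefficients(1) c bl, where \<beta>=start_angle])
    fix \<theta> \<rho> :: "real \<Rightarrow> real \<Rightarrow> real"
    assume *: "\<And>p. p \<in> {A..B} \<Longrightarrow> \<theta> p 0 = start_angle \<and> \<rho> p 0 = 0 \<and>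
      prufer_angle P (lin_potential p) (\<theta> p) \<and> prufer_amplitude P (lin_potential p) (\<theta> p) (\<rho> p)"
      and cont: "continuous_on {A..B} (\<lambda>p. \<theta> p pi)"
    have "rotation p = \<theta> p pi" if "p \<in> {A..B}" for p using rotation_eq *[OF that] by blast
    then show ?thesis using cont by (metis (no_types, lifting) continuous_on_cong)
  qed
qed auto

text \<open>A large multiple of \<open>W >= w0 > 0\<close> dominates any constant and hence any
  multiple of the squared sine. So the two rotation estimates place \<open>rotation\<close> on both
  sides of \<open>final_angle n\<close>.\<close>

lemma rotation_surj:
  fixes n :: nat
  shows "\<exists>lam. rotation lam = final_angle n"
proof -
  obtain CR where CR: "\<And>x. x \<in> {0..pi} \<Longrightarrow> \<bar>R x\<bar> \<le> CR"
    using continuous_on_Icc_bounded[OF cont_coefficients(4)] by metis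
  obtain w0 where w0: "w0 > 0" "\<And>x. x \<in> {0..pi} \<Longrightarrow> w0 \<le> W x" using coefficient_bounds by metis
  obtain m1 where m1: "m1 > 0" "\<And>q \<theta>. prufer_angle P q \<theta> \<Longrightarrow> 0 \<le> \<theta> 0 \<Longrightarrow>
    (\<And>x. x \<in> {0..pi} \<Longrightarrow> - CR + m1 * (sin (\<theta> x))\<^sup>2 \<le> q x) \<Longrightarrow> (real n + 1) * pi < \<theta> pi"
    by (rule rotation_large) blast
  obtain m2 where m2: "m2 > 0" "\<And>q \<theta>. prufer_angle P q \<theta> \<Longrightarrow> \<theta> 0 \<le> pi / 4 \<Longrightarrow>
    (\<And>x. x \<in> {0..pi} \<Longrightarrow> q x \<le> CR - m2 * (sin (\<theta> x))\<^sup>2) \<Longrightarrow> \<theta> pi < pi / 4"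
    by (rule rotation_small) blast
  have W: "m * (sin t)\<^sup>2 \<le> m / w0 * W x" if "x \<in> {0..pi}" "m > 0" for x t m
  proof -
    have "(sin t)\<^sup>2 \<le> 1" by (simp add: abs_square_le_1)
    then have "m * (sin t)\<^sup>2 \<le> m * 1" using that by (intro mult_left_mono) auto
    also have "\<dots> = m / w0 * w0" using w0 by simp
    also have "\<dots> \<le> m / w0 * W x" using that w0 by (intro mult_left_mono) auto
    finally show ?thesis .
  qed
  have "(real n + 1) * pi < rotation (m1 / w0)"
  proof -
    obtain \<theta> where \<theta>: "prufer_angle P (lin_potential (m1 / w0)) \<theta>" "\<theta> 0 = start_angle"
      "rotation (m1 / w0) = \<theta> pi" by (rule rotation_exists)
    have "- CR + m1 * (sin (\<theta> x))\<^sup>2 \<le> lin_potential (m1 / w0) x" if "x \<in> {0..pi}" for x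
      using W[OF that m1(1), of "\<theta> x"] CR[OF that] unfolding lin_potential_def by linarith
    then show ?thesis unfolding \<theta>(3) using m1(2)[OF \<theta>(1)] \<theta>(2) start_angle by auto
  qed
  moreover have "rotation (- m2 / w0) < pi / 4"
  proof -
    obtain \<theta> where \<theta>: "prufer_angle P (lin_potential (- m2 / w0)) \<theta>" "\<theta> 0 = start_angle"
      "rotation (- m2 / w0) = \<theta> pi" by (rule rotation_exists)
    have "lin_potential (- m2 / w0) x \<le> CR - m2 * (sin (\<theta> x))\<^sup>2" if "x \<in> {0..pi}" for x
      using W[OF that m2(1), of "\<theta> x"] CR[OF that] unfolding lin_potential_def by simp
    then show ?thesis unfolding \<theta>(3) using m2(2)[OF \<theta>(1)] \<theta>(2) start_angle by auto
  qed
  moreover have "final_angle n \<le> (real n + 1) * pi" "pi / 4 \<le> final_angle n"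
    using end_angle pi_gt_zero by (auto simp: algebra_simps intro!: add_increasing2)
  moreover have "- m2 / w0 \<le> m1 / w0" using m1(1) m2(1) w0(1) by (intro divide_right_mono) auto
  ultimately show ?thesis
    using IVT'[of rotation "- m2 / w0" "final_angle n" "m1 / w0"] continuous_on_rotation by auto
qed

lemma eigenvalue_iff: "\<mu> \<in> SL_eigenvalues \<alpha> q0 \<longleftrightarrow> (\<exists>n. rotation \<mu> = final_angle n)"
proof
  assume "\<mu> \<in> SL_eigenvalues \<alpha> q0"
  then obtain u where u: "nonzero u" "SL_operator \<alpha> q0 u (\<lambda>x. \<mu> * u x + 0 * (u x) ^ 3)"
    by (auto simp: SL_eigenvalues_def)
  have pot: "potential \<mu> 0 v = lin_potential \<mu>" for v
    by (auto simp: potential_def lin_potential_def)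
  obtain v \<theta> n where "prufer_angle P (potential \<mu> 0 v) \<theta>" "\<theta> 0 = start_angle" "\<theta> pi = final_angle n"
    by (rule SL_operator_imp_prufer[OF u(2,1)])
  then show "\<exists>n. rotation \<mu> = final_angle n" unfolding pot using rotation_eq by metis
next
  assume "\<exists>n. rotation \<mu> = final_angle n"
  then obtain n where n: "rotation \<mu> = final_angle n" ..
  obtain \<theta> \<rho> where *: "\<theta> 0 = start_angle" "prufer_angle P (lin_potential \<mu>) \<theta>"
      "prufer_amplitude P (lin_potential \<mu>) \<theta> \<rho>"
    by (rule prufer_exists[OF cont_coefficients(1) cont_lin_potential, where \<beta>=start_angle])
  have pot: "potential \<mu> 0 v = lin_potential \<mu>" for v
    by (auto simp: potential_def lin_potential_def)
  have "\<theta> pi = final_angle n" using rotation_eq[OF *(2,1)] n by simp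
  then obtain u where "SL_operator \<alpha> q0 u (\<lambda>x. \<mu> * u x + 0 * (u x) ^ 3)" "nonzero u"
    using prufer_imp_SL_operator[of \<mu> 0 1 \<rho> \<theta> n] * unfolding pot by auto
  then show "\<mu> \<in> SL_eigenvalues \<alpha> q0" by (auto simp: SL_eigenvalues_def)
qed

text \<open>Strict monotonicity of \<open>rotation\<close> makes \<open>ev\<close> an increasing
  enumeration of the spectrum, so exactly \<open>n\<close> eigenvalues lie below
  \<open>ev n\<close>. Roots are counted from 0 and eigenvalues from 1, whence
  \<open>Suc n\<close>.\<close>

lemma SL_eigenvalue_rotation:
  obtains \<mu> where "SL_eigenvalue \<alpha> q0 (Suc n) = ereal \<mu>" "rotation \<mu> = final_angle n"
proof -
  obtain ev where ev: "\<And>n :: nat. rotation (ev n) = final_angle n" using rotation_surj by metis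
  have less: "ev m < ev n \<longleftrightarrow> m < n" for m n
    using rotation_less_iff[of "ev m" "ev n"] by (simp add: ev)
  have inj: "ev m = ev n \<longleftrightarrow> m = n" for m n
    using less[of m n] less[of n m] by (metis less_irrefl linorder_neqE_nat)
  have evs: "SL_eigenvalues \<alpha> q0 = range ev"
  proof (rule set_eqI)
    fix \<mu>
    show "\<mu> \<in> SL_eigenvalues \<alpha> q0 \<longleftrightarrow> \<mu> \<in> range ev"
      unfolding eigenvalue_iff using ev rotation_less_iff by (metis linorder_neqE_linordered_idom less_irrefl rangeE rangeI)
  qed
  have below: "{\<nu> \<in> SL_eigenvalues \<alpha> q0. \<nu> < ev n} = ev ` {..<n}" for n
    unfolding evs using less by auto
  have card: "finite (ev ` {..<n})" "card (ev ` {..<n}) = n" for n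
    using inj by (auto simp: card_image inj_on_def)
  have "(THE \<mu>. \<mu> \<in> SL_eigenvalues \<alpha> q0 \<and> finite {\<nu> \<in> SL_eigenvalues \<alpha> q0. \<nu> < \<mu>} \<and>
      card {\<nu> \<in> SL_eigenvalues \<alpha> q0. \<nu> < \<mu>} = Suc n - 1) = ev n"
  proof (rule the_equality)
    show "ev n \<in> SL_eigenvalues \<alpha> q0 \<and> finite {\<nu> \<in> SL_eigenvalues \<alpha> q0. \<nu> < ev n} \<and>
      card {\<nu> \<in> SL_eigenvalues \<alpha> q0. \<nu> < ev n} = Suc n - 1"
      unfolding below using card by (simp add: evs)
    fix \<mu> assume *: "\<mu> \<in> SL_eigenvalues \<alpha> q0 \<and> finite {\<nu> \<in> SL_eigenvalues \<alpha> q0. \<nu> < \<mu>} \<and>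
      card {\<nu> \<in> SL_eigenvalues \<alpha> q0. \<nu> < \<mu>} = Suc n - 1"
    then obtain m where m: "\<mu> = ev m" using evs by auto
    have "m = n" using * unfolding m below card by simp
    then show "\<mu> = ev n" using m by simp
  qed
  then show ?thesis using ev[of n] by (intro that[of "ev n"]) (simp_all add: SL_eigenvalue_def)
qed

subsection \<open>The nonlinear problem\<close>

text \<open>The square \<open>v\<^sup>2\<close> in the nonlinear term is replaced by \<open>min r M * (sin \<theta>)\<^sup>2\<close>, where
  \<open>r = s\<^sup>2 * exp (2 * \<rho>) = v\<^sup>2 + y\<^sup>2\<close>; the amplitude \<open>s = 0\<close> gives the linear problem.\<close>
definition trunc_potential ::
    "real \<Rightarrow> real \<Rightarrow> real \<Rightarrow> real \<Rightarrow> (real \<Rightarrow> real) \<Rightarrow> (real \<Rightarrow> real) \<Rightarrow> real \<Rightarrow> real" where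
  "trunc_potential \<delta> lam M s \<theta> \<rho> x =
     lin_potential lam x + \<delta> * (S x * (min (s\<^sup>2 * exp (2 * \<rho> x)) M * (sin (\<theta> x))\<^sup>2))"

definition trunc_flow ::
    "real \<Rightarrow> real \<Rightarrow> real \<Rightarrow> real \<Rightarrow> (real \<Rightarrow> real) \<Rightarrow> (real \<Rightarrow> real) \<Rightarrow> bool" where
  "trunc_flow \<delta> lam M s \<theta> \<rho> \<longleftrightarrow> \<theta> 0 = start_angle \<and> \<rho> 0 = 0 \<and>
     prufer_angle P (trunc_potential \<delta> lam M s \<theta> \<rho>) \<theta> \<and>
     prufer_amplitude P (trunc_potential \<delta> lam M s \<theta> \<rho>) \<theta> \<rho>"

definition trunc_solution ::
    "real \<Rightarrow> real \<Rightarrow> real \<Rightarrow> nat \<Rightarrow> real \<Rightarrow> (real \<Rightarrow> real) \<Rightarrow> (real \<Rightarrow> real) \<Rightarrow> bool" where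
  "trunc_solution \<delta> lam M n s \<theta> \<rho> \<longleftrightarrow>
     s > 0 \<and> \<theta> pi = final_angle n \<and> trunc_flow \<delta> lam M s \<theta> \<rho>"

lemma trunc_family:
  assumes M: "M > 0"
  obtains \<theta> \<rho> where "\<And>s. s \<in> {0..s1} \<Longrightarrow> trunc_flow \<delta> lam M s (\<theta> s) (\<rho> s)"
    "continuous_on {0..s1} (\<lambda>s. \<theta> s pi)"
proof (cases "0 \<le> s1")
  case True
  define q where "q s x z = lin_potential lam x +
      \<delta> * (S x * (min (s\<^sup>2 * exp (2 * snd z)) M * (sin (fst z) * sin (fst z))))" for s x and z :: "real \<times> real"
  obtain C0 where C0: "\<And>x. x \<in> {0..pi} \<Longrightarrow> \<bar>lin_potential lam x\<bar> \<le> C0"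
    using continuous_on_Icc_bounded[OF cont_lin_potential] by metis
  obtain CS where CS: "\<And>x. x \<in> {0..pi} \<Longrightarrow> \<bar>S x\<bar> \<le> CS"
    using continuous_on_Icc_bounded[OF cont_coefficients(3)] by metis
  have "bdd_lipschitz {0..s1} q"
    unfolding q_def[abs_def]
    by (intro bdd_lipschitz_add bdd_lipschitz_mult bdd_lipschitz_sin_fst
        bdd_lipschitz_trunc_exp[OF M] bdd_lipschitz_const[OF C0] bdd_lipschitz_const[OF CS]
        bdd_lipschitz_const[of _ "\<lambda>p x. \<delta>" "\<bar>\<delta>\<bar>"]) auto
  moreover have "continuous_on ({0..s1} \<times> {0..pi} \<times> (UNIV :: (real \<times> real) set)) (\<lambda>w. lin_potential lam (fst (snd w)))"
    by (rule continuous_on_compose2[OF cont_lin_potential]) (auto intro!: continuous_intros)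
  moreover have "continuous_on ({0..s1} \<times> {0..pi} \<times> (UNIV :: (real \<times> real) set)) (\<lambda>w. S (fst (snd w)))"
    by (rule continuous_on_compose2[OF cont_coefficients(3)]) (auto intro!: continuous_intros)
  ultimately have "bdd_lipschitz {0..s1} q"
    and "continuous_on ({0..s1} \<times> {0..pi} \<times> UNIV) (\<lambda>(s, x, z). q s x z)"
    unfolding split_beta q_def by (auto intro!: continuous_intros)
  note this(2,1)
  note fam = prufer_family[OF True cont_coefficients(1) this, where \<beta>=start_angle]
  have q: "(\<lambda>x. q s x (\<theta> x, \<rho> x)) = trunc_potential \<delta> lam M s \<theta> \<rho>" for s \<theta> \<rho>
    by (simp add: fun_eq_iff q_def trunc_potential_def power2_eq_square)
  show ?thesis
  proof (rule fam)
    fix \<theta> \<rho>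
    assume *: "\<And>s. s \<in> {0..s1} \<Longrightarrow> \<theta> s 0 = start_angle \<and> \<rho> s 0 = 0 \<and>
        prufer_angle P (\<lambda>x. q s x (\<theta> s x, \<rho> s x)) (\<theta> s) \<and>
        prufer_amplitude P (\<lambda>x. q s x (\<theta> s x, \<rho> s x)) (\<theta> s) (\<rho> s)"
      and "continuous_on {0..s1} (\<lambda>s. \<theta> s pi)"
    then show thesis unfolding q trunc_flow_def[symmetric] by (rule that)
  qed
next
  case False
  show ?thesis by (rule that[of "\<lambda>_ _. 0" "\<lambda>_ _. 0"]) (use False in auto)
qed

lemma trunc_solution_exists:
  assumes \<delta>: "\<delta> = 1 \<and> rotation lam < final_angle n \<or> \<delta> = - 1 \<and> final_angle n < rotation lam"
  obtains M0 where "M0 > 0" "\<And>M. M \<ge> M0 \<Longrightarrow> \<exists>s \<theta> \<rho>. trunc_solution \<delta> lam M n s \<theta> \<rho>"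
proof -
  obtain C0 where C0: "C0 > 0" "\<And>x. x \<in> {0..pi} \<Longrightarrow> \<bar>lin_potential lam x\<bar> \<le> C0"
    using continuous_on_Icc_bounded[OF cont_lin_potential] by metis
  obtain PB \<sigma> SB where b: "PB > 0" "\<sigma> > 0" "SB > 0"
      "\<And>x. x \<in> {0..pi} \<Longrightarrow> P x \<le> PB \<and> \<sigma> \<le> S x \<and> S x \<le> SB"
    using coefficient_bounds by metis
  obtain m1 where m1: "m1 > 0" "\<And>q \<theta>. prufer_angle P q \<theta> \<Longrightarrow> 0 \<le> \<theta> 0 \<Longrightarrow>
    (\<And>x. x \<in> {0..pi} \<Longrightarrow> - C0 + m1 * (sin (\<theta> x))\<^sup>2 \<le> q x) \<Longrightarrow> (real n + 1) * pi < \<theta> pi"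
    by (rule rotation_large) blast
  obtain m2 where m2: "m2 > 0" "\<And>q \<theta>. prufer_angle P q \<theta> \<Longrightarrow> \<theta> 0 \<le> pi / 4 \<Longrightarrow>
    (\<And>x. x \<in> {0..pi} \<Longrightarrow> q x \<le> C0 - m2 * (sin (\<theta> x))\<^sup>2) \<Longrightarrow> \<theta> pi < pi / 4"
    by (rule rotation_small) blast
  \<comment> \<open>For \<open>M >= M0\<close> one has
    \<open>S * M >= \<sigma> * M >= max m1 m2\<close>, so the potential with attained cap meets the
    premises of both rotation estimates.\<close>
  define M0 where "M0 = max m1 m2 / \<sigma>"
  show ?thesis
  proof (rule that)
    show M0: "M0 > 0" using m1(1) b(2) by (simp add: M0_def less_max_iff_disj)
    fix M assume M: "M \<ge> M0"
    have "M > 0" using M M0 by linarith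
    have "max m1 m2 = M0 * \<sigma>" using b by (simp add: M0_def)
    also have "\<dots> \<le> M * \<sigma>" using M b by (intro mult_right_mono) auto
    finally have Mm: "m1 \<le> \<sigma> * M" "m2 \<le> \<sigma> * M" by (simp_all add: mult.commute)
    \<comment> \<open>\<open>CM\<close> bounds the derivative of \<open>\<rho>\<close> in modulus,
      for every amplitude thanks to the truncation. Starting from \<open>s1\<close>, the radius
      cannot fall below \<open>sqrt M\<close> before \<open>pi\<close>, so the cap is attained
      throughout.\<close>
    define CM where "CM = PB + C0 + SB * M"
    define s1 where "s1 = sqrt M * exp (CM * pi)"
    have s1: "s1 > 0" using \<open>M > 0\<close> by (simp add: s1_def)
    obtain \<theta> \<rho> where fam: "\<And>s. s \<in> {0..s1} \<Longrightarrow> trunc_flow \<delta> lam M s (\<theta> s) (\<rho> s)"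
      and cont: "continuous_on {0..s1} (\<lambda>s. \<theta> s pi)"
      by (rule trunc_family[OF \<open>M > 0\<close>]) blast
    have zero: "\<theta> 0 pi = rotation lam"
    proof (rule rotation_eq[symmetric])
      have "trunc_potential \<delta> lam M 0 (\<theta> 0) (\<rho> 0) = lin_potential lam"
        using \<open>M > 0\<close> by (simp add: fun_eq_iff trunc_potential_def)
      then show "prufer_angle P (lin_potential lam) (\<theta> 0)" "\<theta> 0 0 = start_angle"
        using fam[of 0] s1 by (auto simp: trunc_flow_def)
    qed
    let ?q1 = "trunc_potential \<delta> lam M s1 (\<theta> s1) (\<rho> s1)" and ?\<theta>1 = "\<theta> s1"
    let ?r = "\<lambda>x. s1\<^sup>2 * exp (2 * \<rho> s1 x)"
    have f1: "?\<theta>1 0 = start_angle" "\<rho> s1 0 = 0"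
      "prufer_angle P ?q1 ?\<theta>1" "prufer_amplitude P ?q1 ?\<theta>1 (\<rho> s1)"
      using fam[of s1] s1 by (auto simp: trunc_flow_def)
    have trunc: "min (?r x) M = M" if x: "x \<in> {0..pi}" for x
    proof -
      have "- \<rho> s1 x - - \<rho> s1 0 \<le> CM * (x - 0)"
      proof (rule derivative_le_imp_le[where a=0 and b=pi and f="\<lambda>x. - \<rho> s1 x"])
        fix t assume t: "t \<in> {0..pi}"
        show "((\<lambda>x. - \<rho> s1 x) has_real_derivative - (sin (?\<theta>1 t) * cos (?\<theta>1 t) * (P t - ?q1 t))) (at t within {0..pi})"
          by (intro DERIV_minus prufer_amplitudeD[OF f1(4) t])
        have m: "0 \<le> min (?r t) M" using \<open>M > 0\<close> by simp
        have "\<bar>S t * (min (?r t) M * (sin (?\<theta>1 t))\<^sup>2)\<bar> \<le> SB * (M * 1)"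
          unfolding abs_mult using b(3) b(4)[OF t] coefficients_pos(3)[of t] m
          by (intro mult_mono) (auto simp: abs_square_le_1)
        moreover have "\<bar>\<delta>\<bar> = 1" using \<delta> by auto
        ultimately have "\<bar>\<delta> * (S t * (min (?r t) M * (sin (?\<theta>1 t))\<^sup>2))\<bar> \<le> SB * M"
          unfolding abs_mult[of \<delta>] by simp
        then have "\<bar>P t - ?q1 t\<bar> \<le> CM"
          unfolding trunc_potential_def CM_def
          using b(4)[OF t] C0(2)[OF t] coefficients_pos(1)[of t] by linarith
        moreover have "\<bar>sin (?\<theta>1 t) * cos (?\<theta>1 t)\<bar> \<le> 1 * 1"
          unfolding abs_mult by (intro mult_mono) auto
        ultimately have "\<bar>sin (?\<theta>1 t) * cos (?\<theta>1 t)\<bar> * \<bar>P t - ?q1 t\<bar> \<le> 1 * CM"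
          by (intro mult_mono) auto
        then show "- (sin (?\<theta>1 t) * cos (?\<theta>1 t) * (P t - ?q1 t)) \<le> CM"
          unfolding abs_mult[symmetric] by linarith
      qed (use x in auto)
      moreover have "CM * x \<le> CM * pi" using x b C0(1) \<open>M > 0\<close> by (intro mult_left_mono) (auto simp: CM_def)
      ultimately have "2 * (- CM * pi) \<le> 2 * \<rho> s1 x" using f1(2) by simp
      then have "s1\<^sup>2 * exp (2 * (- CM * pi)) \<le> s1\<^sup>2 * exp (2 * \<rho> s1 x)" by (intro mult_left_mono) auto
      moreover have "s1\<^sup>2 * exp (2 * (- CM * pi)) = M"
      proof -
        have "exp (CM * pi) ^ 2 = exp (2 * (CM * pi))" by (simp flip: exp_of_nat_mult)
        then have "s1\<^sup>2 = M * exp (2 * (CM * pi))" using \<open>M > 0\<close> by (simp add: s1_def power_mult_distrib)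
        then show ?thesis by (simp add: mult.assoc flip: exp_add)
      qed
      ultimately show ?thesis by simp
    qed
    have pot1: "?q1 x = lin_potential lam x + \<delta> * (S x * M * (sin (?\<theta>1 x))\<^sup>2)"
      if "x \<in> {0..pi}" for x
      using trunc[OF that] by (simp add: trunc_potential_def)
    have SM: "\<sigma> * M * (sin (?\<theta>1 x))\<^sup>2 \<le> S x * M * (sin (?\<theta>1 x))\<^sup>2" if "x \<in> {0..pi}" for x
      using b(4)[OF that] \<open>M > 0\<close> by (intro mult_right_mono) auto
    have ends: "final_angle n \<le> (real n + 1) * pi" "pi / 4 \<le> final_angle n"
      using end_angle pi_gt_zero by (auto simp: algebra_simps intro!: add_increasing2)
    have "\<exists>s. 0 \<le> s \<and> s \<le> s1 \<and> \<theta> s pi = final_angle n"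
    proof (cases "\<delta> = 1")
      case True
      have "(real n + 1) * pi < \<theta> s1 pi"
      proof (rule m1(2)[OF f1(3)])
        fix x assume x: "x \<in> {0..pi}"
        have "m1 * (sin (?\<theta>1 x))\<^sup>2 \<le> \<sigma> * M * (sin (?\<theta>1 x))\<^sup>2" using Mm by (intro mult_right_mono) auto
        then show "- C0 + m1 * (sin (?\<theta>1 x))\<^sup>2 \<le> ?q1 x"
          unfolding pot1[OF x] using SM[OF x] C0(2)[OF x] True by simp
      qed (use f1 start_angle in auto)
      then show ?thesis using \<delta> True zero s1 ends cont by (intro IVT') auto
    next
      case False
      then have "\<delta> = - 1" using \<delta> by auto
      have "\<theta> s1 pi < pi / 4"
      proof (rule m2(2)[OF f1(3)])
        fix x assume x: "x \<in> {0..pi}"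
        have "m2 * (sin (?\<theta>1 x))\<^sup>2 \<le> \<sigma> * M * (sin (?\<theta>1 x))\<^sup>2" using Mm by (intro mult_right_mono) auto
        then show "?q1 x \<le> C0 - m2 * (sin (?\<theta>1 x))\<^sup>2"
          unfolding pot1[OF x] using SM[OF x] C0(2)[OF x] \<open>\<delta> = - 1\<close> by simp
      qed (use f1 start_angle in auto)
      then show ?thesis using \<delta> False zero s1 ends cont by (intro IVT2') auto
    qed
    then obtain s where s: "0 \<le> s" "s \<le> s1" "\<theta> s pi = final_angle n" by blast
    \<comment> \<open>The assumed strict inequality excludes \<open>s = 0\<close>, where the final
      angle is \<open>rotation lam\<close>; hence the solution obtained is not the zero
      solution.\<close>
    have "s \<noteq> 0" using zero s(3) \<delta> by (metis less_irrefl)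
    then have "trunc_solution \<delta> lam M n s (\<theta> s) (\<rho> s)"
      using fam[of s] s by (simp add: trunc_solution_def)
    then show "\<exists>s \<theta> \<rho>. trunc_solution \<delta> lam M n s \<theta> \<rho>" by blast
  qed
qed

lemma trunc_solution_planar:
  fixes s :: real and \<theta> \<rho> :: "real \<Rightarrow> real"
  defines "v \<equiv> \<lambda>x. s * exp (\<rho> x) * sin (\<theta> x)" and "y \<equiv> \<lambda>x. s * exp (\<rho> x) * cos (\<theta> x)"
  assumes "trunc_solution \<delta> lam M n s \<theta> \<rho>"
  shows "planar_system P (trunc_potential \<delta> lam M s \<theta> \<rho>) v y" "boundary_conditions v y"
    "s\<^sup>2 * exp (2 * \<rho> x) = (v x)\<^sup>2 + (y x)\<^sup>2" "s\<^sup>2 * exp (2 * \<rho> x) * (sin (\<theta> x))\<^sup>2 = (v x)\<^sup>2"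
proof -
  show "planar_system P (trunc_potential \<delta> lam M s \<theta> \<rho>) v y" "boundary_conditions v y"
    using assms(3) unfolding v_def y_def trunc_solution_def trunc_flow_def
    by (auto intro!: planar_system_prufer prufer_boundary_conditions)
  have e: "(exp (\<rho> x))\<^sup>2 = exp (2 * \<rho> x)" by (simp flip: exp_of_nat_mult)
  show "s\<^sup>2 * exp (2 * \<rho> x) = (v x)\<^sup>2 + (y x)\<^sup>2"
    by (simp add: v_def y_def power_mult_distrib e flip: distrib_left)
  show "s\<^sup>2 * exp (2 * \<rho> x) * (sin (\<theta> x))\<^sup>2 = (v x)\<^sup>2"
    by (simp add: v_def power_mult_distrib e)
qed

lemma trunc_solution_imp_solution:
  assumes ts: "trunc_solution \<delta> lam M n s \<theta> \<rho>"
    and le: "\<And>x. x \<in> {0..pi} \<Longrightarrow> s\<^sup>2 * exp (2 * \<rho> x) \<le> M"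
  obtains u where "SL_operator \<alpha> q0 u (\<lambda>x. lam * u x + \<delta> * (u x) ^ 3)" "nonzero u"
    "finite (roots u)" "card (roots u) = n"
proof -
  have eq: "trunc_potential \<delta> lam M s \<theta> \<rho> x = potential lam \<delta> (\<lambda>x. s * exp (\<rho> x) * sin (\<theta> x)) x"
    if "x \<in> {0..pi}" for x
  proof -
    have "(exp (\<rho> x))\<^sup>2 = exp (2 * \<rho> x)" by (simp flip: exp_of_nat_mult)
    then show ?thesis
      using le[OF that]
      by (simp add: trunc_potential_def potential_def lin_potential_def power_mult_distrib min_absorb1)
  qed
  have "prufer_angle P (potential lam \<delta> (\<lambda>x. s * exp (\<rho> x) * sin (\<theta> x))) \<theta>"
    "prufer_amplitude P (potential lam \<delta> (\<lambda>x. s * exp (\<rho> x) * sin (\<theta> x))) \<theta> \<rho>"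
    using ts eq unfolding trunc_solution_def trunc_flow_def prufer_angle_def prufer_amplitude_def by metis+
  then show ?thesis
    by (rule prufer_imp_SL_operator) (use ts that in \<open>auto simp: trunc_solution_def trunc_flow_def\<close>)
qed

section \<open>A priori bounds independent of the truncation\<close>

lemma prufer_angle_sin_nonzero:
  assumes "prufer_angle P q \<theta>" "\<theta> 0 = start_angle" "\<theta> pi = final_angle n"
  obtains x where "x \<in> {0<..<pi}" "sin (\<theta> x) \<noteq> 0"
proof -
  have "finite {x \<in> {0<..<pi}. sin (\<theta> x) = 0}"
    using prufer_angle_root_count[OF coefficients_pos(1) assms(1) _ _ assms(3) end_angle(3,2)] assms(2) start_angle
    by simp
  moreover have "infinite {0<..<pi}" using infinite_Ioo[of 0 pi] by simp
  ultimately obtain x where "x \<in> {0<..<pi} - {x \<in> {0<..<pi}. sin (\<theta> x) = 0}"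
    by (metis Diff_infinite_finite finite.emptyI ex_in_conv)
  then show ?thesis by (intro that[of x]) auto
qed

text \<open>Maximum principle: at a maximum of \<open>v\<^sup>2\<close>, which cannot be an end point, \<open>y = 0\<close> and the
  potential is nonnegative.\<close>
lemma square_maximum:
  assumes q: "continuous_on {0..pi} q" and pl: "planar_system P q v y" and bc: "boundary_conditions v y"
    and x0: "x0 \<in> {0..pi}" "v x0 \<noteq> 0" and mx: "\<And>x. x \<in> {0..pi} \<Longrightarrow> (v x)\<^sup>2 \<le> (v x0)\<^sup>2"
  shows "y x0 = 0" "0 \<le> q x0"
proof -
  note D = planar_systemD[OF pl]
  have d2: "((\<lambda>x. (v x)\<^sup>2) has_real_derivative 2 * P x * (v x * y x)) (at x within {0..pi})" if "x \<in> {0..pi}" for x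
    using D(1)[OF that] by (auto intro!: derivative_eq_intros)
  \<comment> \<open>At 0 the product \<open>v * y\<close> equals \<open>v^2 > 0\<close>, so
    \<open>v^2\<close> increases away from the end point; at \<open>pi\<close> the sign is
    reversed.\<close>
  have "x0 \<noteq> 0"
  proof
    assume "x0 = 0"
    then have "sin \<alpha> \<noteq> 0" "y 0 = v 0" "v 0 \<noteq> 0" using bc x0 by (auto simp: boundary_conditions_def split: if_splits)
    then have "0 < 2 * P 0 * (v 0 * y 0)"
      using coefficients_pos(1)[of 0] by (simp add: zero_less_mult_iff)  (metis linorder_neqE_linordered_idom)
    from has_real_derivative_pos_inc_right[OF d2[of 0] this] obtain e where
      e: "e > 0" "\<And>h. h > 0 \<Longrightarrow> 0 + h \<in> {0..pi} \<Longrightarrow> h < e \<Longrightarrow> (v 0)\<^sup>2 < (v (0 + h))\<^sup>2" by auto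
    define k where "k = min (e / 2) pi"
    have "k > 0" "k < e" "k \<in> {0..pi}" using e(1) by (auto simp: k_def min_def)
    then show False using e(2)[of k] mx[of k] \<open>x0 = 0\<close> by auto
  qed
  moreover have "x0 \<noteq> pi"
  proof
    assume "x0 = pi"
    then have *: "sin \<alpha> \<noteq> 0" "v pi = - (P pi * y pi)" "v pi \<noteq> 0"
      using bc x0 by (auto simp: boundary_conditions_def split: if_splits)
    have "2 * P pi * (v pi * y pi) = - (2 * (v pi)\<^sup>2)"
    proof -
      have "v pi * v pi = v pi * - (P pi * y pi)" by (rule arg_cong[OF *(2)])
      then show ?thesis by (simp add: power2_eq_square)
    qed
    also have "\<dots> < 0" using *(3) by simp
    finally have "2 * P pi * (v pi * y pi) < 0" .
    from has_real_derivative_neg_dec_left[OF d2[of pi] this] obtain e where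
      e: "e > 0" "\<And>h. h > 0 \<Longrightarrow> pi - h \<in> {0..pi} \<Longrightarrow> h < e \<Longrightarrow> (v pi)\<^sup>2 < (v (pi - h))\<^sup>2" by auto
    define k where "k = min (e / 2) pi"
    have "k > 0" "k < e" "pi - k \<in> {0..pi}" using e(1) by (auto simp: k_def min_def)
    then show False using e(2)[of k] mx[of "pi - k"] \<open>x0 = pi\<close> by auto
  qed
  ultimately have x0': "x0 \<in> {0<..<pi}" using x0 by auto
  have "2 * P x0 * (v x0 * y x0) = 0"
  proof (rule DERIV_local_max)
    have "at x0 within {0..pi} = at x0" using x0' by (intro at_within_interior) auto
    then show "((\<lambda>x. (v x)\<^sup>2) has_real_derivative 2 * P x0 * (v x0 * y x0)) (at x0)" using d2[OF x0(1)] by simp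
    show "0 < min x0 (pi - x0)" using x0' by auto
    show "\<forall>t. \<bar>x0 - t\<bar> < min x0 (pi - x0) \<longrightarrow> (v t)\<^sup>2 \<le> (v x0)\<^sup>2"
      by (intro allI impI mx) auto
  qed
  then show y0: "y x0 = 0" using x0(2) coefficients_pos(1)[of x0] by simp
  \<comment> \<open>A second-order test without second derivatives of \<open>v\<close>: if
    \<open>q x0 < 0\<close>, then \<open>v * y\<close> vanishes at \<open>x0\<close> with derivative
    \<open>- q * v^2 > 0\<close>, so \<open>v^2\<close> increases just to the right of
    \<open>x0\<close>.\<close>
  show "0 \<le> q x0"
  proof (rule ccontr)
    assume neg: "\<not> 0 \<le> q x0"
    have "((\<lambda>x. v x * y x) has_real_derivative P x0 * y x0 * y x0 + - (q x0 * v x0) * v x0) (at x0 within {0..pi})"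
      by (intro DERIV_mult D x0)
    moreover have "0 < P x0 * y x0 * y x0 + - (q x0 * v x0) * v x0"
    proof -
      have "0 < - q x0 * (v x0)\<^sup>2" using neg x0(2) by (intro mult_pos_pos) auto
      then show ?thesis by (simp add: y0 power2_eq_square)
    qed
    ultimately obtain e where e: "e > 0"
      "\<And>h. h > 0 \<Longrightarrow> x0 + h \<in> {0..pi} \<Longrightarrow> h < e \<Longrightarrow> v x0 * y x0 < v (x0 + h) * y (x0 + h)"
      by (rule has_real_derivative_pos_inc_right[THEN exE]) auto
    define k where "k = min (e / 2) (pi - x0)"
    have k: "k > 0" "k < e" "x0 + k \<in> {0..pi}" using e(1) x0' by (auto simp: k_def min_def)
    have "\<exists>t\<in>{x0<..<x0 + k}. (v (x0 + k))\<^sup>2 - (v x0)\<^sup>2 = 2 * P t * (v t * y t) * (x0 + k - x0)"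
    proof (rule mvt_simple[where f'="\<lambda>t h. 2 * P t * (v t * y t) * h"])
      fix t assume "x0 \<le> t" "t \<le> x0 + k"
      then show "((\<lambda>x. (v x)\<^sup>2) has_derivative (\<lambda>h. 2 * P t * (v t * y t) * h)) (at t within {x0..x0 + k})"
        using DERIV_subset[OF d2[of t], of "{x0..x0 + k}"] x0' k(3) by (auto simp: has_field_derivative_def)
    qed (use k in auto)
    then obtain t where t: "t \<in> {x0<..<x0 + k}" "(v (x0 + k))\<^sup>2 - (v x0)\<^sup>2 = 2 * P t * (v t * y t) * k" by auto
    have "0 < v t * y t" using e(2)[of "t - x0"] t(1) k x0' y0 by auto
    then have "0 < 2 * P t * (v t * y t) * k" using coefficients_pos(1)[of t] k(1) by simp
    then show False using t(2) mx[OF k(3)] by linarith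
  qed
qed

text \<open>At the maximum of \<open>v^2\<close> one has \<open>y = 0\<close>, so the squared radius
  is \<open>v^2\<close> and the squared sine is 1; a nonnegative potential there says
  \<open>S * min (v^2) M <= C0\<close>. This bounds \<open>v\<close>, hence
  \<open>y' = - q * v\<close>, and \<open>y\<close> is controlled from the point where it
  vanishes.\<close>

lemma trunc_solution_bound_defocusing:
  obtains M1 where "\<And>M s \<theta> \<rho> x. M1 \<le> M \<Longrightarrow> trunc_solution (- 1) lam M n s \<theta> \<rho> \<Longrightarrow> x \<in> {0..pi} \<Longrightarrow>
    s\<^sup>2 * exp (2 * \<rho> x) \<le> M"
proof -
  obtain C0 where C0: "C0 > 0" "\<And>x. x \<in> {0..pi} \<Longrightarrow> \<bar>lin_potential lam x\<bar> \<le> C0"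
    using continuous_on_Icc_bounded[OF cont_lin_potential] by metis
  obtain \<sigma> SB where b: "\<sigma> > 0" "SB > 0" "\<And>x. x \<in> {0..pi} \<Longrightarrow> \<sigma> \<le> S x \<and> S x \<le> SB"
    using coefficient_bounds by metis
  define V where "V = C0 / \<sigma>"
  define Y where "Y = (C0 + SB * V) * (1 + V)"
  have V: "V > 0" and Y: "Y \<ge> 0" using C0(1) b by (simp_all add: V_def Y_def)
  \<comment> \<open>Since \<open>V < M1 <= M\<close>, the bound \<open>min (v^2) M <= V\<close>
    passes to \<open>v^2\<close> itself.\<close>
  define M1 where "M1 = V + (Y * pi)\<^sup>2 + 1"
  have M1: "V < M1" using zero_le_power2[of "Y * pi"] unfolding M1_def by linarith
  show ?thesis
  proof (rule that)
    fix M s \<theta> \<rho> x assume M: "M1 \<le> M" and ts: "trunc_solution (- 1) lam M n s \<theta> \<rho>" and x: "x \<in> {0..pi}"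
    define v where "v = (\<lambda>x. s * exp (\<rho> x) * sin (\<theta> x))"
    define y where "y = (\<lambda>x. s * exp (\<rho> x) * cos (\<theta> x))"
    define q where "q = trunc_potential (- 1) lam M s \<theta> \<rho>"
    define r where "r x = s\<^sup>2 * exp (2 * \<rho> x)" for x
    have pl: "planar_system P q v y" and bc: "boundary_conditions v y"
      and r: "\<And>x. r x = (v x)\<^sup>2 + (y x)\<^sup>2" "\<And>x. r x * (sin (\<theta> x))\<^sup>2 = (v x)\<^sup>2"
      using trunc_solution_planar[OF ts] unfolding v_def y_def q_def r_def by auto
    have cv: "continuous_on {0..pi} v" by (rule cont_planar_system[OF pl])
    have ang: "prufer_angle P q \<theta>" "prufer_amplitude P q \<theta> \<rho>" "\<theta> 0 = start_angle" "\<theta> pi = final_angle n"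
      and s: "s > 0"
      using ts by (auto simp: trunc_solution_def trunc_flow_def q_def)
    have cq: "continuous_on {0..pi} q"
      unfolding q_def trunc_potential_def[abs_def]
      by (intro continuous_intros cont_lin_potential cont_coefficients
          cont_prufer_angle[OF ang(1)] cont_prufer_amplitude[OF ang(2)])
    have "continuous_on {0..pi} (\<lambda>x. (v x)\<^sup>2)" by (intro continuous_intros cv)
    then obtain x0 where x0: "x0 \<in> {0..pi}" and mx: "\<And>x. x \<in> {0..pi} \<Longrightarrow> (v x)\<^sup>2 \<le> (v x0)\<^sup>2"
      using continuous_attains_sup[of "{0..pi}" "\<lambda>x. (v x)\<^sup>2"] by force
    obtain z where z: "z \<in> {0<..<pi}" "sin (\<theta> z) \<noteq> 0" by (rule prufer_angle_sin_nonzero[OF ang(1,3,4)])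
    have "0 < (v z)\<^sup>2" using z(2) s by (simp add: v_def)
    also have "(v z)\<^sup>2 \<le> (v x0)\<^sup>2" using z(1) by (intro mx) auto
    finally have vx0: "v x0 \<noteq> 0" by auto
    note sm = square_maximum[OF cq pl bc x0 vx0 mx]
    have "r x0 = (v x0)\<^sup>2" using r(1)[of x0] sm(1) by simp
    then have "(sin (\<theta> x0))\<^sup>2 = 1" using r(2)[of x0] vx0 by simp
    then have "q x0 = lin_potential lam x0 - S x0 * min ((v x0)\<^sup>2) M"
      using \<open>r x0 = (v x0)\<^sup>2\<close> by (simp add: q_def trunc_potential_def r_def)
    then have "S x0 * min ((v x0)\<^sup>2) M \<le> C0" using sm(2) C0(2)[OF x0] by linarith
    moreover have "\<sigma> * min ((v x0)\<^sup>2) M \<le> S x0 * min ((v x0)\<^sup>2) M"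
      using b(3)[OF x0] M M1 V by (intro mult_right_mono) auto
    ultimately have "min ((v x0)\<^sup>2) M \<le> V" using b(1) by (simp add: V_def field_simps)
    then have "(v x0)\<^sup>2 \<le> V" using M M1 by (auto simp: min_def split: if_splits)
    then have vV: "(v t)\<^sup>2 \<le> V" if "t \<in> {0..pi}" for t using mx[OF that] by linarith
    have yb: "\<bar>- (q t * v t)\<bar> \<le> Y" if t: "t \<in> {0..pi}" for t
    proof -
      have "min (r t) M * (sin (\<theta> t))\<^sup>2 \<le> r t * (sin (\<theta> t))\<^sup>2" by (intro mult_right_mono) auto
      also have "\<dots> \<le> V" using vV[OF t] r(2) by simp
      finally have *: "min (r t) M * (sin (\<theta> t))\<^sup>2 \<le> V" .
      have "0 \<le> min (r t) M" using M M1 V by (auto simp: r_def)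
      then have "0 \<le> min (r t) M * (sin (\<theta> t))\<^sup>2" by simp
      with * have "S t * (min (r t) M * (sin (\<theta> t))\<^sup>2) \<le> SB * V" "0 \<le> S t * (min (r t) M * (sin (\<theta> t))\<^sup>2)"
        using b(2) b(3)[OF t] coefficients_pos(3)[of t] by (auto intro!: mult_mono)
      then have "\<bar>q t\<bar> \<le> C0 + SB * V"
        using C0(2)[OF t] unfolding q_def trunc_potential_def r_def by linarith
      moreover have "\<bar>v t\<bar> \<le> 1 + V"
      proof -
        have "0 \<le> (\<bar>v t\<bar> - 1/2)\<^sup>2" by simp
        then have "\<bar>v t\<bar> \<le> (v t)\<^sup>2 + 1/4" by (simp add: power2_eq_square algebra_simps)
        then show ?thesis using vV[OF t] by linarith
      qed
      ultimately have "\<bar>q t\<bar> * \<bar>v t\<bar> \<le> Y" unfolding Y_def using C0(1) b V by (intro mult_mono) auto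
      then show ?thesis by (simp add: abs_mult)
    qed
    have "\<bar>y x\<bar> \<le> Y * pi"
    proof -
      have up: "y t - y u \<le> Y * (t - u)" if "0 \<le> u" "u \<le> t" "t \<le> pi" for t u
        by (rule derivative_le_imp_le[OF planar_systemD(2)[OF pl] _ that]) (use yb in \<open>auto simp: abs_le_iff\<close>)
      have dn: "- y t - - y u \<le> Y * (t - u)" if "0 \<le> u" "u \<le> t" "t \<le> pi" for t u
        by (rule derivative_le_imp_le[OF DERIV_minus[OF planar_systemD(2)[OF pl]] _ that])
           (use yb in \<open>auto simp: abs_le_iff\<close>)
      have "\<bar>y x\<bar> \<le> Y * \<bar>x - x0\<bar>"
        using up[of x0 x] dn[of x0 x] up[of x x0] dn[of x x0] x x0 sm(1) by (cases "x0 \<le> x") auto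
      also have "\<dots> \<le> Y * pi" using x x0 Y by (intro mult_left_mono) auto
      finally show ?thesis .
    qed
    then have "(y x)\<^sup>2 \<le> (Y * pi)\<^sup>2" by (metis abs_ge_zero power2_abs power_mono)
    then show "s\<^sup>2 * exp (2 * \<rho> x) \<le> M"
      using r(1)[of x] vV[OF x] M unfolding r_def M1_def by linarith
  qed
qed

text \<open>The Hamiltonian of the focusing system without its linear potential.\<close>

definition energy :: "(real \<Rightarrow> real) \<Rightarrow> (real \<Rightarrow> real) \<Rightarrow> real \<Rightarrow> real" where
  "energy v y x = P x * (y x)\<^sup>2 / 2 + S x * (v x) ^ 4 / 4"

text \<open>The cubic terms cancel. What remains comes from the logarithmic derivatives
  \<open>- 2 * H\<close> of \<open>P\<close> and \<open>4 * H\<close> of \<open>S\<close> and from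
  the linear potential; it grows at most linearly in the energy, with \<open>k\<close> and
  \<open>e\<close> independent of the solution.\<close>

lemma energy_derivative:
  obtains k e D where "k \<ge> 0" "e \<ge> 0" "\<And>v y q x. x \<in> {0..pi} \<Longrightarrow> planar_system P q v y \<Longrightarrow>
      q x = lin_potential lam x + S x * (v x)\<^sup>2 \<Longrightarrow>
      (energy v y has_real_derivative D v y x) (at x within {0..pi}) \<and> \<bar>D v y x\<bar> \<le> k * energy v y x + e"
proof -
  obtain C0 where C0: "C0 > 0" "\<And>x. x \<in> {0..pi} \<Longrightarrow> \<bar>lin_potential lam x\<bar> \<le> C0"
    using continuous_on_Icc_bounded[OF cont_lin_potential] by metis
  obtain PB \<sigma> CH where b: "PB > 0" "\<sigma> > 0" "CH > 0"
      "\<And>x. x \<in> {0..pi} \<Longrightarrow> P x \<le> PB \<and> \<sigma> \<le> S x \<and> \<bar>H x\<bar> \<le> CH"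
    using coefficient_bounds by metis
  \<comment> \<open>\<open>4 * CH\<close> accounts for the logarithmic derivatives; the rest comes
    from \<open>\<bar>v * y\<bar> <= (v^2 + y^2) / 2\<close> and \<open>v^2 <= 1 + v^4\<close>,
    whose constant 1 is the source of \<open>e\<close>.\<close>
  define k where "k = 4 * CH + C0 + 2 * C0 * (PB / \<sigma>)"
  define e where "e = C0 * PB / 2"
  define D' where "D' v y x = H x * (S x * (v x) ^ 4 - P x * (y x)\<^sup>2) - lin_potential lam x * (P x * (v x * y x))"
    for v y x
  show ?thesis
  proof (rule that[of k e D'])
    show "k \<ge> 0" "e \<ge> 0" using C0(1) b by (simp_all add: k_def e_def)
    fix v y q x
    assume xI: "x \<in> {0..pi}" and pl: "planar_system P q v y" and q: "q x = lin_potential lam x + S x * (v x)\<^sup>2"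
    define D where "D = D' v y x"
    have dP: "(P has_real_derivative - 2 * H x * P x) (at x within {0..pi})"
      unfolding P_def[abs_def] using h_deriv[OF xI] by (auto intro!: derivative_eq_intros)
    have dS: "(S has_real_derivative 4 * H x * S x) (at x within {0..pi})"
      unfolding S_def[abs_def] using h_deriv[OF xI] by (auto intro!: derivative_eq_intros)
    have "(energy v y has_real_derivative D) (at x within {0..pi})"
    proof (rule DERIV_cong)
      show "(energy v y has_real_derivative
          ((- 2 * H x * P x) * (y x)\<^sup>2 + 2 * y x * - (q x * v x) * P x) / 2 +
          ((4 * H x * S x) * (v x) ^ 4 + 4 * (v x) ^ 3 * (P x * y x) * S x) / 4) (at x within {0..pi})"
        unfolding energy_def[abs_def]
        using dP dS planar_systemD[OF pl xI] by (auto intro!: derivative_eq_intros simp: field_simps)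
      show "((- 2 * H x * P x) * (y x)\<^sup>2 + 2 * y x * - (q x * v x) * P x) / 2 +
          ((4 * H x * S x) * (v x) ^ 4 + 4 * (v x) ^ 3 * (P x * y x) * S x) / 4 = D"
        unfolding q D_def D'_def by (simp add: field_simps power2_eq_square power3_eq_cube power4_eq_xxxx)
    qed
    moreover have "\<bar>D\<bar> \<le> k * energy v y x + e"
    proof -
      define Py Sv where "Py = P x * (y x)\<^sup>2" and "Sv = S x * (v x) ^ 4"
      have nn: "0 \<le> Py" "0 \<le> Sv" using coefficients_pos[of x] by (simp_all add: Py_def Sv_def)
      have E: "energy v y x = Py / 2 + Sv / 4" by (simp add: energy_def Py_def Sv_def)
      have "\<bar>H x * (Sv - Py)\<bar> \<le> CH * (Sv + Py)"
        unfolding abs_mult using b(3) b(4)[OF xI] nn by (intro mult_mono) auto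
      moreover have "CH * (Sv + Py) \<le> CH * (4 * energy v y x)" using E nn b(3) by (intro mult_left_mono) auto
      moreover have "\<bar>lin_potential lam x * (P x * (v x * y x))\<bar> \<le> C0 * (Py / 2 + (PB + PB / \<sigma> * Sv) / 2)"
      proof -
        have v4: "(v x)\<^sup>2 \<le> 1 + (v x) ^ 4"
          using zero_le_power2[of "(v x)\<^sup>2 - 1/2"] by (simp add: power2_eq_square power4_eq_xxxx algebra_simps)
        have "\<sigma> * (v x) ^ 4 \<le> Sv" unfolding Sv_def using b(4)[OF xI] by (intro mult_right_mono) auto
        then have "(v x) ^ 4 \<le> Sv / \<sigma>" using b(2) by (simp add: field_simps)
        with v4 have "P x * (v x)\<^sup>2 \<le> PB * (1 + Sv / \<sigma>)"
          using b(1) b(4)[OF xI] by (intro mult_mono) auto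
        also have "\<dots> = PB + PB / \<sigma> * Sv" by (simp add: algebra_simps)
        finally have Pv: "P x * (v x)\<^sup>2 / 2 \<le> (PB + PB / \<sigma> * Sv) / 2" by simp
        have "\<bar>v x * y x\<bar> \<le> (v x)\<^sup>2 / 2 + (y x)\<^sup>2 / 2"
          using zero_le_power2[of "\<bar>v x\<bar> - \<bar>y x\<bar>"] by (simp add: power2_diff abs_mult)
        then have "P x * \<bar>v x * y x\<bar> \<le> P x * ((v x)\<^sup>2 / 2 + (y x)\<^sup>2 / 2)"
          using coefficients_pos(1)[of x] by (intro mult_left_mono) auto
        also have "\<dots> = Py / 2 + P x * (v x)\<^sup>2 / 2"
          by (simp add: Py_def algebra_simps)
        also have "\<dots> \<le> Py / 2 + (PB + PB / \<sigma> * Sv) / 2" using Pv by (rule add_left_mono)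
        finally have "P x * \<bar>v x * y x\<bar> \<le> Py / 2 + (PB + PB / \<sigma> * Sv) / 2" .
        then have "\<bar>P x * (v x * y x)\<bar> \<le> Py / 2 + (PB + PB / \<sigma> * Sv) / 2"
          using coefficients_pos(1)[of x] by (simp add: abs_mult)
        then show ?thesis
          unfolding abs_mult[of "lin_potential lam x"] using C0(1) C0(2)[OF xI] by (intro mult_mono) auto
      qed
      moreover have "C0 * (Py / 2 + (PB + PB / \<sigma> * Sv) / 2) \<le> (C0 + 2 * C0 * (PB / \<sigma>)) * energy v y x + e"
      proof -
        have "0 \<le> C0 * Sv / 4" "0 \<le> C0 * (PB / \<sigma>) * Py" using C0(1) b nn by auto
        moreover have "(C0 + 2 * C0 * (PB / \<sigma>)) * energy v y x + e =
            C0 * (Py / 2 + (PB + PB / \<sigma> * Sv) / 2) + C0 * Sv / 4 + C0 * (PB / \<sigma>) * Py"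
          unfolding E e_def by (simp add: algebra_simps)
        ultimately show ?thesis by linarith
      qed
      moreover have "k * energy v y x = CH * (4 * energy v y x) + (C0 + 2 * C0 * (PB / \<sigma>)) * energy v y x"
        by (simp add: k_def algebra_simps)
      moreover have "\<bar>D\<bar> \<le> \<bar>H x * (Sv - Py)\<bar> + \<bar>lin_potential lam x * (P x * (v x * y x))\<bar>"
        unfolding D_def D'_def Sv_def Py_def by (rule abs_triangle_ineq4)
      ultimately show ?thesis by linarith
    qed
    ultimately show "(energy v y has_real_derivative D' v y x) (at x within {0..pi}) \<and>
        \<bar>D' v y x\<bar> \<le> k * energy v y x + e"
      unfolding D_def ..
  qed
qed

text \<open>A solution that rotates by a bounded angle is small somewhere, hence by the energy estimate
  everywhere, as long as the truncation is not active.\<close>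
lemma trunc_solution_bound_focusing:
  obtains M1 where "\<And>M s \<theta> \<rho> x. M1 \<le> M \<Longrightarrow> trunc_solution 1 lam M n s \<theta> \<rho> \<Longrightarrow> x \<in> {0..pi} \<Longrightarrow>
    s\<^sup>2 * exp (2 * \<rho> x) \<le> M"
proof -
  obtain C0 where C0: "C0 > 0" "\<And>x. x \<in> {0..pi} \<Longrightarrow> \<bar>lin_potential lam x\<bar> \<le> C0"
    using continuous_on_Icc_bounded[OF cont_lin_potential] by metis
  obtain pm PB \<sigma> SB where b: "pm > 0" "PB > 0" "\<sigma> > 0" "SB > 0"
      "\<And>x. x \<in> {0..pi} \<Longrightarrow> pm \<le> P x \<and> P x \<le> PB \<and> \<sigma> \<le> S x \<and> S x \<le> SB"
    using coefficient_bounds by metis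
  obtain m0 where m0: "m0 > 0" "\<And>q \<theta>. prufer_angle P q \<theta> \<Longrightarrow> 0 \<le> \<theta> 0 \<Longrightarrow>
    (\<And>x. x \<in> {0..pi} \<Longrightarrow> - C0 + m0 * (sin (\<theta> x))\<^sup>2 \<le> q x) \<Longrightarrow> (real n + 1) * pi < \<theta> pi"
    by (rule rotation_large) blast
  obtain k e D where k: "k \<ge> 0" "e \<ge> 0" "\<And>v y q x. x \<in> {0..pi} \<Longrightarrow> planar_system P q v y \<Longrightarrow>
      q x = lin_potential lam x + S x * (v x)\<^sup>2 \<Longrightarrow>
      (energy v y has_real_derivative D v y x) (at x within {0..pi}) \<and> \<bar>D v y x\<bar> \<le> k * energy v y x + e"
    by (rule energy_derivative[of lam]) blast
  \<comment> \<open>If the squared radius were at least \<open>r0\<close> everywhere, then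
    \<open>S * min r M >= m0\<close>, and the angle would end beyond \<open>(n + 1) * pi\<close>,
    past its prescribed value.\<close>
  define r0 where "r0 = m0 / \<sigma>"
  have r0: "r0 > 0" using m0(1) b(3) by (simp add: r0_def)
  \<comment> \<open>\<open>E0\<close> bounds the energy at a point where the squared radius is below
    \<open>r0\<close>, \<open>E1\<close> is what Gronwall makes of it over \<open>[0, pi]\<close>,
    and \<open>M1\<close> exceeds \<open>r0\<close> and every squared radius compatible with energy
    \<open>E1\<close>.\<close>
  define E0 where "E0 = PB * r0 / 2 + SB * r0\<^sup>2 / 4"
  define E1 where "E1 = (E0 + e * pi) * exp (k * pi)"
  define M1 where "M1 = r0 + (1 + 4 * E1 / \<sigma> + 2 * E1 / pm) + 1"
  have E01: "E0 \<ge> 0" "E1 \<ge> 0" using b r0 k by (simp_all add: E0_def E1_def)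
  have M1: "r0 < M1" "1 + 4 * E1 / \<sigma> + 2 * E1 / pm < M1" using r0 E01 b by (simp_all add: M1_def add_pos_nonneg)
  show ?thesis
  proof (rule that)
    fix M s \<theta> \<rho> x assume M: "M1 \<le> M" and ts: "trunc_solution 1 lam M n s \<theta> \<rho>" and x: "x \<in> {0..pi}"
    define v where "v = (\<lambda>x. s * exp (\<rho> x) * sin (\<theta> x))"
    define y where "y = (\<lambda>x. s * exp (\<rho> x) * cos (\<theta> x))"
    define q where "q = trunc_potential 1 lam M s \<theta> \<rho>"
    define r where "r x = s\<^sup>2 * exp (2 * \<rho> x)" for x
    have pl: "planar_system P q v y"
      and r: "\<And>x. r x = (v x)\<^sup>2 + (y x)\<^sup>2" "\<And>x. r x * (sin (\<theta> x))\<^sup>2 = (v x)\<^sup>2"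
      using trunc_solution_planar[OF ts] unfolding v_def y_def q_def r_def by auto
    have ang: "prufer_angle P q \<theta>" "prufer_amplitude P q \<theta> \<rho>" "\<theta> 0 = start_angle" "\<theta> pi = final_angle n"
      using ts by (auto simp: trunc_solution_def trunc_flow_def q_def)
    have cr: "continuous_on {0..pi} r"
      unfolding r_def[abs_def] by (intro continuous_intros cont_prufer_amplitude[OF ang(2)])
    have q: "q t = lin_potential lam t + S t * (v t)\<^sup>2" if "r t \<le> M" for t
      using that r(2)[of t] by (simp add: q_def trunc_potential_def r_def min_absorb1)
    have "\<exists>x0\<in>{0..pi}. r x0 < r0"
    proof (rule ccontr)
      assume "\<not> (\<exists>x0\<in>{0..pi}. r x0 < r0)"
      then have big: "r0 \<le> r t" if "t \<in> {0..pi}" for t using that by (meson not_le)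
      have "(real n + 1) * pi < \<theta> pi"
      proof (rule m0(2)[OF ang(1)])
        fix t assume t: "t \<in> {0..pi}"
        have "m0 = \<sigma> * r0" using b by (simp add: r0_def)
        also have "\<dots> \<le> S t * min (r t) M"
          using b(3) b(5)[OF t] r0 big[OF t] M M1 by (intro mult_mono) auto
        finally have "m0 * (sin (\<theta> t))\<^sup>2 \<le> S t * min (r t) M * (sin (\<theta> t))\<^sup>2" by (intro mult_right_mono) auto
        then show "- C0 + m0 * (sin (\<theta> t))\<^sup>2 \<le> q t"
          using C0(2)[OF t] by (simp add: q_def trunc_potential_def r_def mult.assoc)
      qed (use ang start_angle in auto)
      moreover have "final_angle n \<le> (real n + 1) * pi" using end_angle by (simp add: algebra_simps)
      ultimately show False using ang(4) by simp
    qed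
    then obtain x0 where x0: "x0 \<in> {0..pi}" "r x0 < r0" by blast
    have x0E: "energy v y x0 \<le> E0"
    proof -
      have "(y x0)\<^sup>2 \<le> r0" "(v x0)\<^sup>2 \<le> r0"
        using r(1)[of x0] x0(2) zero_le_power2[of "v x0"] zero_le_power2[of "y x0"] by linarith+
      moreover from this(2) have "((v x0)\<^sup>2)\<^sup>2 \<le> r0\<^sup>2" by (intro power_mono) auto
      then have "(v x0) ^ 4 \<le> r0\<^sup>2" by (simp flip: power_mult)
      ultimately have "P x0 * (y x0)\<^sup>2 \<le> PB * r0" "S x0 * (v x0) ^ 4 \<le> SB * r0\<^sup>2"
        using b(2,4) b(5)[OF x0(1)] by (intro mult_mono; simp)+
      then show ?thesis unfolding energy_def E0_def by simp
    qed
    have small: "r t < M" if t: "t \<in> {0..pi}" and E: "energy v y t \<le> E1" for t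
    proof -
      have "\<sigma> * (v t) ^ 4 \<le> S t * (v t) ^ 4" "pm * (y t)\<^sup>2 \<le> P t * (y t)\<^sup>2"
        using b(5)[OF t] by (intro mult_right_mono; simp)+
      moreover have "0 \<le> S t * (v t) ^ 4" "0 \<le> P t * (y t)\<^sup>2" using coefficients_pos[of t] by simp_all
      ultimately have "\<sigma> * (v t) ^ 4 \<le> 4 * E1" "pm * (y t)\<^sup>2 \<le> 2 * E1"
        using E unfolding energy_def by linarith+
      then have "(v t) ^ 4 \<le> 4 * E1 / \<sigma>" "(y t)\<^sup>2 \<le> 2 * E1 / pm" using b by (simp_all add: field_simps)
      moreover have "(v t)\<^sup>2 \<le> 1 + (v t) ^ 4"
        using zero_le_power2[of "(v t)\<^sup>2 - 1/2"] by (simp add: power2_eq_square power4_eq_xxxx algebra_simps)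
      ultimately show ?thesis using r(1)[of t] M1(2) M by linarith
    qed
    have mono: "(E + e * a) * exp (k * a) \<le> E1" if "E \<le> E0" "0 \<le> E" "0 \<le> a" "a \<le> pi" for E a
      unfolding E1_def using that k by (intro mult_mono add_mono) (auto intro: mult_left_mono add_nonneg_nonneg)
    have E_nonneg: "0 \<le> energy v y x0"
      using coefficients_pos[of x0] by (simp add: energy_def)
    \<comment> \<open>This is available only where \<open>r u <= M\<close>, hence the continuity
      arguments below, to the right and to the left of \<open>x0\<close>.\<close>
    have D: "(energy v y has_real_derivative D v y u) (at u within {a..b})" "\<bar>D v y u\<bar> \<le> k * energy v y u + e"
      if "0 \<le> a" "b \<le> pi" "u \<in> {a..b}" "r u \<le> M" for a b u
      using k(3)[OF _ pl q[OF that(4)]] that(1-3) by (auto intro: DERIV_subset)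
    have "r x < M"
    proof (cases "x0 \<le> x")
      case True
      show ?thesis
      proof (rule less_if_bound_improves[where a=x0 and b=pi and f=r])
        show "continuous_on {x0..pi} r" using cr x0 by (auto intro: continuous_on_subset)
        fix t assume t: "t \<in> {x0..pi}" and le: "\<And>u. u \<in> {x0..t} \<Longrightarrow> r u \<le> M"
        have D': "u \<in> {x0..t} \<Longrightarrow> (energy v y has_real_derivative D v y u) (at u within {x0..t})"
          "u \<in> {x0..t} \<Longrightarrow> \<bar>D v y u\<bar> \<le> k * energy v y u + e" for u
          using D[of x0 t u] t x0 le by auto
        have "energy v y t \<le> (energy v y x0 + e * (t - x0)) * exp (k * (t - x0))"
          by (rule gronwall[OF D'(1)]) (use D'(2) k t in \<open>auto simp: abs_le_iff\<close>)
        also have "\<dots> \<le> E1" using t x0 by (intro mono x0E E_nonneg) auto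
        finally show "r t < M" using t x0 by (intro small) auto
      qed (use True x x0 M M1 in auto)
    next
      case False
      show ?thesis
      proof (rule less_if_bound_improves_backward[where a=0 and b=x0 and f=r])
        show "continuous_on {0..x0} r" using cr x0 by (auto intro: continuous_on_subset)
        fix t assume t: "t \<in> {0..x0}" and le: "\<And>u. u \<in> {t..x0} \<Longrightarrow> r u \<le> M"
        have D': "u \<in> {t..x0} \<Longrightarrow> (energy v y has_real_derivative D v y u) (at u within {t..x0})"
          "u \<in> {t..x0} \<Longrightarrow> \<bar>D v y u\<bar> \<le> k * energy v y u + e" for u
          using D[of t x0 u] t x0 le by auto
        have "energy v y t \<le> (energy v y x0 + e * (x0 - t)) * exp (k * (x0 - t))"
          by (rule gronwall_backward[OF D'(1)]) (use D'(2) k t in \<open>auto simp: abs_le_iff\<close>)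
        also have "\<dots> \<le> E1" using t x0 by (intro mono x0E E_nonneg) auto
        finally show "r t < M" using t x0 by (intro small) auto
      qed (use False x x0 M M1 in auto)
    qed
    then show "s\<^sup>2 * exp (2 * \<rho> x) \<le> M" by (simp add: r_def)
  qed
qed

section \<open>Existence and nonexistence for the nonlinear problem\<close>

lemma nonlinear_solution_exists:
  assumes \<delta>: "\<delta> = 1 \<and> rotation lam < final_angle n \<or> \<delta> = - 1 \<and> final_angle n < rotation lam"
  obtains u where "NP_solution \<alpha> q0 lam \<delta> u" "finite (roots u)" "card (roots u) = n"
proof -
  obtain M0 where M0: "\<And>M. M \<ge> M0 \<Longrightarrow> \<exists>s \<theta> \<rho>. trunc_solution \<delta> lam M n s \<theta> \<rho>"
    by (rule trunc_solution_exists[OF \<delta>]) blast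
  obtain M1 where M1: "\<And>M s \<theta> \<rho> x. M1 \<le> M \<Longrightarrow> trunc_solution \<delta> lam M n s \<theta> \<rho> \<Longrightarrow> x \<in> {0..pi} \<Longrightarrow>
    s\<^sup>2 * exp (2 * \<rho> x) \<le> M"
    using trunc_solution_bound_focusing[of lam n] trunc_solution_bound_defocusing[of lam n] \<delta>
    by metis
  obtain s \<theta> \<rho> where ts: "trunc_solution \<delta> lam (max M0 M1) n s \<theta> \<rho>" using M0[of "max M0 M1"] by auto
  show ?thesis
  proof (rule trunc_solution_imp_solution[OF ts M1[OF _ ts]])
    fix u assume "SL_operator \<alpha> q0 u (\<lambda>x. lam * u x + \<delta> * u x ^ 3)" "finite (roots u)" "card (roots u) = n"
    then show thesis by (intro that[of u]) (simp_all add: NP_solution_def)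
  qed auto
qed

text \<open>\<open>u\<close> solves a linear problem whose potential is changed by
  \<open>\<delta> * S * v^2\<close>. This correction has one sign and vanishes only at zeros of
  \<open>sin \<theta>\<close>, so strict comparison moves the final angle strictly off that of the
  eigenfunction.\<close>

lemma nonlinear_solution_root_bound:
  assumes sol: "NP_solution \<alpha> q0 lam \<delta> u" "nonzero u" and rot: "rotation lam = final_angle n"
  shows "finite (roots u)" "\<delta> = 1 \<Longrightarrow> n < card (roots u)" "\<delta> = - 1 \<Longrightarrow> card (roots u) < n"
proof -
  obtain v \<theta> m where v: "continuous_on {0..pi} v" "prufer_angle P (potential lam \<delta> v) \<theta>"
    "\<theta> 0 = start_angle" "\<theta> pi = end_angle + real m * pi"
    "\<And>x. x \<in> {0..pi} \<Longrightarrow> v x = 0 \<longleftrightarrow> sin (\<theta> x) = 0"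
    "finite (roots u)" "card (roots u) = m"
    by (rule SL_operator_imp_prufer[OF sol(1)[unfolded NP_solution_def] sol(2)]) blast
  obtain \<theta>0 where \<theta>0: "prufer_angle P (lin_potential lam) \<theta>0" "\<theta>0 0 = start_angle" "rotation lam = \<theta>0 pi"
    by (rule rotation_exists)
  have init: "\<theta>0 0 = \<theta> 0" "\<theta> 0 = \<theta>0 0" using \<theta>0(2) v(3) by auto
  have pot: "potential lam d v x = lin_potential lam x + d * (S x * (v x)\<^sup>2)" for d x
    by (simp add: potential_def lin_potential_def)
  have nn: "0 \<le> S x * (v x)\<^sup>2" for x using coefficients_pos(3)[of x] by simp
  have z: "sin (\<theta> x) = 0" if "x \<in> {0..pi}" "S x * (v x)\<^sup>2 = 0" for x
    using that v(5)[OF that(1)] coefficients_pos(3)[of x] by auto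
  show "finite (roots u)" by (rule v(6))
  have cancel: "a * pi < b * pi \<Longrightarrow> a < b" for a b :: real
    by (simp add: mult_less_cancel_right_pos)
  show "n < card (roots u)" if "\<delta> = 1"
  proof -
    have "\<theta>0 pi < \<theta> pi"
      by (rule prufer_angle_strict_mono[OF cont_coefficients(1) coefficients_pos(1)
            cont_lin_potential \<theta>0(1) v(2) init(1)])
         (use that nn z in \<open>simp_all add: pot\<close>)
    then show ?thesis using cancel[of "real n" "real m"] rot \<theta>0(3) v(4,7) by simp
  qed
  show "card (roots u) < n" if "\<delta> = - 1"
  proof -
    have "\<theta> pi < \<theta>0 pi"
      by (rule prufer_angle_strict_mono[OF cont_coefficients(1) coefficients_pos(1)
            continuous_on_potential[OF v(1)] v(2) \<theta>0(1) init(2)])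
         (use that nn z in \<open>simp_all add: pot\<close>)
    then show ?thesis using cancel[of "real m" "real n"] rot \<theta>0(3) v(4,7) by simp
  qed
qed

end

text \<open>Solutions with different numbers of roots differ as functions; \<open>1 <= l\<close>
  makes the subtraction \<open>l - 1\<close> on natural numbers injective.\<close>

lemma pairwise_distinct_choice:
  assumes I: "\<And>l. l \<in> I \<Longrightarrow> 1 \<le> l"
    and ex: "\<And>l. l \<in> I \<Longrightarrow> \<exists>u. N u \<and> finite (roots u) \<and> card (roots u) = l - 1"
  shows "\<exists>u. pairwise_distinct I u \<and> (\<forall>l\<in>I. N (u l) \<and> finite (roots (u l)) \<and> card (roots (u l)) = l - 1)"
proof -
  obtain u where u: "\<And>l. l \<in> I \<Longrightarrow> N (u l) \<and> finite (roots (u l)) \<and> card (roots (u l)) = l - 1"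
    using ex by metis
  have "pairwise_distinct I u"
    unfolding pairwise_distinct_def
  proof (intro ballI impI, rule ccontr)
    fix l m assume lm: "l \<in> I" "m \<in> I" "l \<noteq> m" and "\<not> (\<exists>x\<in>{0..pi}. u l x \<noteq> u m x)"
    then have "roots (u l) = roots (u m)" by (auto simp: roots_def)
    then show False using u[OF lm(1)] u[OF lm(2)] I[OF lm(1)] I[OF lm(2)] lm(3) by auto
  qed
  with u show ?thesis by blast
qed

theorem corollary1:
  fixes \<alpha> :: real and q0 :: "real \<Rightarrow> real"
  assumes "q0 \<in> L2"
  shows
    "(\<forall>k\<ge>1. \<forall>lam::real. ereal lam = SL_eigenvalue \<alpha> q0 k \<longrightarrow>
        \<not> (\<exists>u. NP_solution \<alpha> q0 lam 1 u \<and> nonzero u \<and>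
               finite (roots u) \<and> card (roots u) \<le> k - 1) \<and>
        \<not> (\<exists>u. NP_solution \<alpha> q0 lam (- 1) u \<and> nonzero u \<and>
               (infinite (roots u) \<or> card (roots u) \<ge> k - 1)))
     \<and>
     (\<forall>k\<ge>1. \<forall>lam::real.
        SL_eigenvalue \<alpha> q0 (k - 1) < ereal lam \<and> ereal lam < SL_eigenvalue \<alpha> q0 k \<longrightarrow>
        (\<exists>u :: nat \<Rightarrow> real \<Rightarrow> real. pairwise_distinct {k..} u \<and>
           (\<forall>l\<in>{k..}. NP_solution \<alpha> q0 lam 1 (u l) \<and>
              finite (roots (u l)) \<and> card (roots (u l)) = l - 1)))
     \<and>
     (\<forall>k\<ge>1. \<forall>lam::real.
        SL_eigenvalue \<alpha> q0 k < ereal lam \<and> ereal lam < SL_eigenvalue \<alpha> q0 (k + 1) \<longrightarrow>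
        (\<exists>u :: nat \<Rightarrow> real \<Rightarrow> real. pairwise_distinct {1..k} u \<and>
           (\<forall>l\<in>{1..k}. NP_solution \<alpha> q0 lam (- 1) (u l) \<and>
              finite (roots (u l)) \<and> card (roots (u l)) = l - 1)))"
proof -
  interpret sturm_liouville \<alpha> q0 by unfold_locales (rule assms)
  \<comment> \<open>The eigenfunction of number \<open>k\<close> has \<open>k - 1\<close> interior
    roots, hence the index \<open>k - 1\<close> of the final angle.\<close>
  have ev: "\<exists>\<mu>. SL_eigenvalue \<alpha> q0 k = ereal \<mu> \<and> rotation \<mu> = end_angle + real (k - 1) * pi"
    if "k \<ge> 1" for k
    using SL_eigenvalue_rotation[of "k - 1"] that by (metis Suc_diff_1 less_eq_Suc_le One_nat_def)
  show ?thesis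
  proof (intro conjI allI impI)
    fix k :: nat and lam :: real
    assume k: "1 \<le> k" and "ereal lam = SL_eigenvalue \<alpha> q0 k"
    then have rot: "rotation lam = end_angle + real (k - 1) * pi" using ev[OF k] by auto
    show "\<not> (\<exists>u. NP_solution \<alpha> q0 lam 1 u \<and> nonzero u \<and> finite (roots u) \<and> card (roots u) \<le> k - 1)"
      using nonlinear_solution_root_bound(2)[OF _ _ rot refl] by (blast dest: leD)
    show "\<not> (\<exists>u. NP_solution \<alpha> q0 lam (- 1) u \<and> nonzero u \<and> (infinite (roots u) \<or> card (roots u) \<ge> k - 1))"
      using nonlinear_solution_root_bound(1)[OF _ _ rot] nonlinear_solution_root_bound(3)[OF _ _ rot refl]
      by (blast dest: leD)
  next
    fix k :: nat and lam :: real
    assume k: "1 \<le> k" and lam: "SL_eigenvalue \<alpha> q0 (k - 1) < ereal lam \<and> ereal lam < SL_eigenvalue \<alpha> q0 k"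
    obtain \<mu> where \<mu>: "SL_eigenvalue \<alpha> q0 k = ereal \<mu>" "rotation \<mu> = end_angle + real (k - 1) * pi"
      using ev[OF k] by blast
    have "lam < \<mu>" using lam \<mu>(1) by simp
    \<comment> \<open>Final angles increase with their index, so lying below the target for
      \<open>k\<close> means lying below the target for every \<open>l >= k\<close>.\<close>
    then have rot: "rotation lam < end_angle + real (k - 1) * pi" using rotation_strict_mono \<mu>(2) by metis
    show "\<exists>u. pairwise_distinct {k..} u \<and>
        (\<forall>l\<in>{k..}. NP_solution \<alpha> q0 lam 1 (u l) \<and> finite (roots (u l)) \<and> card (roots (u l)) = l - 1)"
    proof (rule pairwise_distinct_choice)
      fix l assume l: "l \<in> {k..}"
      show "1 \<le> l" using l k by simp
      have "real (k - 1) * pi \<le> real (l - 1) * pi" using l by (intro mult_right_mono) auto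
      then have "rotation lam < end_angle + real (l - 1) * pi" using rot by linarith
      then show "\<exists>u. NP_solution \<alpha> q0 lam 1 u \<and> finite (roots u) \<and> card (roots u) = l - 1"
        using nonlinear_solution_exists[of 1 lam "l - 1"] by blast
    qed
  next
    fix k :: nat and lam :: real
    assume k: "1 \<le> k" and lam: "SL_eigenvalue \<alpha> q0 k < ereal lam \<and> ereal lam < SL_eigenvalue \<alpha> q0 (k + 1)"
    obtain \<mu> where \<mu>: "SL_eigenvalue \<alpha> q0 k = ereal \<mu>" "rotation \<mu> = end_angle + real (k - 1) * pi"
      using ev[OF k] by blast
    have "\<mu> < lam" using lam \<mu>(1) by simp
    \<comment> \<open>Lying above the target for \<open>k\<close> means lying above those for all
      \<open>l <= k\<close>, which yields \<open>k\<close> solutions.\<close>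
    then have rot: "end_angle + real (k - 1) * pi < rotation lam" using rotation_strict_mono \<mu>(2) by metis
    show "\<exists>u. pairwise_distinct {1..k} u \<and>
        (\<forall>l\<in>{1..k}. NP_solution \<alpha> q0 lam (- 1) (u l) \<and> finite (roots (u l)) \<and> card (roots (u l)) = l - 1)"
    proof (rule pairwise_distinct_choice)
      fix l assume l: "l \<in> {1..k}"
      show "1 \<le> l" using l k by simp
      have "real (l - 1) * pi \<le> real (k - 1) * pi" using l by (intro mult_right_mono) auto
      then have "end_angle + real (l - 1) * pi < rotation lam" using rot by linarith
      then show "\<exists>u. NP_solution \<alpha> q0 lam (- 1) u \<and> finite (roots u) \<and> card (roots u) = l - 1"
        using nonlinear_solution_exists[of "- 1" lam "l - 1"] by blast
    qed
  qed
qed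

end
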